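(* For each $n$ let $G_{(n)}=G_1(n,m,P)$ be the active random intersection graph with $m=m_n$ and $P=P_n$ depending on $n$, and let $X_1=|D_1|$ be the size of the attribute set of vertex $v_1$. Let $m,n\to\infty$ and put $\beta_n=m/n$. Assume that there is a random variable $Z$ such that (i) $X_1\sqrt{n/m}$ converges in distribution to $Z$; (ii-2) $\mathbf{E} Z^2<\infty$ and $\mathbf{E}(X_1\sqrt{n/m})^2$ converges to $\mathbf{E} Z^2$; and that $\mathbf{E} Z>0$. Suppose that $\beta_n\to+\infty$. Then, as $n\to\infty$, $$ cl(r)= \begin{cases} p_e(1+o(1)), & r=0;\\ \beta_n^{-1/2}(z_1/z_2)(1+o(1))+O(n^{-1}), & r=1. \end{cases} $$ In particular, $cl(0)=O(n^{-1})$ and $cl(1)=o(1)$. Furthermore, $$ cl(2)= \begin{cases} 1+o(1), & \text{if } \beta_n/n\to 0;\\[2pt] \dfrac{1}{1+\beta_*(\delta_2-\delta_1)^4\delta_1^{-6}}+o(1), & \text{if } \beta_n/n\to\beta_*\in(0,+\infty);\\[6pt] o(1), & \text{if } \beta_n/n\to+\infty. \end{cases} $$ Assuming, in addition, that $\beta_n^k=o(n)$ for each $k=1,2,3,\dots$, one has $cl(r)=1+o(1)$ for each fixed $r=2,3,\dots$.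
   Context: Active random intersection graph $G_1(n,m,P)$: the vertex set is $V=\{v_1,\dots,v_n\}$, the set of attributes is $W=\{w_1,\dots,w_m\}$, and $P$ is a probability distribution on $\{0,1,\dots,m\}$. Each vertex $v_i$ is assigned a random subset $D_i\subset W$; the sets $D_1,\dots,D_n$ are independent and identically distributed with $\mathbf{P}(D_i=A)=\binom{m}{|A|}^{-1}P(|A|)$ for every $A\subset W$. (Thus $X_i:=|D_i|$ has distribution $P$ and, given its size, $D_i$ is uniformly distributed.) Distinct vertices $v_i,v_j$ are adjacent, written $v_i\sim v_j$, iff $D_i\cap D_j\neq\emptyset$. Notation: $d(v_1,v_2)$ is the number of common neighbours of $v_1$ and $v_2$ in $G_{(n)}$. The clustering function of $G_{(n)}$ is $cl(r)=\mathbf{P}(v_1\sim v_2\mid d(v_1,v_2)=r)$, $r=0,1,2,\dots$, and the edge probability is $p_e=\mathbf{P}(v_1\sim v_2)$; both depend on $n$. Further $z_k=\mathbf{E} Z^k$, and $\delta_k=\mathbf{E} d_*^k$, where $d_*$ is a random variable with the mixed Poisson distribution $\mathbf{P}(d_*=k)=\mathbf{E}\, e^{-z_1Z}(z_1Z)^k/k!$, $k=0,1,\dots$. *)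

theory Defs
  imports "HOL-Probability.Probability" "HOL-Library.Landau_Symbols"
begin

section \<open>The active random intersection graph\<close>

text \<open>
  The attributes are \<open>1, \<dots>, m\<close>. The size distribution \<open>P\<close> is meant to be supported on
  \<open>{0, \<dots>, m}\<close>; the bind draws the size first and then a uniform set of that size.
\<close>
definition attribute_set_pmf :: "nat \<Rightarrow> nat pmf \<Rightarrow> nat set pmf" where
  "attribute_set_pmf m P =
     bind_pmf P (\<lambda>k. pmf_of_set {A. A \<subseteq> {1..m} \<and> card A = k})"

lemma pmf_attribute_set_pmf:
  assumes P: "set_pmf P \<subseteq> {..m}" and A: "A \<subseteq> {1..m}"
  shows "pmf (attribute_set_pmf m P) A = pmf P (card A) / real (m choose card A)"
proof -
  let ?S = "\<lambda>k. {B. B \<subseteq> {1..m} \<and> card B = k}"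
  have fin: "finite (?S k)" for k
    by (rule finite_subset[of _ "Pow {1..m}"]) auto
  have card: "card (?S k) = m choose k" for k
    using n_subsets[of "{1..m}" k] by simp
  have "pmf (attribute_set_pmf m P) A = (\<integral>k. pmf (pmf_of_set (?S k)) A \<partial>measure_pmf P)"
    by (simp add: attribute_set_pmf_def pmf_bind)
  also have "\<dots> = (\<integral>k. indicator {card A} k / real (m choose card A) \<partial>measure_pmf P)"
  proof (rule integral_cong_AE)
    show "AE k in measure_pmf P. pmf (pmf_of_set (?S k)) A =
            indicator {card A} k / real (m choose card A)"
    proof (rule AE_pmfI)
      fix k assume "k \<in> set_pmf P"
      then have "k \<le> m" using P by auto
      then have "card (?S k) \<noteq> 0" unfolding card by simp
      then have ne: "?S k \<noteq> {}" by (metis card.empty)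
      show "pmf (pmf_of_set (?S k)) A =
            indicator {card A} k / real (m choose card A)"
        unfolding pmf_of_set[OF ne fin] card using A by (auto simp: indicator_def)
    qed
  qed auto
  also have "\<dots> = pmf P (card A) / real (m choose card A)"
    by (simp add: measure_pmf_single)
  finally show ?thesis .
qed

text \<open>
  The vertices are \<open>1, \<dots>, n\<close>. An outcome assigns to each vertex its attribute set (and \<open>{}\<close> to
  every index outside \<open>{1..n}\<close>); the attribute sets of the vertices are i.i.d.
\<close>
definition active_rig :: "nat \<Rightarrow> nat \<Rightarrow> nat pmf \<Rightarrow> (nat \<Rightarrow> nat set) pmf" where
  "active_rig n m P = Pi_pmf {1..n} {} (\<lambda>_. attribute_set_pmf m P)"

definition adjacent :: "(nat \<Rightarrow> nat set) \<Rightarrow> nat \<Rightarrow> nat \<Rightarrow> bool" where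
  "adjacent D i j \<longleftrightarrow> i \<noteq> j \<and> D i \<inter> D j \<noteq> {}"

definition common_nbrs :: "nat \<Rightarrow> (nat \<Rightarrow> nat set) \<Rightarrow> nat \<Rightarrow> nat \<Rightarrow> nat" where
  "common_nbrs n D i j = card {k \<in> {1..n}. adjacent D k i \<and> adjacent D k j}"

definition edge_prob :: "nat \<Rightarrow> nat \<Rightarrow> nat pmf \<Rightarrow> real" where
  "edge_prob n m P = \<P>(D in measure_pmf (active_rig n m P). adjacent D 1 2)"

definition clustering_fun :: "nat \<Rightarrow> nat \<Rightarrow> nat pmf \<Rightarrow> nat \<Rightarrow> real" where
  "clustering_fun n m P r =
     \<P>(D in measure_pmf (active_rig n m P). adjacent D 1 2 \<bar> common_nbrs n D 1 2 = r)"


section \<open>The mixed Poisson distribution\<close>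

text \<open>
  \<open>Y\<close> is the random rate. The formula defines a distribution only for an almost surely
  nonnegative rate; see the lemma below.
\<close>
definition mixed_poisson :: "'a measure \<Rightarrow> ('a \<Rightarrow> real) \<Rightarrow> nat pmf" where
  "mixed_poisson M Y = embed_pmf (\<lambda>k. \<integral>\<omega>. exp (- Y \<omega>) * Y \<omega> ^ k / fact k \<partial>M)"

lemma pmf_mixed_poisson:
  assumes M: "prob_space M" and [measurable]: "Y \<in> borel_measurable M"
    and nonneg: "AE \<omega> in M. 0 \<le> Y \<omega>"
  shows "pmf (mixed_poisson M Y) k = (\<integral>\<omega>. exp (- Y \<omega>) * Y \<omega> ^ k / fact k \<partial>M)"
proof -
  interpret prob_space M by fact
  define g where "g = (\<lambda>k \<omega>. exp (- Y \<omega>) * Y \<omega> ^ k / fact k)"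
  have meas [measurable]: "g k \<in> borel_measurable M" for k
    unfolding g_def by measurable
  have g_sums: "(\<lambda>k. g k \<omega>) sums 1" for \<omega>
  proof -
    have "(\<lambda>k. exp (- Y \<omega>) * (Y \<omega> ^ k /\<^sub>R fact k)) sums (exp (- Y \<omega>) * exp (Y \<omega>))"
      by (intro sums_mult exp_converges)
    then show ?thesis
      by (simp add: g_def exp_minus field_simps scaleR_conv_of_real)
  qed
  have g_nonneg: "AE \<omega> in M. \<forall>k. 0 \<le> g k \<omega>"
    using nonneg by eventually_elim (auto simp: g_def)
  have g_le: "AE \<omega> in M. norm (g k \<omega>) \<le> 1" for k
    using g_nonneg
  proof eventually_elim
    case (elim \<omega>)
    have "sum (\<lambda>k. g k \<omega>) {k} \<le> (\<Sum>k. g k \<omega>)"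
      using elim g_sums[of \<omega>] by (intro sum_le_suminf) (auto simp: sums_iff)
    then show ?case
      using elim g_sums[of \<omega>] by (simp add: sums_iff)
  qed
  have g_int: "integrable M (g k)" for k
    by (rule integrable_const_bound[OF g_le]) measurable
  have int_nonneg: "0 \<le> integral\<^sup>L M (g k)" for k
    using g_nonneg by (intro integral_nonneg_AE) (auto elim: eventually_mono)
  have "(\<integral>\<^sup>+k. ennreal (integral\<^sup>L M (g k)) \<partial>count_space UNIV)
        = (\<Sum>k. \<integral>\<^sup>+\<omega>. ennreal (g k \<omega>) \<partial>M)"
    using g_nonneg by (subst nn_integral_count_space_nat, intro suminf_cong
        nn_integral_eq_integral[symmetric] g_int) (auto elim: eventually_mono)
  also have "\<dots> = (\<integral>\<^sup>+\<omega>. (\<Sum>k. ennreal (g k \<omega>)) \<partial>M)"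
    by (rule nn_integral_suminf[symmetric]) measurable
  also have "\<dots> = (\<integral>\<^sup>+\<omega>. 1 \<partial>M)"
  proof (rule nn_integral_cong_AE)
    show "AE \<omega> in M. (\<Sum>k. ennreal (g k \<omega>)) = 1"
      using g_nonneg
    proof eventually_elim
      case (elim \<omega>)
      have "(\<Sum>k. ennreal (g k \<omega>)) = ennreal (\<Sum>k. g k \<omega>)"
        using elim g_sums[of \<omega>] by (intro suminf_ennreal2) (auto simp: sums_iff)
      then show ?case
        using g_sums[of \<omega>] by (simp add: sums_iff)
    qed
  qed
  also have "\<dots> = 1" by (simp add: emeasure_space_1)
  finally have "pmf (embed_pmf (\<lambda>k. integral\<^sup>L M (g k))) k = integral\<^sup>L M (g k)"
    by (intro pmf_embed_pmf int_nonneg)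
  then show ?thesis
    by (simp add: mixed_poisson_def g_def)
qed

end

(* Condition on D_1 = A and D_2 = B. The number of common neighbours is then binomial with n - 2
   trials and success probability q(A,B), the probability that a third attribute set meets both A
   and B. With s = |A \<inter> B| and X = |D_3|,
     q \<le> s E X / m + |A| |B| E (X choose 2) / (m choose 2),
   and both terms are sharp to leading order: the first one bounds q from below as soon as s \<ge> 1,
   the second one (up to a factor 1 + o(1), for truncated set sizes) when s = 0. Since X is of
   order sqrt \<beta>, adjacent vertices have s = 1 up to events of probability O(1/n^2), so that
     P(edge, d = r) \<ge> (1 + o(1)) n^-1 \<beta>^(-r/2) z_1^(r+2) / r!, with a matching upper bound
       for r \<le> 2 up to additive errors O(n^-2) for r = 1 and o(n^-2) for r = 2,
     P(no edge, d = r) ~ n^-r z_2^r z_r^2 / r! for r = 1, 2,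
     P(no edge, d = r) = O(n^-2) for r \<ge> 2.
   The clustering function is read off from these. Convergence of second moments makes the squares
   uniformly integrable, which replaces higher moments wherever they would be needed. *)

theory Submission
  imports Defs
begin

section \<open>Uniform random sets of random size\<close>

text \<open>Only second moments of the normalised sizes converge, and this bites in the upper bound
  for adjacent pairs with two common neighbours. There both \<open>u\<^sup>2 x\<^sup>2\<close> on
  the edge event and \<open>u x\<close> on two shared attributes (\<open>x = |A| |B|\<close>,
  \<open>u = N mu 2\<close>) would lead to third moments of the sizes. The cure is to cap a factor
  at 1 before taking expectations; both terms then reduce to the single quantity \<open>T\<close>,
  which tends to 0. The transition of cl(2) compares n^-1 \<beta>^-1 z_1^4 / 2 with n^-2 z_2^4 / 2,
  so the natural parameter is the limit \<gamma> of n / \<beta>. The value \<gamma> = 0 covers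
  \<beta> / n tending to infinity. The case \<beta> / n tending to 0 lies outside this scale; it is
  settled by the lower bound for edges against the O(n^-2) bound for non-edges, an argument that
  serves all r \<ge> 2 at once. The constant can be written with degree moments because \<delta>_1 =
  z_1^2 and \<delta>_2 - \<delta>_1 = z_1^2 z_2, whence (\<delta>_2 - \<delta>_1)^4 \<delta>_1^-6 =
  (z_2 / z_1)^4.\<close>

lemma expectation_bind_finite:
  fixes h :: "'b \<Rightarrow> real"
  assumes "finite (set_pmf p)" "\<And>x. x \<in> set_pmf p \<Longrightarrow> finite (set_pmf (f x))"
  shows "measure_pmf.expectation (bind_pmf p f) h =
    measure_pmf.expectation p (\<lambda>x. measure_pmf.expectation (f x) h)"
proof -
  have "measure_pmf.expectation p (\<lambda>x. measure_pmf.expectation (f x) h) =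
      (\<Sum>x\<in>set_pmf p. pmf p x *\<^sub>R measure_pmf.expectation (f x) h)"
    by (rule integral_measure_pmf) (use assms in auto)
  moreover have "measure_pmf.expectation (bind_pmf p f) h =
      (\<Sum>x\<in>set_pmf p. pmf p x *\<^sub>R measure_pmf.expectation (f x) h)"
    by (rule pmf_expectation_bind) (use assms in auto)
  ultimately show ?thesis by (rule trans[OF _ sym, rotated])
qed

lemma card_supersets_of_card:
  assumes U: "finite U" and T: "T \<subseteq> U" "card T \<le> k"
  shows "card {C. C \<subseteq> U \<and> card C = k \<and> T \<subseteq> C} = (card U - card T) choose (k - card T)"
proof -
  have fT: "finite T" using U T finite_subset by blast
  have "bij_betw (\<lambda>C. C - T) {C. C \<subseteq> U \<and> card C = k \<and> T \<subseteq> C} {B. B \<subseteq> U - T \<and> card B = k - card T}"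
  proof (rule bij_betw_byWitness[where f' = "\<lambda>B. B \<union> T"])
    show "(\<lambda>C. C - T) ` {C. C \<subseteq> U \<and> card C = k \<and> T \<subseteq> C} \<subseteq> {B. B \<subseteq> U - T \<and> card B = k - card T}"
      using fT by (auto simp: card_Diff_subset)
    show "(\<lambda>B. B \<union> T) ` {B. B \<subseteq> U - T \<and> card B = k - card T} \<subseteq> {C. C \<subseteq> U \<and> card C = k \<and> T \<subseteq> C}"
    proof safe
      fix B assume B: "B \<subseteq> U - T" "card B = k - card T"
      then have "finite B" using U finite_subset by blast
      with B fT T show "card (B \<union> T) = k"
        by (subst card_Un_disjoint) auto
    qed (use T in auto)
  qed auto
  then have "card {C. C \<subseteq> U \<and> card C = k \<and> T \<subseteq> C} = card {B. B \<subseteq> U - T \<and> card B = k - card T}"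
    by (rule bij_betw_same_card)
  also have "\<dots> = card (U - T) choose (k - card T)"
    using U by (simp add: n_subsets)
  finally show ?thesis using fT T by (simp add: card_Diff_subset)
qed

text \<open>Reduces expectations of binomial coefficients of an intersection size, by linearity, to
  the probability of containing a fixed set.\<close>

lemma sum_card_subsets_indicator:
  assumes "finite A"
  shows "real (card (A \<inter> C) choose i) = (\<Sum>S | S \<subseteq> A \<and> card S = i. of_bool (S \<subseteq> C))"
proof -
  have "card (A \<inter> C) choose i = card {S. S \<subseteq> A \<inter> C \<and> card S = i}"
    using assms n_subsets[of "A \<inter> C" i] by simp
  also have "{S. S \<subseteq> A \<inter> C \<and> card S = i} = {S. (S \<subseteq> A \<and> card S = i) \<and> S \<subseteq> C}" by auto
  also have "real (card \<dots>) = (\<Sum>S\<in>{S. (S \<subseteq> A \<and> card S = i) \<and> S \<subseteq> C}. 1)" by simp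
  also have "\<dots> = (\<Sum>S\<in>{S. S \<subseteq> A \<and> card S = i}. of_bool (S \<subseteq> C))"
    using assms by (intro sum.mono_neutral_cong_left) auto
  finally show ?thesis .
qed

locale random_attribute_set =
  fixes m :: nat and P :: "nat pmf"
  assumes support: "set_pmf P \<subseteq> {..m}"
begin

abbreviation ED :: "(nat set \<Rightarrow> real) \<Rightarrow> real" where
  "ED f \<equiv> measure_pmf.expectation (attribute_set_pmf m P) f"

abbreviation ES :: "(nat \<Rightarrow> real) \<Rightarrow> real" where
  "ES f \<equiv> measure_pmf.expectation P f"

lemma finite_support: "finite (set_pmf P)"
  using support finite_subset by blast

lemma subsets_of_card:
  assumes "k \<le> m"
  shows "finite {A. A \<subseteq> {1..m} \<and> card A = k}" "{A. A \<subseteq> {1..m} \<and> card A = k} \<noteq> {}"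
    "card {A. A \<subseteq> {1..m} \<and> card A = k} = m choose k"
proof -
  show "finite {A. A \<subseteq> {1..m} \<and> card A = k}"
    by (rule finite_subset[of _ "Pow {1..m}"]) auto
  show c: "card {A. A \<subseteq> {1..m} \<and> card A = k} = m choose k"
    using n_subsets[of "{1..m}" k] by simp
  show "{A. A \<subseteq> {1..m} \<and> card A = k} \<noteq> {}"
    using c assms by (metis binomial_eq_0_iff card.empty leD)
qed

lemma set_attribute_set_pmf: "A \<in> set_pmf (attribute_set_pmf m P) \<Longrightarrow> A \<subseteq> {1..m}"
proof -
  assume "A \<in> set_pmf (attribute_set_pmf m P)"
  then obtain k where k: "k \<in> set_pmf P"
    and A: "A \<in> set_pmf (pmf_of_set {A. A \<subseteq> {1..m} \<and> card A = k})"
    by (auto simp: attribute_set_pmf_def)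
  then have "k \<le> m" using support by auto
  then show ?thesis using A subsets_of_card[of k] by simp
qed

lemma finite_attribute_set: "A \<in> set_pmf (attribute_set_pmf m P) \<Longrightarrow> finite A"
  by (rule finite_subset[OF set_attribute_set_pmf]) auto

lemma finite_set_attribute_set_pmf: "finite (set_pmf (attribute_set_pmf m P))"
  by (rule finite_subset[of _ "Pow {1..m}"]) (use set_attribute_set_pmf in blast, simp)

lemma integrable_ED [simp, intro]: "integrable (measure_pmf (attribute_set_pmf m P)) (f :: _ \<Rightarrow> real)"
  by (rule integrable_measure_pmf_finite[OF finite_set_attribute_set_pmf])

lemma integrable_ES [simp, intro]: "integrable (measure_pmf P) (f :: _ \<Rightarrow> real)"
  by (rule integrable_measure_pmf_finite[OF finite_support])

lemma ED_mono:
  "(\<And>A. A \<subseteq> {1..m} \<Longrightarrow> finite A \<Longrightarrow> f A \<le> g A) \<Longrightarrow> ED f \<le> ED g"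
  by (intro integral_mono_AE AE_pmfI integrable_ED) (simp_all add: set_attribute_set_pmf finite_attribute_set del: One_nat_def)

lemma ED_cong:
  "(\<And>A. A \<subseteq> {1..m} \<Longrightarrow> finite A \<Longrightarrow> f A = g A) \<Longrightarrow> ED f = ED g"
  by (intro integral_cong_AE AE_pmfI) (simp_all add: set_attribute_set_pmf finite_attribute_set del: One_nat_def)

lemma ED_nonneg: "(\<And>A. A \<subseteq> {1..m} \<Longrightarrow> finite A \<Longrightarrow> 0 \<le> f A) \<Longrightarrow> 0 \<le> ED f"
  by (intro integral_nonneg_AE AE_pmfI) (simp_all add: set_attribute_set_pmf finite_attribute_set del: One_nat_def)

lemma ES_mono: "(\<And>k. k \<le> m \<Longrightarrow> f k \<le> g k) \<Longrightarrow> ES f \<le> ES g"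
  using support by (intro integral_mono_AE) (auto intro!: AE_pmfI)

lemma ES_nonneg: "(\<And>k. k \<le> m \<Longrightarrow> 0 \<le> f k) \<Longrightarrow> 0 \<le> ES f"
  using support by (intro integral_nonneg_AE) (auto intro!: AE_pmfI)

lemma ED_eq:
  "ED f = ES (\<lambda>k. (\<Sum>A | A \<subseteq> {1..m} \<and> card A = k. f A) / real (m choose k))"
proof -
  have "ED f = ES (\<lambda>k. measure_pmf.expectation (pmf_of_set {A. A \<subseteq> {1..m} \<and> card A = k}) f)"
    unfolding attribute_set_pmf_def using finite_support subsets_of_card support
    by (subst expectation_bind_finite) (auto)
  also have "\<dots> = ES (\<lambda>k. (\<Sum>A | A \<subseteq> {1..m} \<and> card A = k. f A) / real (m choose k))"
    using support subsets_of_card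
    by (intro integral_cong_AE AE_pmfI) (auto simp: integral_pmf_of_set)
  finally show ?thesis .
qed

lemma ED_card: "ED (\<lambda>A. f (card A)) = ES f"
  unfolding ED_eq
proof (intro integral_cong_AE AE_pmfI)
  fix k assume "k \<in> set_pmf P"
  then have "k \<le> m" using support by auto
  have "(\<Sum>A | A \<subseteq> {1..m} \<and> card A = k. f (card A)) = (\<Sum>A | A \<subseteq> {1..m} \<and> card A = k. f k)"
    by (rule sum.cong) auto
  with subsets_of_card[OF \<open>k \<le> m\<close>] \<open>k \<le> m\<close>
  show "(\<Sum>A | A \<subseteq> {1..m} \<and> card A = k. f (card A)) / real (m choose k) = f k"
    by simp
qed auto

text \<open>For \<open>g = 1\<close> and \<open>t \<le> m\<close> this is the probability that a
  random attribute set contains \<open>t\<close> prescribed attributes. The weight \<open>g\<close>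
  later truncates the size of the set.\<close>

definition binom_moment :: "nat \<Rightarrow> (nat \<Rightarrow> real) \<Rightarrow> real" where
  "binom_moment t g = ES (\<lambda>k. real (k choose t) * g k) / real (m choose t)"

text \<open>With \<open>t = card T\<close>: given size \<open>k\<close>, the uniform set contains
  \<open>T\<close> with probability \<open>(k choose t) / (m choose t)\<close>, by the identity
  \<open>(m choose k) (k choose t) = (m choose t) ((m - t) choose (k - t))\<close>.\<close>

lemma ED_superset:
  assumes T: "T \<subseteq> {1..m}"
  shows "ED (\<lambda>C. of_bool (T \<subseteq> C) * g (card C)) = binom_moment (card T) g"
proof -
  have tm: "card T \<le> m" using card_mono[OF _ T] by simp
  have "(\<Sum>A | A \<subseteq> {1..m} \<and> card A = k. of_bool (T \<subseteq> A) * g (card A)) / real (m choose k)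
      = real (k choose card T) * g k / real (m choose card T)" if k: "k \<le> m" for k
  proof -
    have "(\<Sum>A | A \<subseteq> {1..m} \<and> card A = k. of_bool (T \<subseteq> A) * g (card A))
        = (\<Sum>A | A \<subseteq> {1..m} \<and> card A = k \<and> T \<subseteq> A. g k)"
      using subsets_of_card[OF k] by (intro sum.mono_neutral_cong_right) auto
    also have "\<dots> = real (card {A. A \<subseteq> {1..m} \<and> card A = k \<and> T \<subseteq> A}) * g k" by simp
    finally have 1: "(\<Sum>A | A \<subseteq> {1..m} \<and> card A = k. of_bool (T \<subseteq> A) * g (card A))
        = real (card {A. A \<subseteq> {1..m} \<and> card A = k \<and> T \<subseteq> A}) * g k" .
    show ?thesis
    proof (cases "card T \<le> k")
      case True
      have "real (m choose k) * real (k choose card T) = real (m choose card T) * real ((m - card T) choose (k - card T))"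
        using choose_mult[OF True k] by (metis of_nat_mult)
      moreover have "real (m choose k) > 0" "real (m choose card T) > 0" using k tm by auto
      ultimately show ?thesis unfolding 1 using card_supersets_of_card[OF _ T True]
        by (simp add: field_simps)
    next
      case False
      then have e: "{A. A \<subseteq> {1..m} \<and> card A = k \<and> T \<subseteq> A} = {}"
        using card_mono[OF finite_subset[OF _ finite_atLeastAtMost]] by blast
      show ?thesis unfolding 1 e using False by simp
    qed
  qed
  then have "ED (\<lambda>C. of_bool (T \<subseteq> C) * g (card C)) =
      ES (\<lambda>k. real (k choose card T) * g k / real (m choose card T))"
    unfolding ED_eq using support by (intro integral_cong_AE AE_pmfI) auto
  then show ?thesis by (simp add: binom_moment_def)
qed

text \<open>The product counts pairs of an \<open>i\<close>-subset of \<open>A\<close> and a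
  \<open>j\<close>-subset of \<open>B\<close> lying inside \<open>C\<close>. Disjointness gives
  every union exactly \<open>i + j\<close> elements, so all pairs contribute the same
  moment.\<close>

lemma ED_choose_disjoint:
  assumes A: "A \<subseteq> {1..m}" and B: "B \<subseteq> {1..m}" and disj: "A \<inter> B = {}"
  shows "ED (\<lambda>C. real (card (A \<inter> C) choose i) * real (card (B \<inter> C) choose j) * g (card C)) =
    real (card A choose i) * real (card B choose j) * binom_moment (i + j) g"
proof -
  have fin: "finite A" "finite B" using A B by (auto intro: finite_subset[OF _ finite_atLeastAtMost])
  let ?SA = "{S. S \<subseteq> A \<and> card S = i}" and ?SB = "{S. S \<subseteq> B \<and> card S = j}"
  have eq: "real (card (A \<inter> C) choose i) * real (card (B \<inter> C) choose j) * g (card C) =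
      (\<Sum>S\<in>?SA. \<Sum>T\<in>?SB. of_bool (S \<union> T \<subseteq> C) * g (card C))" for C
    unfolding sum_card_subsets_indicator[OF fin(1)] sum_card_subsets_indicator[OF fin(2)]
      sum_product unfolding sum_distrib_right
    by (intro sum.cong refl) auto
  have "ED (\<lambda>C. real (card (A \<inter> C) choose i) * real (card (B \<inter> C) choose j) * g (card C))
     = (\<Sum>S\<in>?SA. \<Sum>T\<in>?SB. ED (\<lambda>C. of_bool (S \<union> T \<subseteq> C) * g (card C)))"
    unfolding eq by (subst Bochner_Integration.integral_sum, blast)+ (rule refl)
  also have "\<dots> = (\<Sum>S\<in>?SA. \<Sum>T\<in>?SB. binom_moment (i + j) g)"
  proof (intro sum.cong refl)
    fix S T assume S: "S \<in> ?SA" and T: "T \<in> ?SB"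
    then have "S \<subseteq> A" "T \<subseteq> B" by auto
    then have "S \<inter> T = {}" "finite S" "finite T"
      using disj by (blast, auto intro: finite_subset[OF _ fin(1)] finite_subset[OF _ fin(2)])
    then have "card (S \<union> T) = i + j" using S T by (simp add: card_Un_disjoint)
    moreover have "S \<union> T \<subseteq> {1..m}" using S T A B by blast
    ultimately show "ED (\<lambda>C. of_bool (S \<union> T \<subseteq> C) * g (card C)) = binom_moment (i + j) g"
      using ED_superset by metis
  qed
  also have "\<dots> = real (card A choose i) * real (card B choose j) * binom_moment (i + j) g"
    using fin by (simp add: n_subsets)
  finally show ?thesis .
qed

lemma ED_choose:
  assumes A: "A \<subseteq> {1..m}"
  shows "ED (\<lambda>C. real (card (A \<inter> C) choose i) * g (card C)) = real (card A choose i) * binom_moment i g"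
  using ED_choose_disjoint[OF A, of "{}" i 0 g] by simp

end

section \<open>Binomial weights and common neighbours\<close>

definition binomial_weight :: "nat \<Rightarrow> real \<Rightarrow> nat \<Rightarrow> real" where
  "binomial_weight N q r = real (N choose r) * q ^ r * (1 - q) ^ (N - r)"

lemma two_choose_two: "2 * real (k choose 2) = real k * (real k - 1)"
proof -
  have "2 * (k choose 2) = k * (k - 1)"
    by (cases k) (auto simp: choose_two)
  then have "real (2 * (k choose 2)) = real (k * (k - 1))" by (simp only:)
  then show ?thesis by (cases k) (auto simp: algebra_simps)
qed

lemma two_choose_le: "real (k choose 2) * 2 \<le> real k * real k"
  using two_choose_two[of k] by (simp add: right_diff_distrib)

text \<open>The identity \<open>3 (j choose 3) = (j choose 2) (j - 2)\<close> at \<open>k\<close>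
  and at \<open>m\<close>. It trades a third moment for a second one at the price of a factor that
  becomes small once \<open>k\<close> is truncated.\<close>

lemma choose_3_le:
  assumes "3 \<le> m" "k \<le> m"
  shows "real (k choose 3) / real (m choose 3) \<le> real (k choose 2) / real (m choose 2) * (real k / real (m - 2))"
proof -
  have 3: "3 * real (j choose 3) = real (j choose 2) * real (j - 2)" if "j \<ge> 2" for j :: nat
  proof -
    have "(j choose 3) * (3 choose 2) = (j choose 2) * ((j - 2) choose (3 - 2))" if "j \<ge> 3"
      using that by (intro choose_mult) auto
    then have "3 * (j choose 3) = (j choose 2) * (j - 2)"
      using that by (cases "j = 2") (auto simp: numeral_3_eq_3 numeral_2_eq_2)
    then have "real (3 * (j choose 3)) = real ((j choose 2) * (j - 2))" by (simp only:)
    then show ?thesis by (simp only: of_nat_mult of_nat_numeral)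
  qed
  show ?thesis
  proof (cases "k \<ge> 2")
    case True
    have "real (k choose 3) / real (m choose 3) = (3 * real (k choose 3)) / (3 * real (m choose 3))" by simp
    also have "\<dots> = real (k choose 2) / real (m choose 2) * (real (k - 2) / real (m - 2))"
      using 3[of k] 3[of m] True assms by simp
    also have "\<dots> \<le> real (k choose 2) / real (m choose 2) * (real k / real (m - 2))"
      by (intro mult_left_mono divide_right_mono) auto
    finally show ?thesis .
  qed (simp add: binomial_eq_0)
qed

lemma one_le_card_Int: "finite A \<Longrightarrow> A \<inter> B \<noteq> {} \<Longrightarrow> 1 \<le> card (A \<inter> B)"
  by (simp add: Suc_le_eq card_gt_0_iff)

lemma square_eq_choose: "real s * real s = real s + 2 * real (s choose 2)"
  unfolding two_choose_two by (simp add: algebra_simps)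

context
  fixes q :: real
  assumes q: "0 \<le> q" "q \<le> 1"
begin

lemma binomial_weight_eq_pmf: "binomial_weight N q r = pmf (binomial_pmf N q) r"
  using q by (simp add: binomial_weight_def)

lemma binomial_weight_nonneg: "0 \<le> binomial_weight N q r"
  by (simp add: binomial_weight_eq_pmf)

lemma binomial_weight_le_1: "binomial_weight N q r \<le> 1"
  by (simp add: binomial_weight_eq_pmf pmf_le_1)

lemma choose_power_le: "real (N choose r) * q ^ r \<le> (real N * q) ^ r"
proof (cases "r \<le> N")
  case True
  then have "real (N choose r) \<le> real N ^ r"
    using binomial_le_pow[OF True] by (metis of_nat_le_iff of_nat_power)
  then show ?thesis using q by (simp add: power_mult_distrib mult_right_mono)
qed (use q in \<open>simp add: binomial_eq_0\<close>)

lemma binomial_weight_le: "binomial_weight N q r \<le> real (N choose r) * q ^ r"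
proof -
  have "(1 - q) ^ (N - r) \<le> 1" using q by (intro power_le_one) auto
  then show ?thesis unfolding binomial_weight_def
    using q by (intro mult_left_le) auto
qed

text \<open>If \<open>N q \<le> 1\<close>, the power \<open>(N q) ^ Suc r\<close> is at most
  \<open>N q\<close>; otherwise the trivial bound 1 does it. As \<open>N q\<close> may be large, the
  bound can be averaged over all pairs of sets.\<close>

lemma binomial_weight_le_1': "binomial_weight N q (Suc r) \<le> real N * q"
proof (cases "real N * q \<le> 1")
  case True
  have "binomial_weight N q (Suc r) \<le> (real N * q) ^ Suc r"
    using binomial_weight_le choose_power_le order_trans by blast
  also have "\<dots> \<le> real N * q"
    using True q by (simp add: mult_left_le power_le_one)
  finally show ?thesis .
next
  case False then show ?thesis using binomial_weight_le_1[of N "Suc r"] by simp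
qed

text \<open>Capping the exponent at two is what lets every \<open>r \<ge> 2\<close> be treated with
  second moments.\<close>

lemma binomial_weight_le_square: "binomial_weight N q (Suc (Suc r)) \<le> (real N * q)\<^sup>2"
proof (cases "real N * q \<le> 1")
  case True
  have "binomial_weight N q (Suc (Suc r)) \<le> (real N * q) ^ (2 + r)"
    using binomial_weight_le[of N "Suc (Suc r)"] choose_power_le[of N "Suc (Suc r)"] by simp
  also have "\<dots> = (real N * q)\<^sup>2 * (real N * q) ^ r" by (rule power_add)
  also have "\<dots> \<le> (real N * q)\<^sup>2"
    using True q by (intro mult_left_le power_le_one) auto
  finally show ?thesis .
next
  case False
  then have "1 \<le> (real N * q)\<^sup>2" by (intro one_le_power) auto
  then show ?thesis using binomial_weight_le_1[of N "Suc (Suc r)"] by simp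
qed

text \<open>Keeps the factor 1/2 that the general quadratic bound loses; the exact limit of
  \<open>cl 2\<close> depends on it.\<close>

lemma binomial_weight_2_le: "binomial_weight N q 2 \<le> (real N * q)\<^sup>2 / 2"
proof -
  have "2 * real (N choose 2) = real N * (real N - 1)" by (rule two_choose_two)
  also have "\<dots> \<le> (real N)\<^sup>2"
    by (simp add: power2_eq_square right_diff_distrib)
  finally have "real (N choose 2) * q\<^sup>2 \<le> (real N)\<^sup>2 / 2 * q\<^sup>2"
    by (intro mult_right_mono) auto
  then show ?thesis using binomial_weight_le[of N 2] by (simp add: power_mult_distrib)
qed

text \<open>Bernoulli's inequality applied to \<open>(1 - q) ^ (N - r)\<close>.\<close>

lemma binomial_weight_ge: "real (N choose r) * q ^ r * (1 - real N * q) \<le> binomial_weight N q r"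
proof -
  have "1 - real N * q \<le> 1 + real (N - r) * (- q)"
    using q by (simp add: mult_right_mono)
  also have "\<dots> \<le> (1 + (- q)) ^ (N - r)"
    using q by (intro Bernoulli_inequality) auto
  finally show ?thesis unfolding binomial_weight_def
    using q by (intro mult_left_mono) auto
qed

end

context random_attribute_set
begin

abbreviation ED2 :: "(nat set \<Rightarrow> nat set \<Rightarrow> real) \<Rightarrow> real" where
  "ED2 F \<equiv> ED (\<lambda>A. ED (\<lambda>B. F A B))"

abbreviation ES2 :: "(nat \<Rightarrow> nat \<Rightarrow> real) \<Rightarrow> real" where
  "ES2 F \<equiv> ES (\<lambda>k. ES (\<lambda>l. F k l))"

definition wedge_prob :: "nat set \<Rightarrow> nat set \<Rightarrow> real" where
  "wedge_prob A B = measure_pmf.prob (attribute_set_pmf m P) {C. C \<inter> A \<noteq> {} \<and> C \<inter> B \<noteq> {}}"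

lemma wedge_prob_bounds: "0 \<le> wedge_prob A B" "wedge_prob A B \<le> 1"
  by (auto simp: wedge_prob_def)

lemma wedge_prob_eq: "wedge_prob A B = ED (\<lambda>C. of_bool (C \<inter> A \<noteq> {} \<and> C \<inter> B \<noteq> {}))"
proof -
  have "wedge_prob A B = ED (indicator {C. C \<inter> A \<noteq> {} \<and> C \<inter> B \<noteq> {}})"
    by (simp add: wedge_prob_def)
  also have "indicator {C. C \<inter> A \<noteq> {} \<and> C \<inter> B \<noteq> {}} = (\<lambda>C. of_bool (C \<inter> A \<noteq> {} \<and> C \<inter> B \<noteq> {}) :: real)"
    by (auto simp: fun_eq_iff)
  finally show ?thesis .
qed

text \<open>The relation \<open>R\<close> is arbitrary so that edge with degree, degree alone and
  edge alone are all instances. Vertices 1 and 2 are split off from the product; given their sets,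
  each of the other \<open>n - 2\<close> vertices is a common neighbour independently with
  probability \<open>wedge_prob A B\<close>.\<close>

lemma prob_active_rig:
  assumes n: "2 \<le> n"
  shows "measure_pmf.prob (active_rig n m P) {D. R (D 1) (D 2) (common_nbrs n D 1 2)} =
    ED2 (\<lambda>A B. measure_pmf.prob (binomial_pmf (n - 2) (wedge_prob A B)) {r. R A B r})"
proof -
  let ?p = "attribute_set_pmf m P" and ?Q = "\<lambda>D. R (D 1) (D 2) (common_nbrs n D 1 2)"
  have set: "{1..n} = insert 1 (insert 2 {3..n})" using n by auto
  have rig: "active_rig n m P = bind_pmf ?p (\<lambda>A. bind_pmf ?p (\<lambda>B.
      map_pmf (\<lambda>f. (f(2 := B))(1 := A)) (Pi_pmf {3..n} {} (\<lambda>_. ?p))))"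
    unfolding active_rig_def set
    by (simp add: Pi_pmf_insert' bind_assoc_pmf bind_return_pmf map_pmf_def)
  \<comment> \<open>The event is turned into the mass at \<open>True\<close> of a Boolean image,
    because \<open>pmf_bind\<close> then carries the computation through the two outer
    binds.\<close>
  have inner: "pmf (map_pmf ?Q (map_pmf (\<lambda>f. (f(2 := B))(1 := A)) (Pi_pmf {3..n} {} (\<lambda>_. ?p)))) True
     = measure_pmf.prob (binomial_pmf (n - 2) (wedge_prob A B)) {r. R A B r}" for A B
  proof -
    define h where "h = (\<lambda>C. C \<inter> A \<noteq> {} \<and> C \<inter> B \<noteq> {})"
    have cn: "common_nbrs n ((f(2 := B))(1 := A)) 1 2 = card {k \<in> {3..n}. h (f k)}" for f
    proof -
      \<comment> \<open>Indices 1 and 2 drop out because \<open>adjacent\<close> requires distinct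
        endpoints.\<close>
      have "{k \<in> {1..n}. adjacent ((f(2 := B))(1 := A)) k 1 \<and> adjacent ((f(2 := B))(1 := A)) k 2}
          = {k \<in> {3..n}. h (f k)}"
        using n by (auto simp: adjacent_def h_def)
      then show ?thesis by (simp add: common_nbrs_def)
    qed
    have "map_pmf h ?p = bernoulli_pmf (wedge_prob A B)"
    proof (rule pmf_eqI)
      fix b
      have 1: "pmf (map_pmf h ?p) True = wedge_prob A B"
        by (simp add: pmf_map wedge_prob_def h_def vimage_def)
      have "pmf (map_pmf h ?p) False = 1 - wedge_prob A B"
        by (simp add: pmf_False_conv_True 1)
      then show "pmf (map_pmf h ?p) b = pmf (bernoulli_pmf (wedge_prob A B)) b"
        using 1 by (cases b) (auto simp: wedge_prob_bounds)
    qed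
    then have "binomial_pmf (n - 2) (wedge_prob A B) =
        map_pmf (\<lambda>f. card {x \<in> {3..n}. f x}) (Pi_pmf {3..n} False (\<lambda>_. map_pmf h ?p))"
      using n by (subst binomial_pmf_altdef'[of "{3..n}"]) (auto simp: wedge_prob_bounds)
    also have "Pi_pmf {3..n} False (\<lambda>_. map_pmf h ?p) = map_pmf (\<lambda>f. h \<circ> f) (Pi_pmf {3..n} {} (\<lambda>_. ?p))"
      by (rule Pi_pmf_map) (auto simp: h_def)
    finally have bin: "binomial_pmf (n - 2) (wedge_prob A B) =
        map_pmf (\<lambda>f. card {x \<in> {3..n}. h (f x)}) (Pi_pmf {3..n} {} (\<lambda>_. ?p))"
      by (simp add: pmf.map_comp o_def)
    have "(\<lambda>f. ?Q ((f(2 := B))(1 := A))) = (\<lambda>f. R A B (card {k \<in> {3..n}. h (f k)}))"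
      unfolding cn by simp
    then show ?thesis
      unfolding bin pmf.map_comp o_def by (simp add: pmf_map vimage_def)
  qed
  have "measure_pmf.prob (active_rig n m P) {D. ?Q D} = pmf (map_pmf ?Q (active_rig n m P)) True"
    by (simp add: pmf_map vimage_def)
  also have "\<dots> = ED2 (\<lambda>A B. measure_pmf.prob (binomial_pmf (n - 2) (wedge_prob A B)) {r. R A B r})"
    unfolding rig map_bind_pmf pmf_bind inner ..
  finally show ?thesis .
qed

definition edge_degree_prob :: "nat \<Rightarrow> nat \<Rightarrow> real" where
  "edge_degree_prob N r =
     ED2 (\<lambda>A B. of_bool (A \<inter> B \<noteq> {}) * binomial_weight N (wedge_prob A B) r)"

definition nonedge_degree_prob :: "nat \<Rightarrow> nat \<Rightarrow> real" where
  "nonedge_degree_prob N r =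
     ED2 (\<lambda>A B. of_bool (A \<inter> B = {}) * binomial_weight N (wedge_prob A B) r)"

lemma degree_prob_sum:
  "edge_degree_prob N r + nonedge_degree_prob N r = ED2 (\<lambda>A B. binomial_weight N (wedge_prob A B) r)"
proof -
  have "edge_degree_prob N r + nonedge_degree_prob N r =
     ED2 (\<lambda>A B. of_bool (A \<inter> B \<noteq> {}) * binomial_weight N (wedge_prob A B) r +
       of_bool (A \<inter> B = {}) * binomial_weight N (wedge_prob A B) r)"
    unfolding edge_degree_prob_def nonedge_degree_prob_def by simp
  also have "\<dots> = ED2 (\<lambda>A B. binomial_weight N (wedge_prob A B) r)"
    by (intro ED_cong) auto
  finally show ?thesis .
qed

text \<open>The conditioning event may have probability 0: both sides are then 0 by the convention
  for division.\<close>

lemma clustering_fun_eq: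
  assumes n: "2 \<le> n"
  shows "clustering_fun n m P r =
    edge_degree_prob (n - 2) r / (edge_degree_prob (n - 2) r + nonedge_degree_prob (n - 2) r)"
proof -
  have "measure_pmf.prob (active_rig n m P) {D. adjacent D 1 2 \<and> common_nbrs n D 1 2 = r} =
      edge_degree_prob (n - 2) r"
    unfolding adjacent_def edge_degree_prob_def
    \<comment> \<open>The conjunct \<open>1 \<noteq> 2\<close> makes the instance match the unfolded
      \<open>adjacent\<close>.\<close>
    using prob_active_rig[OF n, of "\<lambda>A B k. 1 \<noteq> (2::nat) \<and> A \<inter> B \<noteq> {} \<and> k = r"]
    by (auto simp: binomial_weight_eq_pmf wedge_prob_bounds measure_pmf_single intro!: ED_cong)
  moreover have "measure_pmf.prob (active_rig n m P) {D. common_nbrs n D 1 2 = r} =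
      edge_degree_prob (n - 2) r + nonedge_degree_prob (n - 2) r"
    unfolding degree_prob_sum
    using prob_active_rig[OF n, of "\<lambda>A B k. k = r"]
    by (simp add: binomial_weight_eq_pmf wedge_prob_bounds measure_pmf_single)
  ultimately show ?thesis by (simp add: clustering_fun_def cond_prob_def)
qed

lemma edge_prob_eq:
  assumes n: "2 \<le> n"
  shows "edge_prob n m P = ED2 (\<lambda>A B. of_bool (A \<inter> B \<noteq> {}))"
  unfolding edge_prob_def adjacent_def
  using prob_active_rig[OF n, of "\<lambda>A B k. 1 \<noteq> (2::nat) \<and> A \<inter> B \<noteq> {}"]
  by (auto intro!: ED_cong)

lemma expectation_card:
  assumes n: "1 \<le> n"
  shows "measure_pmf.expectation (active_rig n m P) (\<lambda>D. f (card (D 1))) = ES f"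
proof -
  have "measure_pmf.expectation (active_rig n m P) (\<lambda>D. f (card (D 1))) =
     measure_pmf.expectation (map_pmf (\<lambda>D. D 1) (active_rig n m P)) (\<lambda>A. f (card A))"
    by simp
  also have "map_pmf (\<lambda>D. D 1) (active_rig n m P) = attribute_set_pmf m P"
    unfolding active_rig_def using n by (subst Pi_pmf_component) auto
  finally show ?thesis by (simp add: ED_card)
qed

text \<open>For fixed \<open>A\<close> the inner expectation depends on \<open>card A\<close> only,
  so both expectations collapse to expectations over sizes. The factor \<open>F\<close> allows
  truncated or capped functions of the two sizes.\<close>

lemma ED2_choose:
  "ED2 (\<lambda>A B. real (card (A \<inter> B) choose i) * F (card A) (card B)) =
   ES2 (\<lambda>k l. real (k choose i) * real (l choose i) * F k l) / real (m choose i)"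
proof -
  have "ED2 (\<lambda>A B. real (card (A \<inter> B) choose i) * F (card A) (card B)) =
      ED (\<lambda>A. real (card A choose i) * binom_moment i (F (card A)))"
    by (intro ED_cong ED_choose)
  also have "\<dots> = ES (\<lambda>k. real (k choose i) * binom_moment i (F k))"
    by (rule ED_card)
  finally show ?thesis by (simp add: binom_moment_def mult.assoc)
qed

lemma ED2_card: "ED2 (\<lambda>A B. F (card A) (card B)) = ES2 F"
  using ED2_choose[of 0 F] by simp

lemma ES2_mult: "ES2 (\<lambda>k l. f k * g l) = ES f * ES g"
  by simp

lemma ED2_mono:
  assumes "\<And>A B. A \<subseteq> {1..m} \<Longrightarrow> B \<subseteq> {1..m} \<Longrightarrow> finite A \<Longrightarrow> finite B \<Longrightarrow> F A B \<le> G A B"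
  shows "ED2 F \<le> ED2 G"
  by (intro ED_mono assms)

lemma ES2_mono: "(\<And>k l. k \<le> m \<Longrightarrow> l \<le> m \<Longrightarrow> F k l \<le> G k l) \<Longrightarrow> ES2 F \<le> ES2 G"
  by (intro ES_mono)

end

section \<open>Moment bounds\<close>

context random_attribute_set
begin

section \<open>Bounds for the probability that a third set meets two given sets\<close>

definition "mu t = binom_moment t (\<lambda>_. 1)"

lemma binom_moment_nonneg: "(\<And>k. k \<le> m \<Longrightarrow> 0 \<le> g k) \<Longrightarrow> 0 \<le> binom_moment t g"
  unfolding binom_moment_def by (intro divide_nonneg_nonneg ES_nonneg) auto

lemma mu_nonneg: "0 \<le> mu t"
  unfolding mu_def by (rule binom_moment_nonneg) simp

text \<open>A set that meets \<open>A\<close> and \<open>B\<close> either meets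
  \<open>A \<inter> B\<close> or meets both \<open>A - B\<close> and \<open>B - A\<close>. The last
  two are disjoint, so the expected product of the intersection sizes is a second binomial
  moment.\<close>

lemma wedge_prob_le:
  assumes A: "A \<subseteq> {1..m}" and B: "B \<subseteq> {1..m}"
  shows "wedge_prob A B \<le> real (card (A \<inter> B)) * mu 1 + real (card A) * real (card B) * mu 2"
proof -
  have fin: "finite A" "finite B" using A B by (auto intro: finite_subset[OF _ finite_atLeastAtMost])
  have "wedge_prob A B \<le> ED (\<lambda>C. real (card ((A \<inter> B) \<inter> C)) +
      real (card ((A - B) \<inter> C)) * real (card ((B - A) \<inter> C)))"
    unfolding wedge_prob_eq
  proof (rule ED_mono)
    fix C :: "nat set"
    show "of_bool (C \<inter> A \<noteq> {} \<and> C \<inter> B \<noteq> {}) \<le> real (card ((A \<inter> B) \<inter> C)) +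
      real (card ((A - B) \<inter> C)) * real (card ((B - A) \<inter> C))"
    proof (cases "C \<inter> A \<noteq> {} \<and> C \<inter> B \<noteq> {}")
      case wedge: True
      show ?thesis
      proof (cases "(A \<inter> B) \<inter> C = {}")
        case True
        then have "(A - B) \<inter> C \<noteq> {}" "(B - A) \<inter> C \<noteq> {}" using wedge by auto
        then have "1 \<le> card ((A - B) \<inter> C)" "1 \<le> card ((B - A) \<inter> C)"
          using fin by (auto simp: Suc_le_eq card_gt_0_iff)
        then have "1 \<le> card ((A - B) \<inter> C) * card ((B - A) \<inter> C)"
          by (metis mult_le_mono nat_mult_1)
        then have "1 \<le> real (card ((A - B) \<inter> C)) * real (card ((B - A) \<inter> C))"
          by (metis of_nat_1 of_nat_le_iff of_nat_mult)
        then show ?thesis using wedge by simp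
      next
        case False
        then have "1 \<le> card ((A \<inter> B) \<inter> C)"
          using fin by (auto simp: Suc_le_eq card_gt_0_iff)
        then have "1 \<le> real (card ((A \<inter> B) \<inter> C))" by linarith
        then show ?thesis using wedge by (simp add: add_increasing2)
      qed
    qed auto
  qed
  also have "\<dots> = ED (\<lambda>C. real (card ((A \<inter> B) \<inter> C))) +
      ED (\<lambda>C. real (card ((A - B) \<inter> C)) * real (card ((B - A) \<inter> C)))"
    by simp
  also have "ED (\<lambda>C. real (card ((A \<inter> B) \<inter> C))) = real (card (A \<inter> B)) * mu 1"
    using ED_choose[of "A \<inter> B" 1 "\<lambda>_. 1"] A B by (auto simp: mu_def)
  also have "ED (\<lambda>C. real (card ((A - B) \<inter> C)) * real (card ((B - A) \<inter> C)))
      = real (card (A - B)) * real (card (B - A)) * mu 2"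
    using ED_choose_disjoint[of "A - B" "B - A" 1 1 "\<lambda>_. 1"] A B
    by (auto simp: mu_def numeral_2_eq_2)
  also have "real (card (A \<inter> B)) * mu 1 + real (card (A - B)) * real (card (B - A)) * mu 2 \<le>
     real (card (A \<inter> B)) * mu 1 + real (card A) * real (card B) * mu 2"
    using fin by (intro add_left_mono mult_right_mono mult_mono mu_nonneg) (auto intro: card_mono)
  finally show ?thesis .
qed

text \<open>A single shared attribute \<open>w\<close> suffices: every set containing
  \<open>w\<close> meets both \<open>A\<close> and \<open>B\<close>.\<close>

lemma wedge_prob_ge_edge:
  assumes A: "A \<subseteq> {1..m}" and B: "B \<subseteq> {1..m}" and AB: "A \<inter> B \<noteq> {}"
  shows "mu 1 \<le> wedge_prob A B"
proof -
  obtain w where w: "w \<in> A" "w \<in> B" using AB by auto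
  then have "mu 1 = ED (\<lambda>C. of_bool ({w} \<subseteq> C) * 1)"
    using ED_superset[of "{w}" "\<lambda>_. 1"] A by (auto simp: mu_def)
  also have "\<dots> \<le> wedge_prob A B"
    unfolding wedge_prob_eq using w by (intro ED_mono) auto
  finally show ?thesis .
qed

text \<open>With \<open>I = |A \<inter> C|\<close> and \<open>J = |B \<inter> C|\<close>, the indicator of \<open>I, J \<ge> 1\<close> dominates
  \<open>I J (3 - I - J)\<close>, whose expectation involves moments of order at most three; these exist after
  truncating \<open>|C|\<close> at \<open>L\<close>.\<close>

lemma wedge_prob_ge_nonedge:
  assumes A: "A \<subseteq> {1..m}" and B: "B \<subseteq> {1..m}" and AB: "A \<inter> B = {}"
    and L: "real (card A) \<le> L" "real (card B) \<le> L" and m: "3 \<le> m"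
  shows "real (card A) * real (card B) * binom_moment 2 (\<lambda>k. of_bool (real k \<le> L)) *
      (1 - 2 * L\<^sup>2 / real (m - 2)) \<le> wedge_prob A B"
proof -
  define g :: "nat \<Rightarrow> real" where "g = (\<lambda>k. of_bool (real k \<le> L))"
  define a b where "a = real (card A)" and "b = real (card B)"
  have L0: "0 \<le> L" using L(1) by linarith
  \<comment> \<open>On sizes at most \<open>L\<close> the third binomial moment is smaller than the
    second by the factor \<open>L / (m - 2)\<close>.\<close>
  have b3: "binom_moment 3 g \<le> binom_moment 2 g * (L / real (m - 2))"
  proof -
    have "binom_moment 3 g = ES (\<lambda>k. real (k choose 3) / real (m choose 3) * g k)"
      unfolding binom_moment_def by simp
    also have "\<dots> \<le> ES (\<lambda>k. real (k choose 2) / real (m choose 2) * (L / real (m - 2)) * g k)"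
    proof (rule ES_mono)
      fix k assume k: "k \<le> m"
      show "real (k choose 3) / real (m choose 3) * g k \<le>
          real (k choose 2) / real (m choose 2) * (L / real (m - 2)) * g k"
      proof (cases "real k \<le> L")
        case True
        have "real (k choose 3) / real (m choose 3) \<le> real (k choose 2) / real (m choose 2) * (real k / real (m - 2))"
          by (rule choose_3_le[OF m k])
        also have "\<dots> \<le> real (k choose 2) / real (m choose 2) * (L / real (m - 2))"
          using True by (intro mult_left_mono divide_right_mono) auto
        finally show ?thesis by (simp add: g_def)
      qed (simp add: g_def)
    qed
    also have "\<dots> = ES (\<lambda>k. real (k choose 2) * g k * (L / real (m - 2) / real (m choose 2)))"
      by (simp add: field_simps)
    also have "\<dots> = binom_moment 2 g * (L / real (m - 2))"
      unfolding binom_moment_def by simp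
    finally show ?thesis .
  qed
  define IA IB where "IA = (\<lambda>i C. real (card (A \<inter> C) choose i))"
    and "IB = (\<lambda>i C. real (card (B \<inter> C) choose i))"
  have E: "ED (\<lambda>C. IA i C * IB j C * g (card C)) =
      real (card A choose i) * real (card B choose j) * binom_moment (i + j) g" for i j
    unfolding IA_def IB_def by (rule ED_choose_disjoint[OF A B AB])
  have "a * b * binom_moment 2 g - 2 * (real (card A choose 2) * b * binom_moment 3 g)
        - 2 * (a * real (card B choose 2) * binom_moment 3 g)
      = ED (\<lambda>C. IA 1 C * IB 1 C * g (card C) - 2 * (IA 2 C * IB 1 C * g (card C))
         - 2 * (IA 1 C * IB 2 C * g (card C)))"
    using E[of 1 1] E[of 2 1] E[of 1 2] by (simp add: a_def b_def numeral_2_eq_2 numeral_3_eq_3)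
  also have "\<dots> \<le> wedge_prob A B"
    unfolding wedge_prob_eq
  proof (rule ED_mono)
    fix C :: "nat set" assume C: "finite C"
    define i j where "i = card (A \<inter> C)" and "j = card (B \<inter> C)"
    have "i = 0 \<longleftrightarrow> C \<inter> A = {}" "j = 0 \<longleftrightarrow> C \<inter> B = {}" using C by (auto simp: i_def j_def)
    then have ind: "(of_bool (C \<inter> A \<noteq> {} \<and> C \<inter> B \<noteq> {}) :: real) = of_bool (i \<noteq> 0 \<and> j \<noteq> 0)" by simp
    have *: "IA 1 C * IB 1 C * g (card C) - 2 * (IA 2 C * IB 1 C * g (card C))
         - 2 * (IA 1 C * IB 2 C * g (card C)) =
       (real i * real j - (2 * real (i choose 2)) * real j - real i * (2 * real (j choose 2))) * g (card C)"
      by (simp add: IA_def IB_def i_def j_def algebra_simps)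
    also have "\<dots> = real i * real j * (3 - real i - real j) * g (card C)"
      unfolding two_choose_two by (simp add: algebra_simps)
    also have "\<dots> \<le> of_bool (i \<noteq> 0 \<and> j \<noteq> 0)"
    \<comment> \<open>From \<open>i + j = 3\<close> on the product is nonpositive; below that it is
      nonzero only at \<open>i = j = 1\<close>, where it equals the weight \<open>g\<close>, at most
      1.\<close>
    proof (cases "i + j \<ge> 3")
      case True
      then have "real i * real j * (3 - real i - real j) * g (card C) \<le> 0"
        by (intro mult_nonpos_nonneg mult_nonneg_nonpos) (auto simp: g_def)
      then show ?thesis by (simp add: order_trans)
    next
      case False
      then have "i = 0 \<or> j = 0 \<or> (i = 1 \<and> j = 1)" by auto
      then show ?thesis by (auto simp: g_def)
    qed
    finally show "IA 1 C * IB 1 C * g (card C) - 2 * (IA 2 C * IB 1 C * g (card C))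
         - 2 * (IA 1 C * IB 2 C * g (card C)) \<le> of_bool (C \<inter> A \<noteq> {} \<and> C \<inter> B \<noteq> {})"
      unfolding ind .
  qed
  finally have lower: "a * b * binom_moment 2 g - 2 * (real (card A choose 2) * b * binom_moment 3 g)
        - 2 * (a * real (card B choose 2) * binom_moment 3 g) \<le> wedge_prob A B" .
  have b3': "0 \<le> binom_moment 3 g" by (rule binom_moment_nonneg) (simp add: g_def)
  have ab: "0 \<le> a" "0 \<le> b" "a \<le> L" "b \<le> L" using L by (auto simp: a_def b_def)
  \<comment> \<open>Each correction term is smaller than the main one by
    \<open>L\<^sup>2 / (m - 2)\<close>: one factor \<open>L\<close> comes from
    \<open>2 (card A choose 2) \<le> a L\<close>, and \<open>L / (m - 2)\<close> comes from
    \<open>b3\<close>.\<close>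
  have "2 * (real (card A choose 2) * b * binom_moment 3 g) = (real (card A choose 2) * 2) * (b * binom_moment 3 g)"
    by simp
  also have "\<dots> \<le> (a * a) * (b * binom_moment 3 g)"
    using b3' ab two_choose_le[of "card A"] by (intro mult_right_mono) (auto simp: a_def)
  also have "\<dots> = a * b * (a * binom_moment 3 g)" by simp
  also have "\<dots> \<le> a * b * (L * (binom_moment 2 g * (L / real (m - 2))))"
    using b3 b3' ab L0 by (intro mult_left_mono mult_mono) auto
  finally have 1: "2 * (real (card A choose 2) * b * binom_moment 3 g) \<le>
      a * b * binom_moment 2 g * (L\<^sup>2 / real (m - 2))" by (simp add: power2_eq_square mult_ac)
  have "2 * (a * real (card B choose 2) * binom_moment 3 g) = (real (card B choose 2) * 2) * (a * binom_moment 3 g)"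
    by simp
  also have "\<dots> \<le> (b * b) * (a * binom_moment 3 g)"
    using b3' ab two_choose_le[of "card B"] by (intro mult_right_mono) (auto simp: b_def)
  also have "\<dots> = a * b * (b * binom_moment 3 g)" by simp
  also have "\<dots> \<le> a * b * (L * (binom_moment 2 g * (L / real (m - 2))))"
    using b3 b3' ab L0 by (intro mult_left_mono mult_mono) auto
  finally have 2: "2 * (a * real (card B choose 2) * binom_moment 3 g) \<le>
      a * b * binom_moment 2 g * (L\<^sup>2 / real (m - 2))" by (simp add: power2_eq_square mult_ac)
  define T where "T = a * b * binom_moment 2 g * (L\<^sup>2 / real (m - 2))"
  have "a * b * binom_moment 2 g * (1 - 2 * L\<^sup>2 / real (m - 2)) = a * b * binom_moment 2 g - 2 * T"
    by (simp add: right_diff_distrib T_def)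
  also have "\<dots> \<le> wedge_prob A B" using lower 1 2 unfolding T_def[symmetric] by linarith
  finally show ?thesis by (simp add: a_def b_def g_def)
qed

section \<open>Adjacency and small degrees: expectations over two random sets\<close>

definition "e1 = ES (\<lambda>k. real k)"
definition "e2 = ES (\<lambda>k. (real k)\<^sup>2)"
definition "c2 = ES (\<lambda>k. real (k choose 2))"

text \<open>Dominates the expectation of \<open>N q\<close> on the event that the two vertices are adjacent, where
  \<open>q\<close> is the conditional probability of a common neighbour.\<close>

definition edge_wedge_bound :: "nat \<Rightarrow> real" where
  "edge_wedge_bound N = real N * mu 1 * (e1\<^sup>2 / real m + 2 * c2\<^sup>2 / real (m choose 2))
     + real N * mu 2 * (e2\<^sup>2 / real m)"

text \<open>Equals \<open>edge_prob n m P\<close> for every \<open>n \<ge> 2\<close>, by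
  \<open>edge_prob_eq\<close>; the number of vertices does not enter.\<close>

definition two_edge_prob :: real where
  "two_edge_prob = ED2 (\<lambda>A B. of_bool (A \<inter> B \<noteq> {}))"

lemma ED2_card_Int: "ED2 (\<lambda>A B. real (card (A \<inter> B))) = e1\<^sup>2 / real m"
  using ED2_choose[of 1 "\<lambda>_ _. 1"] by (simp add: e1_def power2_eq_square)

lemma ED2_card_Int_choose_2: "ED2 (\<lambda>A B. real (card (A \<inter> B) choose 2)) = c2\<^sup>2 / real (m choose 2)"
  using ED2_choose[of 2 "\<lambda>_ _. 1"] by (simp add: c2_def power2_eq_square)

lemma ED2_card_Int_mult:
  "ED2 (\<lambda>A B. real (card (A \<inter> B)) * (real (card A) * real (card B))) = e2\<^sup>2 / real m"
proof -
  have "ED2 (\<lambda>A B. real (card (A \<inter> B)) * (real (card A) * real (card B))) =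
      ES2 (\<lambda>k l. real k * real l * (real k * real l)) / real m"
    using ED2_choose[of 1 "\<lambda>k l. real k * real l"] by simp
  also have "(\<lambda>k l. real k * real l * (real k * real l)) = (\<lambda>k l. (real k)\<^sup>2 * (real l)\<^sup>2)"
    by (auto simp: fun_eq_iff power2_eq_square)
  finally show ?thesis by (simp add: e2_def power2_eq_square)
qed

lemma two_edge_prob_le: "two_edge_prob \<le> e1\<^sup>2 / real m"
  unfolding two_edge_prob_def ED2_card_Int[symmetric]
proof (rule ED2_mono)
  fix A B :: "nat set" assume "finite A" 
  then show "of_bool (A \<inter> B \<noteq> {}) \<le> real (card (A \<inter> B))"
    using one_le_card_Int[of A B] by (cases "A \<inter> B = {}") auto
qed

text \<open>A weak Bonferroni inequality: with \<open>s = card (A \<inter> B)\<close>, the value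
  \<open>s - 2 (s choose 2) = s (2 - s)\<close> is 1 at \<open>s = 1\<close> and at most 0 at any
  other \<open>s\<close>. The subtracted term turns out to be of order n^-2, against n^-1 for the
  main one.\<close>

lemma two_edge_prob_ge: "e1\<^sup>2 / real m - 2 * c2\<^sup>2 / real (m choose 2) \<le> two_edge_prob"
proof -
  have "e1\<^sup>2 / real m - 2 * c2\<^sup>2 / real (m choose 2) =
      ED2 (\<lambda>A B. real (card (A \<inter> B)) - 2 * real (card (A \<inter> B) choose 2))"
    by (simp add: ED2_card_Int ED2_card_Int_choose_2)
  also have "\<dots> \<le> two_edge_prob"
    unfolding two_edge_prob_def
  proof (rule ED2_mono)
    fix A B :: "nat set" assume "finite A"
    consider "card (A \<inter> B) = 0" | "card (A \<inter> B) = 1" | "card (A \<inter> B) \<ge> 2" by linarith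
    then show "real (card (A \<inter> B)) - 2 * real (card (A \<inter> B) choose 2) \<le> of_bool (A \<inter> B \<noteq> {})"
    proof cases
      case 3
      then have "real (card (A \<inter> B)) * 1 \<le> real (card (A \<inter> B)) * (real (card (A \<inter> B)) - 1)"
        by (intro mult_left_mono) auto
      moreover have "A \<inter> B \<noteq> {}" using 3 by (intro notI) simp
      ultimately show ?thesis unfolding two_choose_two by simp
    next
      case 2
      then have "A \<inter> B \<noteq> {}" by (intro notI) simp
      then show ?thesis using 2 by simp
    qed (use \<open>finite A\<close> in auto)
  qed
  finally show ?thesis .
qed

text \<open>The edge indicator is bounded by \<open>s = card (A \<inter> B)\<close> and
  \<open>wedge_prob\<close> by its linear bound in \<open>s\<close>. The resulting
  \<open>s\<^sup>2\<close> is split into binomial moments, so that the rare case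
  \<open>s \<ge> 2\<close> appears as a separate small term.\<close>

lemma ED2_edge_wedge_le:
  "ED2 (\<lambda>A B. of_bool (A \<inter> B \<noteq> {}) * (real N * wedge_prob A B)) \<le> edge_wedge_bound N"
proof -
  have "ED2 (\<lambda>A B. of_bool (A \<inter> B \<noteq> {}) * (real N * wedge_prob A B)) \<le>
    ED2 (\<lambda>A B. real N * mu 1 * (real (card (A \<inter> B)) + 2 * real (card (A \<inter> B) choose 2))
      + real N * mu 2 * (real (card (A \<inter> B)) * (real (card A) * real (card B))))"
  proof (rule ED2_mono)
    fix A B :: "nat set" assume AB: "A \<subseteq> {1..m}" "B \<subseteq> {1..m}" "finite A"
    define s where "s = real (card (A \<inter> B))"
    have "of_bool (A \<inter> B \<noteq> {}) \<le> s"
      using one_le_card_Int[of A B] AB by (cases "A \<inter> B = {}") (auto simp: s_def)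
    then have "of_bool (A \<inter> B \<noteq> {}) * (real N * wedge_prob A B) \<le>
       s * (real N * (s * mu 1 + real (card A) * real (card B) * mu 2))"
      using wedge_prob_le[OF AB(1,2)] wedge_prob_bounds mu_nonneg
      by (intro mult_mono mult_left_mono) (auto simp: s_def)
    also have "\<dots> = real N * mu 1 * (s * s) + real N * mu 2 * (s * (real (card A) * real (card B)))"
      by (simp add: algebra_simps)
    finally show "of_bool (A \<inter> B \<noteq> {}) * (real N * wedge_prob A B) \<le>
      real N * mu 1 * (real (card (A \<inter> B)) + 2 * real (card (A \<inter> B) choose 2))
      + real N * mu 2 * (real (card (A \<inter> B)) * (real (card A) * real (card B)))"
      unfolding s_def square_eq_choose .
  qed
  also have "\<dots> = edge_wedge_bound N"
    unfolding edge_wedge_bound_def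
    by (simp add: ED2_card_Int ED2_card_Int_choose_2 ED2_card_Int_mult)
  finally show ?thesis .
qed

lemma weight_nonneg: "0 \<le> binomial_weight N (wedge_prob A B) r"
  by (intro binomial_weight_nonneg wedge_prob_bounds)

lemma weight_le_1: "binomial_weight N (wedge_prob A B) r \<le> 1"
  by (intro binomial_weight_le_1 wedge_prob_bounds)

lemma edge_degree_prob_nonneg: "0 \<le> edge_degree_prob N r"
  unfolding edge_degree_prob_def by (intro ED_nonneg mult_nonneg_nonneg weight_nonneg) auto

lemma nonedge_degree_prob_nonneg: "0 \<le> nonedge_degree_prob N r"
  unfolding nonedge_degree_prob_def by (intro ED_nonneg mult_nonneg_nonneg weight_nonneg) auto

text \<open>On an edge the conditional probability is at least \<open>mu 1\<close>, which gives the
  factor in front; the loss \<open>N q\<close> from Bernoulli's inequality is averaged over edges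
  and absorbed in \<open>edge_wedge_bound\<close>.\<close>

lemma edge_degree_prob_ge:
  "real (N choose r) * mu 1 ^ r * (two_edge_prob - edge_wedge_bound N) \<le> edge_degree_prob N r"
proof -
  define c where "c = real (N choose r) * mu 1 ^ r"
  have c: "0 \<le> c" by (simp add: c_def mu_nonneg)
  have "c * (two_edge_prob - edge_wedge_bound N) \<le>
     c * (two_edge_prob - ED2 (\<lambda>A B. of_bool (A \<inter> B \<noteq> {}) * (real N * wedge_prob A B)))"
    using c ED2_edge_wedge_le by (intro mult_left_mono) auto
  also have "\<dots> = ED2 (\<lambda>A B. c * (of_bool (A \<inter> B \<noteq> {}) -
      of_bool (A \<inter> B \<noteq> {}) * (real N * wedge_prob A B)))"
    unfolding two_edge_prob_def by simp
  also have "\<dots> \<le> edge_degree_prob N r"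
    unfolding edge_degree_prob_def
  proof (rule ED2_mono)
    fix A B assume AB: "A \<subseteq> {1..m}" "B \<subseteq> {1..m}"
    let ?q = "wedge_prob A B"
    have "c * (1 - real N * ?q) \<le> binomial_weight N ?q r" if "A \<inter> B \<noteq> {}"
    \<comment> \<open>Replacing the conditional probability by the smaller \<open>mu 1\<close> is
      monotone only if the factor \<open>1 - N q\<close> is nonnegative; otherwise the left side is
      nonpositive anyway.\<close>
    proof (cases "0 \<le> 1 - real N * ?q")
      case True
      have "c \<le> real (N choose r) * ?q ^ r"
        unfolding c_def using wedge_prob_ge_edge[OF AB that] mu_nonneg
        by (intro mult_left_mono power_mono) auto
      then have "c * (1 - real N * ?q) \<le> real (N choose r) * ?q ^ r * (1 - real N * ?q)"
        using True by (intro mult_right_mono)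
      also have "\<dots> \<le> binomial_weight N ?q r"
        by (intro binomial_weight_ge wedge_prob_bounds)
      finally show ?thesis .
    next
      case False
      then have "c * (1 - real N * ?q) \<le> 0" using c by (intro mult_nonneg_nonpos) auto
      then show ?thesis using weight_nonneg order_trans by blast
    qed
    then show "c * (of_bool (A \<inter> B \<noteq> {}) - of_bool (A \<inter> B \<noteq> {}) * (real N * ?q)) \<le>
        of_bool (A \<inter> B \<noteq> {}) * binomial_weight N ?q r"
      by (cases "A \<inter> B = {}") auto
  qed
  finally show ?thesis unfolding c_def .
qed

lemma edge_degree_prob_le_two_edge_prob: "edge_degree_prob N r \<le> two_edge_prob"
  unfolding edge_degree_prob_def two_edge_prob_def
  by (intro ED2_mono mult_left_le weight_le_1) auto

lemma edge_degree_prob_1_le: "edge_degree_prob N 1 \<le> edge_wedge_bound N"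
proof -
  have "edge_degree_prob N 1 \<le> ED2 (\<lambda>A B. of_bool (A \<inter> B \<noteq> {}) * (real N * wedge_prob A B))"
    unfolding edge_degree_prob_def
    using binomial_weight_le_1'[OF wedge_prob_bounds, of N _ _ 0]
    by (intro ED2_mono mult_left_mono) auto
  then show ?thesis using ED2_edge_wedge_le order_trans by blast
qed

lemma degree_prob_0_ge:
  "1 - (real N * mu 1 * (e1\<^sup>2 / real m) + real N * mu 2 * e1\<^sup>2) \<le>
     edge_degree_prob N 0 + nonedge_degree_prob N 0"
proof -
  have "1 - (real N * mu 1 * (e1\<^sup>2 / real m) + real N * mu 2 * e1\<^sup>2) =
     ED2 (\<lambda>A B. 1 - (real N * mu 1 * real (card (A \<inter> B)) +
        real N * mu 2 * (real (card A) * real (card B))))"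
    using ED2_card[of "\<lambda>k l. real k * real l"]
    by (simp add: ED2_card_Int e1_def power2_eq_square)
  also have "\<dots> \<le> edge_degree_prob N 0 + nonedge_degree_prob N 0"
    unfolding degree_prob_sum
  proof (rule ED2_mono)
    fix A B assume AB: "A \<subseteq> {1..m}" "B \<subseteq> {1..m}"
    let ?q = "wedge_prob A B"
    have "real N * ?q \<le> real N * (real (card (A \<inter> B)) * mu 1 + real (card A) * real (card B) * mu 2)"
      using wedge_prob_le[OF AB] by (intro mult_left_mono) auto
    then have "1 - (real N * mu 1 * real (card (A \<inter> B)) + real N * mu 2 * (real (card A) * real (card B)))
      \<le> 1 - real N * ?q" by (simp add: algebra_simps)
    also have "\<dots> \<le> binomial_weight N ?q 0"
      using binomial_weight_ge[OF wedge_prob_bounds, of N 0 A B] by simp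
    finally show "1 - (real N * mu 1 * real (card (A \<inter> B)) + real N * mu 2 * (real (card A) * real (card B)))
      \<le> binomial_weight N ?q 0" .
  qed
  finally show ?thesis .
qed

lemma degree_prob_le_1: "edge_degree_prob N r + nonedge_degree_prob N r \<le> 1"
proof -
  have "ED2 (\<lambda>A B. binomial_weight N (wedge_prob A B) r) \<le> ED2 (\<lambda>A B. 1)"
    by (intro ED2_mono weight_le_1)
  then show ?thesis by (simp add: degree_prob_sum)
qed

section \<open>Non-adjacent pairs\<close>

lemma nonedge_wedge_le:
  assumes "A \<subseteq> {1..m}" "B \<subseteq> {1..m}" "A \<inter> B = {}"
  shows "real N * wedge_prob A B \<le> real N * mu 2 * (real (card A) * real (card B))"
  using mult_left_mono[OF wedge_prob_le[OF assms(1,2)], of "real N"] assms(3)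
  by (simp add: mult_ac)

lemma nonedge_degree_prob_1_le: "nonedge_degree_prob N 1 \<le> real N * mu 2 * e1\<^sup>2"
proof -
  have "nonedge_degree_prob N 1 \<le> ED2 (\<lambda>A B. real N * mu 2 * (real (card A) * real (card B)))"
    unfolding nonedge_degree_prob_def
  proof (rule ED2_mono)
    fix A B assume AB: "A \<subseteq> {1..m}" "B \<subseteq> {1..m}"
    show "of_bool (A \<inter> B = {}) * binomial_weight N (wedge_prob A B) 1
      \<le> real N * mu 2 * (real (card A) * real (card B))"
      using order_trans[OF binomial_weight_le_1'[OF wedge_prob_bounds, of N A B 0] nonedge_wedge_le[OF AB]]
        mu_nonneg[of 2] by (cases "A \<inter> B = {}") auto
  qed
  also have "\<dots> = real N * mu 2 * e1\<^sup>2"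
    using ED2_card[of "\<lambda>k l. real k * real l"] by (simp add: e1_def power2_eq_square)
  finally show ?thesis .
qed

lemma ED2_card_square:
  "ED2 (\<lambda>A B. c * (real N * mu 2 * (real (card A) * real (card B)))\<^sup>2) = c * (real N * mu 2 * e2)\<^sup>2"
proof -
  have "ED2 (\<lambda>A B. c * (real N * mu 2 * (real (card A) * real (card B)))\<^sup>2)
    = ED2 (\<lambda>A B. c * (real N * mu 2)\<^sup>2 * ((real (card A))\<^sup>2 * (real (card B))\<^sup>2))"
    by (simp only: power_mult_distrib mult.assoc)
  also have "\<dots> = c * (real N * mu 2 * e2)\<^sup>2"
    using ED2_card[of "\<lambda>k l. (real k)\<^sup>2 * (real l)\<^sup>2"]
    by (simp add: e2_def power_mult_distrib power2_eq_square)
  finally show ?thesis .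
qed

text \<open>The sharp bound for degree \<open>r\<close> would involve the \<open>r\<close>-th moment
  of the size. The quadratic bound on the weight keeps the estimate at second moments for every
  \<open>r \<ge> 2\<close>.\<close>

lemma nonedge_degree_prob_le_square:
  assumes "2 \<le> r"
  shows "nonedge_degree_prob N r \<le> (real N * mu 2 * e2)\<^sup>2"
proof -
  obtain j where r: "r = Suc (Suc j)" using assms by (metis Suc_le_D numeral_2_eq_2 Suc_le_mono)
  have "nonedge_degree_prob N r \<le> ED2 (\<lambda>A B. 1 * (real N * mu 2 * (real (card A) * real (card B)))\<^sup>2)"
    unfolding nonedge_degree_prob_def
  proof (rule ED2_mono)
    fix A B assume AB: "A \<subseteq> {1..m}" "B \<subseteq> {1..m}"
    let ?q = "wedge_prob A B"
    have "binomial_weight N ?q r \<le> (real N * mu 2 * (real (card A) * real (card B)))\<^sup>2" if "A \<inter> B = {}"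
    proof -
      have "binomial_weight N ?q r \<le> (real N * ?q)\<^sup>2"
        unfolding r by (intro binomial_weight_le_square wedge_prob_bounds)
      also have "\<dots> \<le> (real N * mu 2 * (real (card A) * real (card B)))\<^sup>2"
        using nonedge_wedge_le[OF AB that, of N] wedge_prob_bounds by (intro power_mono) auto
      finally show ?thesis .
    qed
    then show "of_bool (A \<inter> B = {}) * binomial_weight N ?q r
      \<le> 1 * (real N * mu 2 * (real (card A) * real (card B)))\<^sup>2"
      by (cases "A \<inter> B = {}") auto
  qed
  then show ?thesis unfolding ED2_card_square by simp
qed

lemma nonedge_degree_prob_2_le: "nonedge_degree_prob N 2 \<le> (real N * mu 2 * e2)\<^sup>2 / 2"
proof -
  have "nonedge_degree_prob N 2 \<le> ED2 (\<lambda>A B. (1 / 2) * (real N * mu 2 * (real (card A) * real (card B)))\<^sup>2)"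
    unfolding nonedge_degree_prob_def
  proof (rule ED2_mono)
    fix A B assume AB: "A \<subseteq> {1..m}" "B \<subseteq> {1..m}"
    let ?q = "wedge_prob A B"
    have "binomial_weight N ?q 2 \<le> (1 / 2) * (real N * mu 2 * (real (card A) * real (card B)))\<^sup>2" if "A \<inter> B = {}"
    proof -
      have "binomial_weight N ?q 2 \<le> (real N * ?q)\<^sup>2 / 2"
        by (intro binomial_weight_2_le wedge_prob_bounds)
      also have "\<dots> \<le> (real N * mu 2 * (real (card A) * real (card B)))\<^sup>2 / 2"
        using nonedge_wedge_le[OF AB that, of N] wedge_prob_bounds by (intro divide_right_mono power_mono) auto
      finally show ?thesis by simp
    qed
    then show "of_bool (A \<inter> B = {}) * binomial_weight N ?q 2
      \<le> (1 / 2) * (real N * mu 2 * (real (card A) * real (card B)))\<^sup>2"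
      by (cases "A \<inter> B = {}") auto
  qed
  then show ?thesis unfolding ED2_card_square by simp
qed

text \<open>Only pairs of sets of size at most \<open>L\<close> are kept. Three correction factors
  result: \<open>1 - 2 L\<^sup>2 / (m - 2)\<close> from the lower bound on the conditional
  probability, \<open>1 - N mu 2 L\<^sup>2\<close> from Bernoulli's inequality, and
  \<open>1 - L\<^sup>2 / m\<close> from disjointness, since the indicator of
  \<open>A \<inter> B = {}\<close> is at least \<open>1 - card (A \<inter> B)\<close>, whose mean
  given sizes \<open>k\<close>, \<open>l\<close> is \<open>1 - k l / m\<close>.\<close>

lemma nonedge_degree_prob_ge:
  fixes L :: real
  assumes L: "0 \<le> L" and m: "3 \<le> m" and small: "2 * L\<^sup>2 \<le> real (m - 2)" "real N * mu 2 * L\<^sup>2 \<le> 1"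
  shows "real (N choose r) * (binom_moment 2 (\<lambda>k. of_bool (real k \<le> L)) * (1 - 2 * L\<^sup>2 / real (m - 2))) ^ r *
     (1 - real N * mu 2 * L\<^sup>2) * (1 - L\<^sup>2 / real m) * (ES (\<lambda>k. real k ^ r * of_bool (real k \<le> L)))\<^sup>2
    \<le> nonedge_degree_prob N r"
proof -
  define b where "b = binom_moment 2 (\<lambda>k. of_bool (real k \<le> L)) * (1 - 2 * L\<^sup>2 / real (m - 2))"
  define G where "G = (\<lambda>k l. of_bool (real k \<le> L) * of_bool (real l \<le> L) * (real k ^ r * real l ^ r))"
  define c where "c = real (N choose r) * b ^ r * (1 - real N * mu 2 * L\<^sup>2)"
  have G0: "0 \<le> G k l" for k l by (simp add: G_def)
  have b0: "0 \<le> b"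
    unfolding b_def using small(1) m by (intro mult_nonneg_nonneg binom_moment_nonneg) auto
  have c0: "0 \<le> c" unfolding c_def using small(2) b0 by (intro mult_nonneg_nonneg) auto
  have "(1 - L\<^sup>2 / real m) * ES2 G = ES2 (\<lambda>k l. G k l - L\<^sup>2 / real m * G k l)"
    by (simp add: left_diff_distrib)
  also have "\<dots> \<le> ES2 (\<lambda>k l. G k l - real k * real l * G k l / real m)"
  proof (rule ES2_mono)
    fix k l
    show "G k l - L\<^sup>2 / real m * G k l \<le> G k l - real k * real l * G k l / real m"
    proof (cases "real k \<le> L \<and> real l \<le> L")
      case True
      then have "real k * real l \<le> L\<^sup>2" unfolding power2_eq_square by (intro mult_mono) auto
      then have "real k * real l * (G k l / real m) \<le> L\<^sup>2 * (G k l / real m)"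
        by (intro mult_right_mono) (auto simp: G0)
      then show ?thesis by simp
    qed (auto simp: G_def)
  qed
  also have "\<dots> = ES2 G - ES2 (\<lambda>k l. real k * real l * G k l) / real m"
    by simp
  also have "\<dots> = ED2 (\<lambda>A B. G (card A) (card B)) -
      ED2 (\<lambda>A B. real (card (A \<inter> B)) * G (card A) (card B))"
    using ED2_choose[of 1 G] by (simp add: ED2_card)
  also have "\<dots> = ED2 (\<lambda>A B. G (card A) (card B) - real (card (A \<inter> B)) * G (card A) (card B))"
    by simp
  also have "\<dots> \<le> ED2 (\<lambda>A B. of_bool (A \<inter> B = {}) * G (card A) (card B))"
  proof (rule ED2_mono)
    fix A B :: "nat set" assume "finite A"
    then show "G (card A) (card B) - real (card (A \<inter> B)) * G (card A) (card B) \<le>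
        of_bool (A \<inter> B = {}) * G (card A) (card B)"
      using one_le_card_Int[of A B] G0[of "card A" "card B"]
        mult_right_mono[of 1 "real (card (A \<inter> B))" "G (card A) (card B)"]
      by (cases "A \<inter> B = {}") auto
  qed
  finally have "c * ((1 - L\<^sup>2 / real m) * ES2 G) \<le> c * ED2 (\<lambda>A B. of_bool (A \<inter> B = {}) * G (card A) (card B))"
    using c0 by (intro mult_left_mono)
  also have "\<dots> = ED2 (\<lambda>A B. c * (of_bool (A \<inter> B = {}) * G (card A) (card B)))"
    by simp
  also have "\<dots> \<le> nonedge_degree_prob N r"
    unfolding nonedge_degree_prob_def
  proof (rule ED2_mono)
    fix A B assume AB: "A \<subseteq> {1..m}" "B \<subseteq> {1..m}"
    let ?q = "wedge_prob A B" and ?x = "real (card A) * real (card B)"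
    show "c * (of_bool (A \<inter> B = {}) * G (card A) (card B)) \<le> of_bool (A \<inter> B = {}) * binomial_weight N ?q r"
    proof (cases "A \<inter> B = {} \<and> real (card A) \<le> L \<and> real (card B) \<le> L")
      case True
      then have x: "?x \<le> L\<^sup>2" unfolding power2_eq_square by (intro mult_mono) auto
      have "real N * ?q \<le> real N * mu 2 * ?x" using True AB by (intro nonedge_wedge_le) auto
      also have "\<dots> \<le> real N * mu 2 * L\<^sup>2" using x mu_nonneg by (intro mult_left_mono) auto
      finally have Nq: "1 - real N * mu 2 * L\<^sup>2 \<le> 1 - real N * ?q" by simp
      have q: "?x * b \<le> ?q"
        using wedge_prob_ge_nonedge[OF AB, of L] True m by (simp add: b_def mult.assoc)
      have "c * G (card A) (card B) = real (N choose r) * (?x * b) ^ r * (1 - real N * mu 2 * L\<^sup>2)"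
        using True by (simp add: c_def G_def power_mult_distrib mult_ac)
      also have "\<dots> \<le> real (N choose r) * ?q ^ r * (1 - real N * ?q)"
        using q b0 Nq small(2) wedge_prob_bounds by (intro mult_mono mult_left_mono power_mono) auto
      also have "\<dots> \<le> binomial_weight N ?q r"
        by (intro binomial_weight_ge wedge_prob_bounds)
      finally show ?thesis using True by simp
    next
      case False
      then show ?thesis using weight_nonneg by (auto simp: G_def)
    qed
  qed
  also have "ES2 G = (ES (\<lambda>k. real k ^ r * of_bool (real k \<le> L)))\<^sup>2"
  proof -
    have "ES2 G = ES2 (\<lambda>k l. (real k ^ r * of_bool (real k \<le> L)) * (real l ^ r * of_bool (real l \<le> L)))"
      by (simp add: G_def mult_ac)
    then show ?thesis unfolding ES2_mult by (simp add: power2_eq_square)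
  qed
  finally show ?thesis by (simp add: c_def b_def mult.assoc)
qed

section \<open>Upper bound for adjacent pairs with two common neighbours\<close>

lemma ED2_edge_le_min:
  assumes F: "\<And>k l. 0 \<le> F k l" and m: "0 < m"
  shows "ED2 (\<lambda>A B. of_bool (A \<inter> B \<noteq> {}) * F (card A) (card B)) \<le>
    ES2 (\<lambda>k l. min 1 (real k * real l / real m) * F k l)"
proof -
  \<comment> \<open>Where \<open>k l \<le> m\<close> the edge indicator is bounded by the
    intersection size, whose mean is \<open>k l / m\<close>; elsewhere it is bounded by 1. Together
    this is the capped weight.\<close>
  define F1 F2 where "F1 = (\<lambda>k l. of_bool (k * l \<le> m) * F k l)" and "F2 = (\<lambda>k l. of_bool (\<not> k * l \<le> m) * F k l)"
  have "ED2 (\<lambda>A B. of_bool (A \<inter> B \<noteq> {}) * F (card A) (card B)) \<le>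
     ED2 (\<lambda>A B. real (card (A \<inter> B)) * F1 (card A) (card B) + F2 (card A) (card B))"
  proof (rule ED2_mono)
    fix A B :: "nat set" assume "finite A"
    then show "of_bool (A \<inter> B \<noteq> {}) * F (card A) (card B) \<le>
      real (card (A \<inter> B)) * F1 (card A) (card B) + F2 (card A) (card B)"
      using one_le_card_Int[of A B] F[of "card A" "card B"]
        mult_right_mono[of 1 "real (card (A \<inter> B))" "F (card A) (card B)"]
      by (cases "A \<inter> B = {}") (auto simp: F1_def F2_def)
  qed
  also have "\<dots> = ES2 (\<lambda>k l. real k * real l * F1 k l) / real m + ES2 F2"
    using ED2_choose[of 1 F1] by (simp add: ED2_card)
  also have "\<dots> = ES2 (\<lambda>k l. real k * real l * F1 k l / real m + F2 k l)"
    by simp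
  also have "\<dots> = ES2 (\<lambda>k l. min 1 (real k * real l / real m) * F k l)"
  proof -
    have "real k * real l * F1 k l / real m + F2 k l = min 1 (real k * real l / real m) * F k l" for k l
    proof (cases "k * l \<le> m")
      case True
      then have "real k * real l \<le> real m" by (metis of_nat_le_iff of_nat_mult)
      then show ?thesis using m True by (simp add: F1_def F2_def min_def)
    next
      case False
      then have "real k * real l > real m" by (metis of_nat_less_iff of_nat_mult not_le)
      then show ?thesis using m False by (simp add: F1_def F2_def min_def field_simps)
    qed
    then show ?thesis by simp
  qed
  finally show ?thesis .
qed

text \<open>Only the first summand matters in the limit, and its 1/2 is sharp. The first three come
  from one shared attribute, by expanding \<open>(a + u x)\<^sup>2 / 2\<close> with
  \<open>x = card A * card B\<close>; the last two from at least two shared attributes. The caps in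
  the third and fifth summands avoid third moments of the sizes.\<close>

lemma edge_degree_prob_2_le:
  fixes N :: nat
  assumes m: "0 < m"
  defines "a \<equiv> real N * mu 1" and "u \<equiv> real N * mu 2"
  shows "edge_degree_prob N 2 \<le> a\<^sup>2 / 2 * (e1\<^sup>2 / real m) + a * u * (e2\<^sup>2 / real m)
     + u\<^sup>2 / 2 * ES2 (\<lambda>k l. min 1 (real k * real l / real m) * ((real k)\<^sup>2 * (real l)\<^sup>2))
     + 2 * a * (c2\<^sup>2 / real (m choose 2))
     + ES2 (\<lambda>k l. real (k choose 2) * real (l choose 2) * min 1 (u * (real k * real l))) / real (m choose 2)"
proof -
  have au: "0 \<le> a" "0 \<le> u" by (simp_all add: a_def u_def mu_nonneg)
  have "edge_degree_prob N 2 \<le> ED2 (\<lambda>A B.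
      a\<^sup>2 / 2 * real (card (A \<inter> B))
    + a * u * (real (card (A \<inter> B)) * (real (card A) * real (card B)))
    + u\<^sup>2 / 2 * (of_bool (A \<inter> B \<noteq> {}) * ((real (card A))\<^sup>2 * (real (card B))\<^sup>2))
    + 2 * a * real (card (A \<inter> B) choose 2)
    + real (card (A \<inter> B) choose 2) * min 1 (u * (real (card A) * real (card B))))"
    unfolding edge_degree_prob_def
  proof (rule ED2_mono)
    fix A B :: "nat set" assume AB: "A \<subseteq> {1..m}" "B \<subseteq> {1..m}" and fin: "finite A"
    let ?q = "wedge_prob A B"
    define s x where "s = card (A \<inter> B)" and "x = real (card A) * real (card B)"
    have x0: "0 \<le> x" by (simp add: x_def)
    have ux0: "0 \<le> u * x" using au x0 by simp
    have xx: "x\<^sup>2 = (real (card A))\<^sup>2 * (real (card B))\<^sup>2" by (simp add: x_def power_mult_distrib)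
    have s0: "A \<inter> B = {} \<longleftrightarrow> s = 0" using fin by (auto simp: s_def)
    have Nq: "real N * ?q \<le> real s * a + u * x"
      using mult_left_mono[OF wedge_prob_le[OF AB], of "real N"]
      by (simp add: s_def x_def a_def u_def algebra_simps)
    have "of_bool (s \<noteq> 0) * binomial_weight N ?q 2 \<le> a\<^sup>2 / 2 * real s + a * u * (real s * x)
       + u\<^sup>2 / 2 * (of_bool (s \<noteq> 0) * x\<^sup>2) + 2 * a * real (s choose 2) + real (s choose 2) * min 1 (u * x)"
    proof -
      consider "s = 0" | "s = 1" | "s \<ge> 2" by linarith
      then show ?thesis
      proof cases
        case 2
        have "binomial_weight N ?q 2 \<le> (real N * ?q)\<^sup>2 / 2"
          by (intro binomial_weight_2_le wedge_prob_bounds)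
        also have "\<dots> \<le> (a + u * x)\<^sup>2 / 2"
          using Nq 2 wedge_prob_bounds by (intro divide_right_mono power_mono) auto
        also have "\<dots> = a\<^sup>2 / 2 + a * u * x + u\<^sup>2 / 2 * x\<^sup>2"
          by (simp add: power2_sum power_mult_distrib field_simps)
        finally show ?thesis using 2 by (simp add: binomial_eq_0)
      next
        \<comment> \<open>With two or more shared attributes a bound linear in \<open>N q\<close> is
          enough, because \<open>s choose 2\<close> is at least 1 and at least \<open>s / 2\<close>
          and can pay for it. The cap is kept on \<open>u x\<close> only: \<open>s a\<close>
          involves no further factor in the sizes.\<close>
        case 3
        have c1: "1 \<le> real (s choose 2)"
          using 3 by (metis One_nat_def Suc_leI of_nat_1 of_nat_le_iff zero_less_binomial_iff)
        have c2: "real s \<le> 2 * real (s choose 2)"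
          using mult_left_mono[of 1 "real s - 1" "real s"] 3 unfolding two_choose_two by simp
        have "binomial_weight N ?q 2 \<le> min 1 (real N * ?q)"
          using binomial_weight_le_1'[OF wedge_prob_bounds, of N A B 1] weight_le_1[of N A B 2]
          by (simp add: numeral_2_eq_2)
        also have "\<dots> \<le> real s * a + min 1 (u * x)"
          using Nq mult_nonneg_nonneg[OF of_nat_0_le_iff au(1), of s] by linarith
        also have "\<dots> \<le> 2 * real (s choose 2) * a + real (s choose 2) * min 1 (u * x)"
          using c1 c2 au ux0 mult_right_mono[of 1 "real (s choose 2)" "min 1 (u * x)"]
          by (intro add_mono mult_right_mono) auto
        finally show ?thesis using 3 au x0
          by (simp add: add_increasing mult_ac add.assoc)
      qed (simp add: binomial_eq_0)
    qed
    then show "of_bool (A \<inter> B \<noteq> {}) * binomial_weight N ?q 2 \<le>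
      a\<^sup>2 / 2 * real (card (A \<inter> B))
      + a * u * (real (card (A \<inter> B)) * (real (card A) * real (card B)))
      + u\<^sup>2 / 2 * (of_bool (A \<inter> B \<noteq> {}) * ((real (card A))\<^sup>2 * (real (card B))\<^sup>2))
      + 2 * a * real (card (A \<inter> B) choose 2)
      + real (card (A \<inter> B) choose 2) * min 1 (u * (real (card A) * real (card B)))"
      unfolding s0 xx[symmetric] x_def[symmetric] s_def[symmetric] .
  qed
  also have "\<dots> = a\<^sup>2 / 2 * (e1\<^sup>2 / real m) + a * u * (e2\<^sup>2 / real m)
     + u\<^sup>2 / 2 * ED2 (\<lambda>A B. of_bool (A \<inter> B \<noteq> {}) * ((real (card A))\<^sup>2 * (real (card B))\<^sup>2))
     + 2 * a * (c2\<^sup>2 / real (m choose 2))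
     + ES2 (\<lambda>k l. real (k choose 2) * real (l choose 2) * min 1 (u * (real k * real l))) / real (m choose 2)"
    unfolding ED2_card_Int[symmetric] ED2_card_Int_choose_2[symmetric] ED2_card_Int_mult[symmetric]
      ED2_choose[of 2 "\<lambda>k l. min 1 (u * (real k * real l))", symmetric]
    by simp
  also have "\<dots> \<le> a\<^sup>2 / 2 * (e1\<^sup>2 / real m) + a * u * (e2\<^sup>2 / real m)
     + u\<^sup>2 / 2 * ES2 (\<lambda>k l. min 1 (real k * real l / real m) * ((real k)\<^sup>2 * (real l)\<^sup>2))
     + 2 * a * (c2\<^sup>2 / real (m choose 2))
     + ES2 (\<lambda>k l. real (k choose 2) * real (l choose 2) * min 1 (u * (real k * real l))) / real (m choose 2)"
    using ED2_edge_le_min[of "\<lambda>k l. (real k)\<^sup>2 * (real l)\<^sup>2"] m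
    by (intro add_mono mult_left_mono order_refl) auto
  finally show ?thesis .
qed

end

section \<open>Weak convergence with second moments; mixed Poisson moments\<close>

lemma weak_conv_integral_bounded:
  fixes \<nu> :: "nat \<Rightarrow> real measure" and f :: "real \<Rightarrow> real"
  assumes "\<And>n. real_distribution (\<nu> n)" "real_distribution \<mu>" "weak_conv_m \<nu> \<mu>"
    and "continuous_on UNIV f" "\<And>x. \<bar>f x\<bar> \<le> B"
  shows "(\<lambda>n. integral\<^sup>L (\<nu> n) f) \<longlonglongrightarrow> integral\<^sup>L \<mu> f"
  using assms
  by (intro weak_conv_imp_integral_bdd_continuous_conv[where B = B])
    (auto simp: continuous_on_eq_continuous_at)

text \<open>Here \<open>\<nu> n\<close> stands for the law of the normalised size and
  \<open>\<mu>\<close> for the law of \<open>Z\<close>. What is extracted is convergence of the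
  first moments and uniform smallness of the tails of the squares.\<close>

locale weak_conv_second_moment =
  fixes \<nu> :: "nat \<Rightarrow> real measure" and \<mu> :: "real measure"
  assumes distr_\<nu>: "\<And>n. real_distribution (\<nu> n)" and distr_\<mu>: "real_distribution \<mu>"
    and conv: "weak_conv_m \<nu> \<mu>"
    and int_\<nu>: "\<And>n. integrable (\<nu> n) (\<lambda>x. x\<^sup>2)" and int_\<mu>: "integrable \<mu> (\<lambda>x. x\<^sup>2)"
    and moment: "(\<lambda>n. \<integral>x. x\<^sup>2 \<partial>\<nu> n) \<longlonglongrightarrow> (\<integral>x. x\<^sup>2 \<partial>\<mu>)"
begin

lemma borel_measurable_real_distribution:
  "real_distribution M \<Longrightarrow> (f :: real \<Rightarrow> real) \<in> borel_measurable borel \<Longrightarrow> f \<in> borel_measurable M"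
  by (metis measurable_cong_sets real_distribution.events_eq_borel)

lemma integrable_dominated_square:
  assumes M: "real_distribution M" "integrable M (\<lambda>x. x\<^sup>2)" and f: "f \<in> borel_measurable borel"
    and b: "\<And>x. \<bar>f x\<bar> \<le> 1 + x\<^sup>2"
  shows "integrable M (f :: real \<Rightarrow> real)"
proof -
  interpret real_distribution M by fact
  show ?thesis
  proof (rule Bochner_Integration.integrable_bound[where f = "\<lambda>x. 1 + x\<^sup>2"])
    show "integrable M (\<lambda>x. 1 + x\<^sup>2)" using M(2) by simp
    show "f \<in> borel_measurable M" by (rule borel_measurable_real_distribution[OF M(1) f])
    show "AE x in M. norm (f x) \<le> norm (1 + x\<^sup>2)"
      using b by (intro AE_I2) (simp add: abs_of_nonneg)
  qed
qed

lemma abs_le_square: "\<bar>x\<bar> \<le> 1 + (x::real)\<^sup>2"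
  using sum_squares_bound[of 1 "\<bar>x\<bar>"] by (simp add: power2_abs)

text \<open>Clamping to \<open>[- K, K]\<close> gives a bounded continuous test function, and the
  error is at most \<open>x\<^sup>2 / K\<close>, which is small uniformly since the second moments
  are bounded.\<close>

lemma first_moment: "(\<lambda>n. \<integral>x. x \<partial>\<nu> n) \<longlonglongrightarrow> (\<integral>x. x \<partial>\<mu>)"
proof (rule LIMSEQ_I)
  fix \<epsilon> :: real assume \<epsilon>: "0 < \<epsilon>"
  define S where "S = (\<integral>x. x\<^sup>2 \<partial>\<mu>)"
  have S0: "0 \<le> S" unfolding S_def by (rule Bochner_Integration.integral_nonneg) simp
  \<comment> \<open>The second moments of \<open>\<nu> n\<close> and \<open>\<mu>\<close> eventually
    sum to at most \<open>2 S + 1\<close>, so this \<open>K\<close> makes the two clamping errors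
    together at most \<open>\<epsilon> / 4\<close>.\<close>
  define K where "K = 4 * (2 * S + 1) / \<epsilon>"
  have K: "0 < K" using \<epsilon> S0 by (simp add: K_def)
  define c where "c = (\<lambda>x::real. max (- K) (min K x))"
  have c_diff: "\<bar>x - c x\<bar> \<le> x\<^sup>2 / K" for x
  proof (cases "\<bar>x\<bar> \<le> K")
    case True
    then have "c x = x" using K by (simp add: c_def max_def min_def abs_le_iff)
    then show ?thesis using K by simp
  next
    case False
    then have "\<bar>x - c x\<bar> \<le> \<bar>x\<bar>" using K by (auto simp: c_def max_def min_def)
    also have "\<bar>x\<bar> \<le> x\<^sup>2 / K"
      using False K mult_right_mono[of K "\<bar>x\<bar>" "\<bar>x\<bar>"]
      by (simp add: field_simps power2_eq_square)
    finally show ?thesis .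
  qed
  have c_meas: "c \<in> borel_measurable borel" unfolding c_def by measurable
  have c_le: "\<bar>c x\<bar> \<le> 1 + x\<^sup>2" for x
    using abs_le_square[of x] K by (auto simp: c_def max_def min_def)
  have approx: "\<bar>(\<integral>x. x \<partial>M) - (\<integral>x. c x \<partial>M)\<bar> \<le> (\<integral>x. x\<^sup>2 \<partial>M) / K"
    if M: "real_distribution M" "integrable M (\<lambda>x. x\<^sup>2)" for M
  proof -
    have ix: "integrable M (\<lambda>x. x)"
      by (rule integrable_dominated_square[OF M]) (auto simp: abs_le_square)
    have ic: "integrable M c"
      by (rule integrable_dominated_square[OF M c_meas c_le])
    have "\<bar>(\<integral>x. x \<partial>M) - (\<integral>x. c x \<partial>M)\<bar> = \<bar>\<integral>x. x - c x \<partial>M\<bar>"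
      using ix ic by simp
    also have "\<dots> \<le> (\<integral>x. \<bar>x - c x\<bar> \<partial>M)" by (rule integral_abs_bound)
    also have "\<dots> \<le> (\<integral>x. x\<^sup>2 / K \<partial>M)"
      using ix ic M c_diff by (intro integral_mono) auto
    finally show ?thesis by simp
  qed
  have "(\<lambda>n. integral\<^sup>L (\<nu> n) c) \<longlonglongrightarrow> integral\<^sup>L \<mu> c"
    using distr_\<nu> distr_\<mu> conv
  proof (rule weak_conv_integral_bounded[where B = K])
    show "continuous_on UNIV c" unfolding c_def by (intro continuous_intros)
    show "\<bar>c x\<bar> \<le> K" for x using K by (auto simp: c_def max_def min_def)
  qed
  then have "\<forall>\<^sub>F n in sequentially. \<bar>integral\<^sup>L (\<nu> n) c - integral\<^sup>L \<mu> c\<bar> < \<epsilon> / 2"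
    using \<epsilon> by (auto dest: tendstoD[where e = "\<epsilon> / 2"] simp: dist_real_def)
  moreover have "\<forall>\<^sub>F n in sequentially. (\<integral>x. x\<^sup>2 \<partial>\<nu> n) < S + 1"
    using moment by (rule order_tendstoD) (simp add: S_def)
  ultimately have "\<forall>\<^sub>F n in sequentially. \<bar>(\<integral>x. x \<partial>\<nu> n) - (\<integral>x. x \<partial>\<mu>)\<bar> < \<epsilon>"
  proof eventually_elim
    case (elim n)
    have "(\<integral>x. x\<^sup>2 \<partial>\<nu> n) / K + (\<integral>x. x\<^sup>2 \<partial>\<mu>) / K \<le> (2 * S + 1) / K"
      using elim(2) K unfolding S_def by (simp add: add_divide_distrib[symmetric] divide_right_mono)
    also have "\<dots> = \<epsilon> / 4"
    proof -
      have "2 * S + 1 \<noteq> 0" using S0 by linarith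
      moreover have "x / (4 * x / \<epsilon>) = \<epsilon> / 4" if "x \<noteq> 0" for x using that by simp
      ultimately show ?thesis unfolding K_def by blast
    qed
    finally have "(\<integral>x. x\<^sup>2 \<partial>\<nu> n) / K + (\<integral>x. x\<^sup>2 \<partial>\<mu>) / K \<le> \<epsilon> / 4" .
    then show ?case
      using approx[OF distr_\<nu>[of n] int_\<nu>[of n]] approx[OF distr_\<mu> int_\<mu>] elim(1) \<epsilon>
      by linarith
  qed
  then show "\<exists>N. \<forall>n\<ge>N. norm ((\<integral>x. x \<partial>\<nu> n) - (\<integral>x. x \<partial>\<mu>)) < \<epsilon>"
    by (simp add: eventually_sequentially)
qed

text \<open>The function \<open>min |x| K\<close> squared is bounded and continuous, so its
  integrals converge. As the full second moments converge too, the excess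
  \<open>x\<^sup>2 - \<psi> K x\<close> is eventually as small in mean as it is under
  \<open>\<mu>\<close>.\<close>

lemma uniform_tail:
  assumes \<epsilon>: "0 < \<epsilon>"
  obtains K where "1 \<le> K" "\<forall>\<^sub>F n in sequentially. (\<integral>x. x\<^sup>2 * of_bool (K < \<bar>x\<bar>) \<partial>\<nu> n) < \<epsilon>"
proof -
  interpret \<mu>: real_distribution \<mu> by (rule distr_\<mu>)
  define \<psi> where "\<psi> = (\<lambda>K x::real. (min \<bar>x\<bar> K)\<^sup>2)"
  have \<psi>_meas: "\<psi> K \<in> borel_measurable borel" for K unfolding \<psi>_def by measurable
  have \<psi>_le: "\<psi> K x \<le> x\<^sup>2" if "0 \<le> K" for K x
    using that power_mono[of "min \<bar>x\<bar> K" "\<bar>x\<bar>" 2] by (simp add: \<psi>_def)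
  have \<psi>_le': "\<bar>\<psi> K x\<bar> \<le> 1 + x\<^sup>2" if "0 \<le> K" for K x
    using \<psi>_le[OF that, of x] by (simp add: \<psi>_def)
  have "(\<lambda>k. \<integral>x. \<psi> (real k) x \<partial>\<mu>) \<longlonglongrightarrow> (\<integral>x. x\<^sup>2 \<partial>\<mu>)"
  proof (rule integral_dominated_convergence[where w = "\<lambda>x. x\<^sup>2"])
    show "AE x in \<mu>. (\<lambda>k. \<psi> (real k) x) \<longlonglongrightarrow> x\<^sup>2"
    proof (rule AE_I2)
      fix x :: real
      have "\<forall>\<^sub>F k in sequentially. \<psi> (real k) x = x\<^sup>2"
        using eventually_ge_at_top[of "nat \<lceil>\<bar>x\<bar>\<rceil>"]
        by eventually_elim (auto simp: \<psi>_def min_def nat_le_iff ceiling_le_iff)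
      then show "(\<lambda>k. \<psi> (real k) x) \<longlonglongrightarrow> x\<^sup>2" by (rule tendsto_eventually)
    qed
    show "AE x in \<mu>. norm (\<psi> (real k) x) \<le> x\<^sup>2" for k
      using \<psi>_le[of "real k"] by (intro AE_I2) (simp add: \<psi>_def)
    show "(\<lambda>x. x\<^sup>2) \<in> borel_measurable \<mu>" using int_\<mu> by (rule borel_measurable_integrable)
  qed (rule int_\<mu> borel_measurable_real_distribution[OF distr_\<mu> \<psi>_meas])+
  then have "\<forall>\<^sub>F k in sequentially. (\<integral>x. x\<^sup>2 \<partial>\<mu>) - \<epsilon> / 2 < (\<integral>x. \<psi> (real k) x \<partial>\<mu>)"
    by (rule order_tendstoD) (use \<epsilon> in simp)
  then obtain k where k: "1 \<le> k" "(\<integral>x. x\<^sup>2 \<partial>\<mu>) - \<epsilon> / 2 < (\<integral>x. \<psi> (real k) x \<partial>\<mu>)"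
    using eventually_happens'[OF _ eventually_conj[OF eventually_ge_at_top[of "1::nat"]]]
    by (metis (mono_tags, lifting) sequentially_bot)
  define K where "K = real k"
  have K: "1 \<le> K" using k by (simp add: K_def)
  have "(\<lambda>n. integral\<^sup>L (\<nu> n) (\<psi> K)) \<longlonglongrightarrow> integral\<^sup>L \<mu> (\<psi> K)"
    using distr_\<nu> distr_\<mu> conv
  proof (rule weak_conv_integral_bounded[where B = "K\<^sup>2"])
    show "continuous_on UNIV (\<psi> K)" unfolding \<psi>_def by (intro continuous_intros)
    show "\<bar>\<psi> K x\<bar> \<le> K\<^sup>2" for x using K by (auto simp: \<psi>_def intro!: power_mono)
  qed
  then have "(\<lambda>n. (\<integral>x. x\<^sup>2 \<partial>\<nu> n) - integral\<^sup>L (\<nu> n) (\<psi> K)) \<longlonglongrightarrow> (\<integral>x. x\<^sup>2 \<partial>\<mu>) - integral\<^sup>L \<mu> (\<psi> K)"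
    by (intro tendsto_diff moment)
  then have "\<forall>\<^sub>F n in sequentially. (\<integral>x. x\<^sup>2 \<partial>\<nu> n) - integral\<^sup>L (\<nu> n) (\<psi> K) < \<epsilon> / 2"
    by (rule order_tendstoD) (use k in \<open>simp add: K_def\<close>)
  then have "\<forall>\<^sub>F n in sequentially. (\<integral>x. x\<^sup>2 * of_bool (2 * K < \<bar>x\<bar>) \<partial>\<nu> n) < \<epsilon>"
  proof eventually_elim
    case (elim n)
    have i\<psi>: "integrable (\<nu> n) (\<psi> K)"
      by (rule integrable_dominated_square[OF distr_\<nu> int_\<nu> \<psi>_meas]) (use \<psi>_le' K in auto)
    have it: "integrable (\<nu> n) (\<lambda>x. x\<^sup>2 * of_bool (2 * K < \<bar>x\<bar>))"
      by (rule integrable_dominated_square[OF distr_\<nu> int_\<nu>]) auto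
    have "(\<integral>x. x\<^sup>2 * of_bool (2 * K < \<bar>x\<bar>) \<partial>\<nu> n) \<le> (\<integral>x. 2 * (x\<^sup>2 - \<psi> K x) \<partial>\<nu> n)"
    proof (rule integral_mono)
      fix x :: real
      \<comment> \<open>Just beyond \<open>K\<close> the excess over \<open>\<psi> K x\<close> is
        negligible, hence the cut at \<open>2 K\<close>: there \<open>\<psi> K x = K\<^sup>2\<close>
        is at most half of \<open>x\<^sup>2\<close>.\<close>
      show "x\<^sup>2 * of_bool (2 * K < \<bar>x\<bar>) \<le> 2 * (x\<^sup>2 - \<psi> K x)"
      proof (cases "2 * K < \<bar>x\<bar>")
        case True
        then have "(2 * K)\<^sup>2 \<le> \<bar>x\<bar>\<^sup>2" using K by (intro power_mono) auto
        then have "4 * K\<^sup>2 \<le> x\<^sup>2" by (simp add: power_mult_distrib)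
        moreover have "2 * K\<^sup>2 \<le> 4 * K\<^sup>2" by simp
        ultimately have "2 * K\<^sup>2 \<le> x\<^sup>2" by (rule order_trans[rotated])
        moreover have "\<psi> K x = K\<^sup>2" using True K by (simp add: \<psi>_def min_def)
        ultimately have "2 * \<psi> K x \<le> x\<^sup>2" by simp
        then have "x\<^sup>2 \<le> 2 * (x\<^sup>2 - \<psi> K x)" by simp
        then show ?thesis using True by simp
      qed (use \<psi>_le[of K x] K in simp)
    qed (use it i\<psi> int_\<nu> in auto)
    also have "\<dots> = 2 * ((\<integral>x. x\<^sup>2 \<partial>\<nu> n) - integral\<^sup>L (\<nu> n) (\<psi> K))"
      using i\<psi> int_\<nu> by simp
    also have "\<dots> < \<epsilon>" using elim by simp
    finally show ?case .
  qed
  with K show ?thesis by (intro that[of "2 * K"]) auto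
qed

end

text \<open>Tested with a bounded continuous function that is positive exactly on the negative
  half-line. It supplies the nonnegative rate required by the mixed Poisson formula.\<close>

lemma weak_conv_limit_nonneg:
  fixes \<nu> :: "nat \<Rightarrow> real measure"
  assumes \<nu>: "\<And>n. real_distribution (\<nu> n)" and \<mu>: "real_distribution \<mu>" and conv: "weak_conv_m \<nu> \<mu>"
    and nonneg: "\<And>n. AE x in \<nu> n. 0 \<le> x"
  shows "AE x in \<mu>. 0 \<le> x"
proof -
  interpret \<mu>: real_distribution \<mu> by fact
  define f where "f = (\<lambda>x::real. max 0 (min 1 (- x)))"
  have "(\<lambda>n. integral\<^sup>L (\<nu> n) f) \<longlonglongrightarrow> integral\<^sup>L \<mu> f"
    using \<nu> \<mu> conv by (rule weak_conv_integral_bounded[where B = 1])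
      (auto simp: f_def intro!: continuous_intros)
  moreover have "integral\<^sup>L (\<nu> n) f = 0" for n
  proof -
    have "AE x in \<nu> n. f x = 0" using nonneg[of n] by eventually_elim (simp add: f_def)
    then show ?thesis by (rule integral_eq_zero_AE)
  qed
  ultimately have 0: "integral\<^sup>L \<mu> f = 0" by (simp add: LIMSEQ_const_iff)
  have f: "f \<in> borel_measurable \<mu>"
    using \<mu>.events_eq_borel measurable_cong_sets[of \<mu> borel borel borel] by (simp add: f_def)
  have "integrable \<mu> f" 
    by (rule \<mu>.integrable_const_bound[of _ 1, OF _ f]) (simp add: f_def)
  then have "AE x in \<mu>. f x = 0"
    using 0 by (subst (asm) integral_nonneg_eq_0_iff_AE) (auto simp: f_def)
  then show ?thesis by eventually_elim (auto simp: f_def max_def min_def split: if_splits)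
qed

text \<open>\<open>h y\<close> is the Poisson mean of \<open>g\<close> at rate \<open>y\<close>. Sum
  and integral are interchanged for nonnegative extended reals, so integrability is not
  presupposed.\<close>

lemma expectation_mixed_poisson:
  fixes g :: "nat \<Rightarrow> real"
  assumes M: "prob_space M" and Y: "Y \<in> borel_measurable M" and nonneg: "AE \<omega> in M. 0 \<le> Y \<omega>"
    and g: "\<And>k. 0 \<le> g k" and h: "h \<in> borel_measurable borel"
    and sums: "\<And>y. 0 \<le> y \<Longrightarrow> (\<lambda>k. exp (- y) * y ^ k / fact k * g k) sums h y"
  shows "measure_pmf.expectation (mixed_poisson M Y) g = (\<integral>\<omega>. h (Y \<omega>) \<partial>M)"
proof -
  interpret prob_space M by fact
  note [measurable] = Y h
  define p where "p = (\<lambda>k \<omega>. exp (- Y \<omega>) * Y \<omega> ^ k / fact k)"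
  have [measurable]: "p k \<in> borel_measurable M" for k unfolding p_def by measurable
  have p_nonneg: "AE \<omega> in M. \<forall>k. 0 \<le> p k \<omega>"
    using nonneg by eventually_elim (auto simp: p_def)
  have p_int: "integrable M (p k)" for k
  proof (rule integrable_const_bound[of _ 1])
    show "AE \<omega> in M. norm (p k \<omega>) \<le> 1"
      using nonneg
    proof eventually_elim
      case (elim \<omega>)
      have "Y \<omega> ^ k / fact k \<le> exp (Y \<omega>)"
        using elim sum_le_suminf[OF sums_summable[OF exp_converges[of "Y \<omega>"]], of "{k}"]
        by (simp add: exp_def scaleR_conv_of_real field_simps)
      then have "exp (- Y \<omega>) * (Y \<omega> ^ k / fact k) \<le> exp (- Y \<omega>) * exp (Y \<omega>)"
        by (intro mult_left_mono) auto
      then show ?case using elim by (simp add: p_def flip: exp_add)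
    qed
  qed measurable
  have pmf: "pmf (mixed_poisson M Y) k = (\<integral>\<omega>. p k \<omega> \<partial>M)" for k
    using pmf_mixed_poisson[OF M Y nonneg] by (simp add: p_def)
  have "(\<integral>\<^sup>+k. ennreal (g k) \<partial>measure_pmf (mixed_poisson M Y)) =
      (\<integral>\<^sup>+k. ennreal (pmf (mixed_poisson M Y) k) * ennreal (g k) \<partial>count_space UNIV)"
    by (rule nn_integral_measure_pmf)
  also have "\<dots> = (\<Sum>k. ennreal (\<integral>\<omega>. p k \<omega> \<partial>M) * ennreal (g k))"
    by (simp add: nn_integral_count_space_nat pmf)
  also have "\<dots> = (\<Sum>k. \<integral>\<^sup>+\<omega>. ennreal (p k \<omega>) * ennreal (g k) \<partial>M)"
  proof (rule suminf_cong)
    fix k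
    have "ennreal (\<integral>\<omega>. p k \<omega> \<partial>M) = (\<integral>\<^sup>+\<omega>. ennreal (p k \<omega>) \<partial>M)"
      using p_nonneg by (intro nn_integral_eq_integral[symmetric] p_int) (auto elim: eventually_mono)
    then show "ennreal (\<integral>\<omega>. p k \<omega> \<partial>M) * ennreal (g k) = (\<integral>\<^sup>+\<omega>. ennreal (p k \<omega>) * ennreal (g k) \<partial>M)"
      by (simp add: nn_integral_multc)
  qed
  also have "\<dots> = (\<integral>\<^sup>+\<omega>. (\<Sum>k. ennreal (p k \<omega>) * ennreal (g k)) \<partial>M)"
    by (rule nn_integral_suminf[symmetric]) measurable
  also have "\<dots> = (\<integral>\<^sup>+\<omega>. ennreal (h (Y \<omega>)) \<partial>M)"
  proof (rule nn_integral_cong_AE)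
    show "AE \<omega> in M. (\<Sum>k. ennreal (p k \<omega>) * ennreal (g k)) = ennreal (h (Y \<omega>))"
      using nonneg p_nonneg
    proof eventually_elim
      case (elim \<omega>)
      have "(\<Sum>k. ennreal (p k \<omega>) * ennreal (g k)) = (\<Sum>k. ennreal (p k \<omega> * g k))"
        using elim g by (simp add: ennreal_mult')
      also have "\<dots> = ennreal (\<Sum>k. p k \<omega> * g k)"
        using elim g sums[OF elim(1)] by (intro suminf_ennreal2) (auto simp: sums_iff p_def)
      finally show ?case using sums[OF elim(1)] by (simp add: sums_iff p_def)
    qed
  qed
  finally have nn: "(\<integral>\<^sup>+k. ennreal (g k) \<partial>measure_pmf (mixed_poisson M Y)) = (\<integral>\<^sup>+\<omega>. ennreal (h (Y \<omega>)) \<partial>M)" .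
  have h_nonneg: "0 \<le> h y" if "0 \<le> y" for y
    using sums[OF that] g that by (intro sums_le[OF _ sums_zero sums[OF that]]) auto
  have "AE \<omega> in M. 0 \<le> h (Y \<omega>)" using nonneg by eventually_elim (rule h_nonneg)
  then show ?thesis using nn g by (simp add: integral_eq_nn_integral)
qed

lemma poisson_first_moment_sums: "(\<lambda>k. exp (- y) * y ^ k / fact k * real k ^ 1) sums (y::real)"
proof -
  have "(\<lambda>k. (exp (- y) * y) * (y ^ k /\<^sub>R fact k)) sums ((exp (- y) * y) * exp y)"
    by (intro sums_mult exp_converges)
  also have "(\<lambda>k. (exp (- y) * y) * (y ^ k /\<^sub>R fact k)) =
      (\<lambda>k. exp (- y) * y ^ Suc k / fact (Suc k) * real (Suc k) ^ 1)"
    by (auto simp: fun_eq_iff divide_simps scaleR_conv_of_real)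
  finally have "(\<lambda>k. exp (- y) * y ^ k / fact k * real k ^ 1) sums (exp (- y) * y * exp y + 0)"
    by (subst (asm) sums_Suc_iff) simp
  moreover have "exp (- y) * y * exp y + 0 = y" by (simp add: exp_minus field_simps)
  ultimately show ?thesis by (simp only:)
qed

text \<open>The factorial moment \<open>y\<^sup>2\<close>, found by shifting the exponential series
  by two, plus the first moment \<open>y\<close>.\<close>

lemma poisson_second_moment_sums: "(\<lambda>k. exp (- y) * y ^ k / fact k * real k ^ 2) sums (y\<^sup>2 + (y::real))"
proof -
  have "(\<lambda>k. (exp (- y) * y\<^sup>2) * (y ^ k /\<^sub>R fact k)) sums ((exp (- y) * y\<^sup>2) * exp y)"
    by (intro sums_mult exp_converges)
  also have "(\<lambda>k. (exp (- y) * y\<^sup>2) * (y ^ k /\<^sub>R fact k)) =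
      (\<lambda>k. exp (- y) * y ^ (k + 2) / fact (k + 2) * (real (k + 2) * (real (k + 2) - 1)))"
    by (auto simp: fun_eq_iff divide_simps scaleR_conv_of_real power_add power2_eq_square)
  finally have "(\<lambda>k. exp (- y) * y ^ k / fact k * (real k * (real k - 1))) sums (exp (- y) * y\<^sup>2 * exp y)"
    by (subst (asm) sums_iff_shift) (simp add: numeral_2_eq_2)
  then have "(\<lambda>k. exp (- y) * y ^ k / fact k * (real k * (real k - 1)) +
      exp (- y) * y ^ k / fact k * real k ^ 1) sums (exp (- y) * y\<^sup>2 * exp y + y)"
    by (intro sums_add poisson_first_moment_sums)
  moreover have "exp (- y) * y\<^sup>2 * exp y + y = y\<^sup>2 + y" by (simp add: exp_minus field_simps)
  moreover have "exp (- y) * y ^ k / fact k * (real k * (real k - 1)) +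
      exp (- y) * y ^ k / fact k * real k ^ 1 = exp (- y) * y ^ k / fact k * real k ^ 2" for k
    unfolding distrib_left[symmetric] by (simp add: algebra_simps power2_eq_square)
  ultimately show ?thesis by (simp only:)
qed

section \<open>Asymptotics\<close>

lemma tendsto_choose_over_power:
  "(\<lambda>N. real (N choose r) / real N ^ r) \<longlonglongrightarrow> 1 / fact r"
proof -
  have "(\<lambda>N. (\<Prod>i<r. 1 - real i / real N) / fact r) \<longlonglongrightarrow> (\<Prod>i<r. 1 - 0) / fact r"
    by (intro tendsto_intros tendsto_divide_0[OF tendsto_const] filterlim_at_top_imp_at_infinity
        filterlim_real_sequentially) simp
  moreover have "\<forall>\<^sub>F N in sequentially.
      (\<Prod>i<r. 1 - real i / real N) / fact r = real (N choose r) / real N ^ r"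
    using eventually_gt_at_top[of "0::nat"]
  proof eventually_elim
    case (elim N)
    have "real (N choose r) = (\<Prod>i<r. real N - real i) / fact r"
      by (simp add: binomial_gbinomial gbinomial_prod_rev atLeast0LessThan)
    moreover have "(\<Prod>i<r. 1 - real i / real N) = (\<Prod>i<r. (real N - real i) / real N)"
      using elim by (intro prod.cong) (auto simp: field_simps)
    then have "(\<Prod>i<r. 1 - real i / real N) = (\<Prod>i<r. real N - real i) / real N ^ r"
      by (simp add: prod_dividef)
    ultimately show ?case by simp
  qed
  ultimately show ?thesis by (simp add: Lim_transform_eventually)
qed

text \<open>The limit variable \<open>Z\<close> has disappeared: all that remains of it are two
  numbers and the uniform integrability \<open>tail\<close>, stated for the size laws
  \<open>P n\<close> without normalising the size.\<close>

locale random_attribute_sets_limit =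
  fixes m :: "nat \<Rightarrow> nat" and P :: "nat \<Rightarrow> nat pmf" and \<beta> :: "nat \<Rightarrow> real" and z1 z2 :: real
  assumes \<beta>_def: "\<And>n. \<beta> n = real (m n) / real n"
    and P_support: "\<And>n. set_pmf (P n) \<subseteq> {..m n}"
    and \<beta>_at_top: "filterlim \<beta> at_top sequentially"
    and z1_pos: "0 < z1" and z2_pos: "0 < z2"
    and first_moment:
      "(\<lambda>n. measure_pmf.expectation (P n) real / sqrt (\<beta> n)) \<longlonglongrightarrow> z1"
    and second_moment:
      "(\<lambda>n. measure_pmf.expectation (P n) (\<lambda>k. (real k)\<^sup>2) / \<beta> n) \<longlonglongrightarrow> z2"
    and tail: "\<And>\<epsilon>. 0 < \<epsilon> \<Longrightarrow> \<exists>K\<ge>1. \<forall>\<^sub>F n in sequentially.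
      measure_pmf.expectation (P n) (\<lambda>k. (real k)\<^sup>2 * of_bool (K * sqrt (\<beta> n) < real k)) / \<beta> n < \<epsilon>"
begin

sublocale rig: random_attribute_set "m n" "P n" for n
  by standard (rule P_support)

text \<open>Expected numbers of the \<open>n - 2\<close> other vertices that hold a given attribute
  (\<open>a\<close>) or a given pair of attributes (\<open>u\<close>). Their orders are
  \<beta>^(-1/2) and 1 / (\<beta> n).\<close>

definition a :: "nat \<Rightarrow> real" where "a n = real (n - 2) * rig.mu n 1"
definition u :: "nat \<Rightarrow> real" where "u n = real (n - 2) * rig.mu n 2"

section \<open>Limits of the normalised moments\<close>

lemma ev_regular: "\<forall>\<^sub>F n in sequentially. 3 \<le> n \<and> 1 \<le> \<beta> n \<and> real (m n) = \<beta> n * real n \<and> 3 \<le> m n"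
  using eventually_ge_at_top[of 3] filterlim_at_top[THEN iffD1, OF \<beta>_at_top, rule_format, of 1]
proof eventually_elim
  case (elim n)
  then have eq: "real (m n) = \<beta> n * real n" by (simp add: \<beta>_def)
  have "1 * real n \<le> \<beta> n * real n" using elim by (intro mult_right_mono) auto
  then have "3 \<le> m n" using eq elim by linarith
  with eq elim show ?case by simp
qed

lemma inverse_n: "(\<lambda>n. 1 / real n) \<longlonglongrightarrow> 0"
  by (rule lim_1_over_n)

lemma sqrt_\<beta>_at_top: "filterlim (\<lambda>n. sqrt (\<beta> n)) at_top sequentially"
  by (rule filterlim_compose[OF sqrt_at_top \<beta>_at_top])

lemma inverse_sqrt_\<beta>: "(\<lambda>n. 1 / sqrt (\<beta> n)) \<longlonglongrightarrow> 0"
  using sqrt_\<beta>_at_top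
  by (intro tendsto_divide_0[OF tendsto_const] filterlim_at_top_imp_at_infinity)

lemma shifted_ratio: "(\<lambda>n. real (n - 2) / real n) \<longlonglongrightarrow> 1"
proof -
  have "(\<lambda>n. 1 - 2 * (1 / real n)) \<longlonglongrightarrow> 1 - 2 * 0"
    by (intro tendsto_intros inverse_n)
  moreover have "\<forall>\<^sub>F n in sequentially. 1 - 2 * (1 / real n) = real (n - 2) / real n"
    using eventually_ge_at_top[of 3] by eventually_elim (simp add: field_simps of_nat_diff)
  ultimately show ?thesis by (simp add: Lim_transform_eventually)
qed

lemma m_at_top: "filterlim (\<lambda>n. real (m n)) at_top sequentially"
proof (rule filterlim_at_top_mono[OF filterlim_real_sequentially])
  show "\<forall>\<^sub>F n in sequentially. real n \<le> real (m n)"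
    using ev_regular
  proof eventually_elim
    case (elim n)
    then have "1 * real n \<le> \<beta> n * real n" by (intro mult_right_mono) auto
    with elim show ?case by simp
  qed
qed

lemma inverse_m: "(\<lambda>n. 1 / real (m n)) \<longlonglongrightarrow> 0"
  using m_at_top by (intro tendsto_divide_0[OF tendsto_const] filterlim_at_top_imp_at_infinity)

lemma m_ratio: "(\<lambda>n. real (m n) / (real (m n) - 1)) \<longlonglongrightarrow> 1"
proof -
  have "(\<lambda>n. 1 / (1 - 1 / real (m n))) \<longlonglongrightarrow> 1 / (1 - 0)"
    by (intro tendsto_intros inverse_m) auto
  moreover have "\<forall>\<^sub>F n in sequentially. 1 / (1 - 1 / real (m n)) = real (m n) / (real (m n) - 1)"
    using ev_regular by eventually_elim (simp add: field_simps)
  ultimately show ?thesis by (simp add: Lim_transform_eventually)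
qed

lemma e1_lim: "(\<lambda>n. rig.e1 n / sqrt (\<beta> n)) \<longlonglongrightarrow> z1"
  using first_moment by (simp add: rig.e1_def)

lemma e2_lim: "(\<lambda>n. rig.e2 n / \<beta> n) \<longlonglongrightarrow> z2"
  using second_moment by (simp add: rig.e2_def)

lemma two_c2: "2 * rig.c2 n = rig.e2 n - rig.e1 n"
proof -
  have "2 * rig.c2 n = rig.ES n (\<lambda>k. 2 * real (k choose 2))" by (simp add: rig.c2_def)
  also have "\<dots> = rig.ES n (\<lambda>k. (real k)\<^sup>2 - real k)"
    unfolding two_choose_two by (simp add: algebra_simps power2_eq_square)
  finally show ?thesis by (simp add: rig.e1_def rig.e2_def)
qed

lemma c2_lim: "(\<lambda>n. 2 * rig.c2 n / \<beta> n) \<longlonglongrightarrow> z2"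
proof -
  have "(\<lambda>n. rig.e2 n / \<beta> n - rig.e1 n / sqrt (\<beta> n) * (1 / sqrt (\<beta> n))) \<longlonglongrightarrow> z2 - z1 * 0"
    by (intro tendsto_intros e1_lim e2_lim inverse_sqrt_\<beta>)
  moreover have "\<forall>\<^sub>F n in sequentially.
      rig.e2 n / \<beta> n - rig.e1 n / sqrt (\<beta> n) * (1 / sqrt (\<beta> n)) = 2 * rig.c2 n / \<beta> n"
    using ev_regular by eventually_elim (simp add: two_c2 diff_divide_distrib)
  ultimately show ?thesis by (simp add: Lim_transform_eventually)
qed

lemma choose_m_2: "real (m n choose 2) = real (m n) * (real (m n) - 1) / 2"
  using two_choose_two[of "m n"] by simp

lemma a_nonneg: "0 \<le> a n" and u_nonneg: "0 \<le> u n"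
  by (simp_all add: a_def u_def rig.mu_nonneg)

lemma mu_1: "rig.mu n 1 = rig.e1 n / real (m n)"
  by (simp add: rig.mu_def rig.binom_moment_def rig.e1_def)

lemma mu_2: "rig.mu n 2 = rig.c2 n / real (m n choose 2)"
  by (simp add: rig.mu_def rig.binom_moment_def rig.c2_def)

lemma a_lim: "(\<lambda>n. a n * sqrt (\<beta> n)) \<longlonglongrightarrow> z1"
proof -
  have "(\<lambda>n. real (n - 2) / real n * (rig.e1 n / sqrt (\<beta> n))) \<longlonglongrightarrow> 1 * z1"
    by (intro tendsto_intros e1_lim shifted_ratio)
  moreover have "\<forall>\<^sub>F n in sequentially.
      real (n - 2) / real n * (rig.e1 n / sqrt (\<beta> n)) = a n * sqrt (\<beta> n)"
    using ev_regular
  proof eventually_elim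
    case (elim n)
    define s where "s = sqrt (\<beta> n)"
    have s: "s \<noteq> 0" "real (m n) = s * s * real n" "real n \<noteq> 0" using elim by (auto simp: s_def)
    then show ?case unfolding a_def mu_1 s_def[symmetric] by (simp add: field_simps)
  qed
  ultimately show ?thesis by (simp add: Lim_transform_eventually)
qed

lemma a_lim_0: "a \<longlonglongrightarrow> 0"
proof -
  have "(\<lambda>n. a n * sqrt (\<beta> n) * (1 / sqrt (\<beta> n))) \<longlonglongrightarrow> z1 * 0"
    by (intro tendsto_intros a_lim inverse_sqrt_\<beta>)
  moreover have "\<forall>\<^sub>F n in sequentially. a n * sqrt (\<beta> n) * (1 / sqrt (\<beta> n)) = a n"
    using ev_regular by eventually_elim simp
  ultimately show ?thesis by (simp add: Lim_transform_eventually)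
qed

lemma u_lim: "(\<lambda>n. u n * (\<beta> n * real n)) \<longlonglongrightarrow> z2"
proof -
  have "(\<lambda>n. real (n - 2) / real n * (real (m n) / (real (m n) - 1)) * (2 * rig.c2 n / \<beta> n)) \<longlonglongrightarrow> 1 * 1 * z2"
    by (intro tendsto_intros c2_lim shifted_ratio m_ratio)
  moreover have "\<forall>\<^sub>F n in sequentially.
      real (n - 2) / real n * (real (m n) / (real (m n) - 1)) * (2 * rig.c2 n / \<beta> n) = u n * (\<beta> n * real n)"
    using ev_regular
  proof eventually_elim
    case (elim n)
    then have "real (m n) - 1 \<noteq> 0" by linarith
    moreover have "\<beta> n * real n - 1 \<noteq> 0" using elim calculation by simp
    ultimately show ?case using elim unfolding u_def mu_2 choose_m_2 by (simp add: divide_simps)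
  qed
  ultimately show ?thesis by (simp add: Lim_transform_eventually)
qed

lemma e1_square_lim: "(\<lambda>n. real n * ((rig.e1 n)\<^sup>2 / real (m n))) \<longlonglongrightarrow> z1\<^sup>2"
proof -
  have "(\<lambda>n. (rig.e1 n / sqrt (\<beta> n))\<^sup>2) \<longlonglongrightarrow> z1\<^sup>2"
    by (intro tendsto_intros e1_lim)
  moreover have "\<forall>\<^sub>F n in sequentially.
      (rig.e1 n / sqrt (\<beta> n))\<^sup>2 = real n * ((rig.e1 n)\<^sup>2 / real (m n))"
    using ev_regular by eventually_elim (simp add: power_divide)
  ultimately show ?thesis by (rule Lim_transform_eventually)
qed

lemma c2_square_lim:
  "(\<lambda>n. (real n)\<^sup>2 * ((rig.c2 n)\<^sup>2 / real (m n choose 2))) \<longlonglongrightarrow> z2\<^sup>2 / 2"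
proof -
  have "(\<lambda>n. (2 * rig.c2 n / \<beta> n)\<^sup>2 / 2 * (real (m n) / (real (m n) - 1))) \<longlonglongrightarrow> z2\<^sup>2 / 2 * 1"
    by (intro tendsto_intros c2_lim m_ratio) auto
  moreover have "\<forall>\<^sub>F n in sequentially. (2 * rig.c2 n / \<beta> n)\<^sup>2 / 2 * (real (m n) / (real (m n) - 1))
      = (real n)\<^sup>2 * ((rig.c2 n)\<^sup>2 / real (m n choose 2))"
    using ev_regular
  proof eventually_elim
    case (elim n)
    then have "\<beta> n * real n - 1 \<noteq> 0" by (metis numeral_le_one_iff of_nat_le_iff of_nat_numeral 
          order.trans right_minus_eq semiring_norm(70) one_le_numeral of_nat_1 order_refl)
    then show ?case using elim unfolding choose_m_2 by (simp add: divide_simps power2_eq_square)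
  qed
  ultimately show ?thesis by (simp add: Lim_transform_eventually)
qed

lemma e2_square_lim: "(\<lambda>n. real n / \<beta> n * ((rig.e2 n)\<^sup>2 / real (m n))) \<longlonglongrightarrow> z2\<^sup>2"
proof -
  have "(\<lambda>n. (rig.e2 n / \<beta> n)\<^sup>2) \<longlonglongrightarrow> z2\<^sup>2"
    by (intro tendsto_intros e2_lim)
  moreover have "\<forall>\<^sub>F n in sequentially.
      (rig.e2 n / \<beta> n)\<^sup>2 = real n / \<beta> n * ((rig.e2 n)\<^sup>2 / real (m n))"
    using ev_regular by eventually_elim (simp add: power_divide power2_eq_square)
  ultimately show ?thesis by (rule Lim_transform_eventually)
qed

definition R :: "nat \<Rightarrow> real" where "R n = rig.edge_wedge_bound n (n - 2)"

text \<open>The part of \<open>R\<close> of order \<open>1/n\<^sup>2\<close>, which causes the additive error \<open>O(1/n)\<close> of \<open>cl 1\<close>.\<close>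

definition R' :: "nat \<Rightarrow> real" where
  "R' n = a n * (2 * ((rig.c2 n)\<^sup>2 / real (m n choose 2))) + u n * ((rig.e2 n)\<^sup>2 / real (m n))"

lemma R_eq: "R n = a n * ((rig.e1 n)\<^sup>2 / real (m n)) + R' n"
  by (simp add: R_def R'_def rig.edge_wedge_bound_def a_def u_def algebra_simps)

text \<open>The term for two shared attributes carries the factor \<open>a\<close>, which tends to
  0. The other one contributes the limit \<open>z2\<close> of \<open>u \<beta> n\<close> times the
  limit \<open>z2\<^sup>2\<close> of \<open>e2_square_lim\<close>.\<close>

lemma R'_lim: "(\<lambda>n. (real n)\<^sup>2 * R' n) \<longlonglongrightarrow> z2 ^ 3"
proof -
  have "(\<lambda>n. a n * (2 * ((real n)\<^sup>2 * ((rig.c2 n)\<^sup>2 / real (m n choose 2)))) +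
      u n * (\<beta> n * real n) * (real n / \<beta> n * ((rig.e2 n)\<^sup>2 / real (m n)))) \<longlonglongrightarrow>
      0 * (2 * (z2\<^sup>2 / 2)) + z2 * z2\<^sup>2"
    by (intro tendsto_intros a_lim_0 c2_square_lim u_lim e2_square_lim)
  moreover have "\<forall>\<^sub>F n in sequentially. a n * (2 * ((real n)\<^sup>2 * ((rig.c2 n)\<^sup>2 / real (m n choose 2)))) +
      u n * (\<beta> n * real n) * (real n / \<beta> n * ((rig.e2 n)\<^sup>2 / real (m n))) = (real n)\<^sup>2 * R' n"
    using ev_regular
  proof eventually_elim
    case (elim n)
    have "u n * (\<beta> n * real n) * (real n / \<beta> n * ((rig.e2 n)\<^sup>2 / real (m n))) =
        (real n)\<^sup>2 * (u n * ((rig.e2 n)\<^sup>2 / real (m n)))"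
      using elim by (simp add: power2_eq_square)
    then show ?case by (simp add: R'_def distrib_left)
  qed
  ultimately have "(\<lambda>n. (real n)\<^sup>2 * R' n) \<longlonglongrightarrow> 0 * (2 * (z2\<^sup>2 / 2)) + z2 * z2\<^sup>2"
    by (rule Lim_transform_eventually)
  then show ?thesis by (simp add: power3_eq_cube power2_eq_square mult.assoc)
qed

lemma tendsto_mult_n_0:
  assumes "(\<lambda>n. (real n)\<^sup>2 * f n) \<longlonglongrightarrow> l"
  shows "(\<lambda>n. real n * f n) \<longlonglongrightarrow> 0"
proof -
  have "(\<lambda>n. (real n)\<^sup>2 * f n * (1 / real n)) \<longlonglongrightarrow> l * 0"
    by (intro tendsto_intros assms inverse_n)
  moreover have "\<forall>\<^sub>F n in sequentially. (real n)\<^sup>2 * f n * (1 / real n) = real n * f n"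
    using eventually_gt_at_top[of 0] by eventually_elim (simp add: power2_eq_square)
  ultimately show ?thesis by (simp add: Lim_transform_eventually)
qed

lemma R_lim: "(\<lambda>n. real n * R n) \<longlonglongrightarrow> 0"
proof -
  have "(\<lambda>n. a n * (real n * ((rig.e1 n)\<^sup>2 / real (m n))) + real n * R' n) \<longlonglongrightarrow> 0 * z1\<^sup>2 + 0"
    by (intro tendsto_intros a_lim_0 e1_square_lim tendsto_mult_n_0[OF R'_lim])
  then show ?thesis by (simp add: R_eq algebra_simps)
qed

section \<open>Edge probability and lower bounds for adjacent pairs\<close>

definition pe :: "nat \<Rightarrow> real" where "pe n = rig.two_edge_prob n"
definition edge :: "nat \<Rightarrow> nat \<Rightarrow> real" where "edge r n = rig.edge_degree_prob n (n - 2) r"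
definition nonedge :: "nat \<Rightarrow> nat \<Rightarrow> real" where "nonedge r n = rig.nonedge_degree_prob n (n - 2) r"

lemma pe_lim: "(\<lambda>n. real n * pe n) \<longlonglongrightarrow> z1\<^sup>2"
proof (rule tendsto_sandwich[OF always_eventually always_eventually _ e1_square_lim])
  show "(\<lambda>n. real n * ((rig.e1 n)\<^sup>2 / real (m n)) - 2 * (real n * ((rig.c2 n)\<^sup>2 / real (m n choose 2))))
      \<longlonglongrightarrow> z1\<^sup>2"
    using tendsto_diff[OF e1_square_lim tendsto_mult[OF tendsto_const[of 2] tendsto_mult_n_0[OF c2_square_lim]]]
    by simp
  show "\<forall>n. real n * ((rig.e1 n)\<^sup>2 / real (m n)) - 2 * (real n * ((rig.c2 n)\<^sup>2 / real (m n choose 2)))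
      \<le> real n * pe n"
    using mult_left_mono[OF rig.two_edge_prob_ge of_nat_0_le_iff] by (simp add: pe_def algebra_simps)
  show "\<forall>n. real n * pe n \<le> real n * ((rig.e1 n)\<^sup>2 / real (m n))"
    unfolding pe_def using rig.two_edge_prob_le by (intro allI mult_left_mono) auto
qed

text \<open>A minorant with known asymptotics is provided in place of a limit for
  \<open>edge r\<close>: the upper bounds available for positive degrees carry additive errors which
  can exceed this order when \<beta> grows fast.\<close>

lemma edge_lower:
  obtains f where "\<And>n. f n \<le> edge r n" "(\<lambda>n. real n * sqrt (\<beta> n) ^ r * f n) \<longlonglongrightarrow> z1 ^ (r + 2) / fact r"
proof
  define f where "f = (\<lambda>n. real ((n - 2) choose r) * rig.mu n 1 ^ r * (pe n - R n))"
  show "f n \<le> edge r n" for n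
    unfolding f_def edge_def R_def pe_def by (rule rig.edge_degree_prob_ge)
  have "filterlim (\<lambda>n. n - 2) sequentially sequentially" by (rule filterlim_minus_const_nat_at_top)
  then have choose: "(\<lambda>n. real ((n - 2) choose r) / real (n - 2) ^ r) \<longlonglongrightarrow> 1 / fact r"
    by (rule filterlim_compose[OF tendsto_choose_over_power])
  have "(\<lambda>n. real ((n - 2) choose r) / real (n - 2) ^ r * (a n * sqrt (\<beta> n)) ^ r *
      (real n * pe n - real n * R n)) \<longlonglongrightarrow> 1 / fact r * z1 ^ r * (z1\<^sup>2 - 0)"
    by (intro tendsto_mult tendsto_power tendsto_diff choose a_lim pe_lim R_lim)
  moreover have "\<forall>\<^sub>F n in sequentially. real ((n - 2) choose r) / real (n - 2) ^ r * (a n * sqrt (\<beta> n)) ^ r *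
      (real n * pe n - real n * R n) = real n * sqrt (\<beta> n) ^ r * f n"
    using ev_regular
  proof eventually_elim
    case (elim n)
    then have "real (n - 2) \<noteq> 0" by simp
    then have "a n ^ r / real (n - 2) ^ r = rig.mu n 1 ^ r"
      by (simp add: a_def power_mult_distrib)
    then have "real ((n - 2) choose r) * rig.mu n 1 ^ r = real ((n - 2) choose r) / real (n - 2) ^ r * a n ^ r"
      by (metis times_divide_eq_left times_divide_eq_right)
    then show ?case unfolding f_def by (simp add: power_mult_distrib algebra_simps)
  qed
  ultimately have "(\<lambda>n. real n * sqrt (\<beta> n) ^ r * f n) \<longlonglongrightarrow> 1 / fact r * z1 ^ r * (z1\<^sup>2 - 0)"
    by (rule Lim_transform_eventually)
  then show "(\<lambda>n. real n * sqrt (\<beta> n) ^ r * f n) \<longlonglongrightarrow> z1 ^ (r + 2) / fact r"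
    by (simp add: power_add power2_eq_square mult_ac)
qed

lemma edge_nonneg: "0 \<le> edge r n" and nonedge_nonneg: "0 \<le> nonedge r n"
  by (simp_all add: edge_def nonedge_def rig.edge_degree_prob_nonneg rig.nonedge_degree_prob_nonneg)

section \<open>Non-adjacent pairs with one or two common neighbours\<close>

lemma m_shift_ratio: "(\<lambda>n. \<beta> n / real (m n - 2)) \<longlonglongrightarrow> 0"
proof -
  have "(\<lambda>n. (1 / real n) * (1 / (1 - 2 * (1 / real (m n))))) \<longlonglongrightarrow> 0 * (1 / (1 - 2 * 0))"
    by (intro tendsto_intros inverse_n inverse_m) auto
  moreover have "\<forall>\<^sub>F n in sequentially.
      (1 / real n) * (1 / (1 - 2 * (1 / real (m n)))) = \<beta> n / real (m n - 2)"
    using ev_regular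
  proof eventually_elim
    case (elim n)
    then have "real (m n - 2) = real (m n) - 2" by (simp add: of_nat_diff)
    moreover have "1 / (1 - 2 * (1 / real (m n))) = real (m n) / (real (m n) - 2)"
      using elim by (simp add: field_simps)
    ultimately show ?case by (simp add: \<beta>_def)
  qed
  ultimately show ?thesis by (simp add: Lim_transform_eventually)
qed

lemma u_\<beta>_lim: "(\<lambda>n. u n * \<beta> n) \<longlonglongrightarrow> 0"
proof -
  have "(\<lambda>n. u n * (\<beta> n * real n) * (1 / real n)) \<longlonglongrightarrow> z2 * 0"
    by (intro tendsto_mult u_lim inverse_n)
  moreover have "\<forall>\<^sub>F n in sequentially. u n * (\<beta> n * real n) * (1 / real n) = u n * \<beta> n"
    using ev_regular by eventually_elim simp
  ultimately show ?thesis by (simp add: Lim_transform_eventually)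
qed

text \<open>A number \<open>y\<close> below the limit leaves room to lower \<open>z2\<close> and
  \<open>zr\<close> by some \<open>\<epsilon>\<close>. Sizes are truncated at
  \<open>L = K sqrt \<beta>\<close> with \<open>K\<close> fixed; since
  \<open>L\<^sup>2 = K\<^sup>2 \<beta>\<close> and \<open>m = \<beta> n\<close>, all correction
  factors tend to 1. The degrees 1 and 2 are those whose size moment of the same order is controlled
  by the tail of the squares.\<close>

lemma nonedge_lower:
  assumes r: "r = 1 \<or> r = 2" and zr: "zr = (if r = 1 then z1 else z2)"
    and y: "y < z2 ^ r * zr\<^sup>2 / fact r"
  shows "\<forall>\<^sub>F n in sequentially. y < real n ^ r * nonedge r n"
proof -
  have zr_pos: "0 < zr" using zr z1_pos z2_pos by simp
  have "((\<lambda>\<epsilon>. (z2 - \<epsilon>) ^ r * (zr - \<epsilon>)\<^sup>2 / fact r) \<longlongrightarrow> (z2 - 0) ^ r * (zr - 0)\<^sup>2 / fact r) (at_right 0)"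
    by (intro tendsto_intros) auto
  then have "\<forall>\<^sub>F \<epsilon> in at_right 0. y < (z2 - \<epsilon>) ^ r * (zr - \<epsilon>)\<^sup>2 / fact r"
    using y by (intro order_tendstoD) auto
  \<comment> \<open>This keeps \<open>z2 - \<epsilon>\<close> and \<open>zr - \<epsilon>\<close>
    positive, as monotonicity of the powers requires later.\<close>
  moreover have "\<forall>\<^sub>F \<epsilon> in at_right (0::real). \<epsilon> < min z2 zr"
    using z2_pos zr_pos by (intro eventually_at_rightI[of 0 "min z2 zr"]) auto
  ultimately have "\<forall>\<^sub>F \<epsilon> in at_right (0::real). 0 < \<epsilon> \<and> y < (z2 - \<epsilon>) ^ r * (zr - \<epsilon>)\<^sup>2 / fact r \<and> \<epsilon> < min z2 zr"
    using eventually_at_right_less[of "0::real"] by eventually_elim auto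
  then obtain \<epsilon> where \<epsilon>: "0 < \<epsilon>" "y < (z2 - \<epsilon>) ^ r * (zr - \<epsilon>)\<^sup>2 / fact r" "\<epsilon> < z2" "\<epsilon> < zr"
    by (auto dest!: eventually_happens)
  \<comment> \<open>Half of \<open>\<epsilon>\<close> pays for the truncation, the other half for
    the distance of the moments from their limits.\<close>
  obtain K where K: "1 \<le> K" and t: "\<forall>\<^sub>F n in sequentially.
      rig.ES n (\<lambda>k. (real k)\<^sup>2 * of_bool (K * sqrt (\<beta> n) < real k)) / \<beta> n < \<epsilon> / 2"
    using tail[of "\<epsilon> / 2"] \<epsilon> by auto
  define L where "L = (\<lambda>n. K * sqrt (\<beta> n))"
  define d where "d = (\<lambda>n. 1 - 2 * (L n)\<^sup>2 / real (m n - 2))"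
  define p where "p = (\<lambda>n. real ((n - 2) choose r) / real (n - 2) ^ r)"
  \<comment> \<open>The ratio of the exact prefactor \<open>(n - 2) n \<beta> / (m choose 2)\<close>
    to its approximation \<open>2 / \<beta>\<close>.\<close>
  define w where "w = (\<lambda>n. real (n - 2) / real n * (real (m n) / (real (m n) - 1)))"
  have "(\<lambda>n. 1 - 2 * (K\<^sup>2 * (\<beta> n / real (m n - 2)))) \<longlonglongrightarrow> 1 - 2 * (K\<^sup>2 * 0)"
    by (intro tendsto_intros m_shift_ratio)
  moreover have "\<forall>\<^sub>F n in sequentially. 1 - 2 * (K\<^sup>2 * (\<beta> n / real (m n - 2))) = d n"
    using ev_regular by eventually_elim (simp add: d_def L_def power_mult_distrib)
  ultimately have d_lim: "d \<longlonglongrightarrow> 1" by (simp add: Lim_transform_eventually)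
  have "(\<lambda>n. K\<^sup>2 * (u n * \<beta> n)) \<longlonglongrightarrow> K\<^sup>2 * 0" by (intro tendsto_mult u_\<beta>_lim tendsto_const)
  moreover have "\<forall>\<^sub>F n in sequentially. K\<^sup>2 * (u n * \<beta> n) = u n * (L n)\<^sup>2"
    using ev_regular by eventually_elim (simp add: L_def power_mult_distrib)
  ultimately have uL_lim: "(\<lambda>n. u n * (L n)\<^sup>2) \<longlonglongrightarrow> 0" by (simp add: Lim_transform_eventually)
  have "(\<lambda>n. K\<^sup>2 * (1 / real n)) \<longlonglongrightarrow> K\<^sup>2 * 0" by (intro tendsto_intros inverse_n)
  moreover have "\<forall>\<^sub>F n in sequentially. K\<^sup>2 * (1 / real n) = (L n)\<^sup>2 / real (m n)"
    using ev_regular by eventually_elim (simp add: L_def power_mult_distrib)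
  ultimately have Lm_lim: "(\<lambda>n. (L n)\<^sup>2 / real (m n)) \<longlonglongrightarrow> 0" by (simp add: Lim_transform_eventually)
  have "filterlim (\<lambda>n. n - 2) sequentially sequentially" by (rule filterlim_minus_const_nat_at_top)
  then have p_lim: "p \<longlonglongrightarrow> 1 / fact r"
    unfolding p_def by (rule filterlim_compose[OF tendsto_choose_over_power])
  have w_lim: "w \<longlonglongrightarrow> 1 * 1" unfolding w_def by (intro tendsto_mult shifted_ratio m_ratio)
  have "(\<lambda>n. p n * (w n * (z2 - \<epsilon>) * d n) ^ r * (1 - u n * (L n)\<^sup>2) * (1 - (L n)\<^sup>2 / real (m n)) * (zr - \<epsilon>)\<^sup>2)
    \<longlonglongrightarrow> 1 / fact r * (1 * 1 * (z2 - \<epsilon>) * 1) ^ r * (1 - 0) * (1 - 0) * (zr - \<epsilon>)\<^sup>2"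
    by (intro tendsto_mult tendsto_power tendsto_diff tendsto_const p_lim w_lim d_lim uL_lim Lm_lim)
  then have main: "\<forall>\<^sub>F n in sequentially. y < p n * (w n * (z2 - \<epsilon>) * d n) ^ r * (1 - u n * (L n)\<^sup>2) *
      (1 - (L n)\<^sup>2 / real (m n)) * (zr - \<epsilon>)\<^sup>2"
    using \<epsilon>(2) by (intro order_tendstoD(1)) auto
  have ev_c2: "\<forall>\<^sub>F n in sequentially. z2 - \<epsilon> / 2 < 2 * rig.c2 n / \<beta> n"
    using c2_lim by (rule order_tendstoD) (use \<epsilon> in simp)
  have ev_e1: "\<forall>\<^sub>F n in sequentially. z1 - \<epsilon> / 2 < rig.e1 n / sqrt (\<beta> n)"
    using e1_lim by (rule order_tendstoD) (use \<epsilon> in simp)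
  have ev_e2: "\<forall>\<^sub>F n in sequentially. z2 - \<epsilon> / 2 < rig.e2 n / \<beta> n"
    using e2_lim by (rule order_tendstoD) (use \<epsilon> in simp)
  have ev_d: "\<forall>\<^sub>F n in sequentially. 0 < d n" using d_lim by (rule order_tendstoD) simp
  have ev_u: "\<forall>\<^sub>F n in sequentially. u n * (L n)\<^sup>2 < 1" using uL_lim by (rule order_tendstoD) simp
  have ev_Lm: "\<forall>\<^sub>F n in sequentially. (L n)\<^sup>2 / real (m n) < 1" using Lm_lim by (rule order_tendstoD) simp
  show ?thesis
    using main ev_c2 ev_e1 ev_e2 ev_d ev_u ev_Lm t ev_regular
  proof eventually_elim
    case (elim n)
    let ?I = "\<lambda>k. of_bool (real k \<le> L n) :: real" and ?J = "\<lambda>k. of_bool (L n < real k) :: real"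
    define s where "s = sqrt (\<beta> n)"
    have s: "1 \<le> s" "s\<^sup>2 = \<beta> n" "0 < s" using elim by (auto simp: s_def)
    have L0: "0 \<le> L n" "s \<le> L n" using K s mult_right_mono[of 1 K s] by (auto simp: L_def s_def[symmetric])
    define t where "t = rig.ES n (\<lambda>k. (real k)\<^sup>2 * ?J k)"
    have t: "t / \<beta> n < \<epsilon> / 2" using elim by (simp add: t_def L_def)
    define b where "b = rig.ES n (\<lambda>k. real (k choose 2) * ?I k)"
    have b_ge: "2 * rig.c2 n - t \<le> 2 * b"
    proof -
      have "2 * rig.c2 n - t = rig.ES n (\<lambda>k. 2 * real (k choose 2) - (real k)\<^sup>2 * ?J k)"
        by (simp add: t_def rig.c2_def)
      also have "\<dots> \<le> rig.ES n (\<lambda>k. 2 * (real (k choose 2) * ?I k))"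
      proof (rule rig.ES_mono)
        fix k
        show "2 * real (k choose 2) - (real k)\<^sup>2 * ?J k \<le> 2 * (real (k choose 2) * ?I k)"
          using two_choose_le[of k] by (cases "real k \<le> L n") (auto simp: power2_eq_square)
      qed
      finally show ?thesis by (simp add: b_def)
    qed
    define x where "x = rig.ES n (\<lambda>k. real k ^ r * ?I k)"
    have x_ge: "zr - \<epsilon> \<le> x / s ^ r"
      using r
    proof
      assume r1: "r = 1"
      have "rig.e1 n - t / s = rig.ES n (\<lambda>k. real k - (real k)\<^sup>2 * ?J k / s)"
        by (simp add: t_def rig.e1_def)
      also have "\<dots> \<le> rig.ES n (\<lambda>k. real k * ?I k)"
      proof (rule rig.ES_mono)
        fix k
        show "real k - (real k)\<^sup>2 * ?J k / s \<le> real k * ?I k"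
        proof (cases "real k \<le> L n")
          case False
          \<comment> \<open>The condition \<open>1 \<le> K\<close> enters here: beyond
            \<open>L\<close> the size exceeds \<open>s = sqrt \<beta>\<close>, so the tail of the
            first moment is dominated by that of the second divided by \<open>s\<close>.\<close>
          then have "s * real k \<le> real k * real k" using L0 by (intro mult_right_mono) auto
          then show ?thesis using False s by (simp add: field_simps power2_eq_square)
        qed simp
      qed
      finally have "(rig.e1 n - t / s) / s \<le> x / s" using s r1 by (simp add: x_def divide_right_mono)
      moreover have "(rig.e1 n - t / s) / s = rig.e1 n / s - t / \<beta> n"
        using s by (simp add: diff_divide_distrib power2_eq_square flip: s(2))
      ultimately show ?thesis using t elim r1 zr by (simp add: s_def)
    next
      assume r2: "r = 2"
      have "rig.e2 n - t = rig.ES n (\<lambda>k. (real k)\<^sup>2 - (real k)\<^sup>2 * ?J k)"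
        by (simp add: t_def rig.e2_def)
      also have "\<dots> \<le> x"
        unfolding x_def r2 by (intro rig.ES_mono) (auto simp: not_le)
      finally have "(rig.e2 n - t) / \<beta> n \<le> x / \<beta> n" using elim by (simp add: divide_right_mono)
      then show ?thesis using t elim r2 zr s by (simp add: diff_divide_distrib)
    qed
    have bm: "rig.binom_moment n 2 ?I = b / real (m n choose 2)"
      by (simp add: rig.binom_moment_def b_def)
    have w0: "0 \<le> w n" using elim by (auto simp: w_def)
    have p0: "0 \<le> p n" by (simp add: p_def)
    have wb: "w n * (z2 - \<epsilon>) \<le> real (n - 2) * real n * (\<beta> n * (b / real (m n choose 2)))"
    proof -
      have "z2 - \<epsilon> \<le> (2 * rig.c2 n - t) / \<beta> n" using elim t by (simp add: diff_divide_distrib)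
      also have "\<dots> \<le> 2 * b / \<beta> n" using b_ge elim by (intro divide_right_mono) auto
      finally have "w n * (z2 - \<epsilon>) \<le> w n * (2 * b / \<beta> n)" using w0 by (rule mult_left_mono)
      also have "\<dots> = real (n - 2) * real n * (\<beta> n * (b / real (m n choose 2)))"
      proof -
        have "real (m n) - 1 \<noteq> 0" "real n \<noteq> 0" "\<beta> n \<noteq> 0" using elim by linarith+
        then show ?thesis unfolding w_def choose_m_2 using elim by (simp add: divide_simps del: One_nat_def)
      qed
      finally show ?thesis .
    qed
    have "y < p n * (w n * (z2 - \<epsilon>) * d n) ^ r * (1 - u n * (L n)\<^sup>2) *
        (1 - (L n)\<^sup>2 / real (m n)) * (zr - \<epsilon>)\<^sup>2" by (rule elim)
    also have "\<dots> \<le> p n * (real (n - 2) * real n * (\<beta> n * (b / real (m n choose 2))) * d n) ^ r *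
        (1 - u n * (L n)\<^sup>2) * (1 - (L n)\<^sup>2 / real (m n)) * (x / s ^ r)\<^sup>2"
    proof (rule mult_mono)
      show "(zr - \<epsilon>)\<^sup>2 \<le> (x / s ^ r)\<^sup>2" using x_ge \<epsilon> by (intro power_mono) auto
      have "(w n * (z2 - \<epsilon>) * d n) ^ r \<le> (real (n - 2) * real n * (\<beta> n * (b / real (m n choose 2))) * d n) ^ r"
        using wb elim w0 \<epsilon> by (intro power_mono mult_right_mono) auto
      then show "p n * (w n * (z2 - \<epsilon>) * d n) ^ r * (1 - u n * (L n)\<^sup>2) * (1 - (L n)\<^sup>2 / real (m n)) \<le>
        p n * (real (n - 2) * real n * (\<beta> n * (b / real (m n choose 2))) * d n) ^ r *
        (1 - u n * (L n)\<^sup>2) * (1 - (L n)\<^sup>2 / real (m n))"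
        using p0 elim by (intro mult_right_mono mult_left_mono) auto
      have "0 \<le> b" unfolding b_def by (intro rig.ES_nonneg) simp
      then show "0 \<le> p n * (real (n - 2) * real n * (\<beta> n * (b / real (m n choose 2))) * d n) ^ r *
        (1 - u n * (L n)\<^sup>2) * (1 - (L n)\<^sup>2 / real (m n))"
        using p0 elim by (intro mult_nonneg_nonneg zero_le_power) auto
    qed simp
    also have "\<dots> = real n ^ r * (real ((n - 2) choose r) * (rig.binom_moment n 2 ?I * d n) ^ r *
        (1 - u n * (L n)\<^sup>2) * (1 - (L n)\<^sup>2 / real (m n)) * x\<^sup>2)"
    proof -
      define g where "g = (1 - u n * (L n)\<^sup>2) * (1 - (L n)\<^sup>2 / real (m n))"
      have 1: "p n * real (n - 2) ^ r = real ((n - 2) choose r)" using elim by (simp add: p_def)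
      have 2: "\<beta> n ^ r * (x / s ^ r)\<^sup>2 = x\<^sup>2"
        using s by (simp add: power_divide power_mult[symmetric] mult.commute flip: s(2))
      have "p n * (real (n - 2) * real n * (\<beta> n * (b / real (m n choose 2))) * d n) ^ r * g * (x / s ^ r)\<^sup>2
        = (p n * real (n - 2) ^ r) * (real n ^ r) * (b / real (m n choose 2) * d n) ^ r * g * (\<beta> n ^ r * (x / s ^ r)\<^sup>2)"
        by (simp only: power_mult_distrib mult_ac)
      also have "\<dots> = real n ^ r * (real ((n - 2) choose r) * (rig.binom_moment n 2 ?I * d n) ^ r * g * x\<^sup>2)"
        unfolding 1 2 bm by (simp only: mult_ac)
      finally show ?thesis unfolding g_def by (simp only: mult.assoc)
    qed
    also have "\<dots> \<le> real n ^ r * nonedge r n"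
    proof (rule mult_left_mono)
      have "2 * (L n)\<^sup>2 \<le> real (m n - 2)"
        using elim by (simp add: d_def field_simps)
      then show "real ((n - 2) choose r) * (rig.binom_moment n 2 ?I * d n) ^ r *
        (1 - u n * (L n)\<^sup>2) * (1 - (L n)\<^sup>2 / real (m n)) * x\<^sup>2 \<le> nonedge r n"
        unfolding nonedge_def x_def d_def u_def
        using elim by (intro rig.nonedge_degree_prob_ge L0) (auto simp: u_def)
    qed simp
    finally show ?case .
  qed
qed

lemma nonedge_1_lim: "(\<lambda>n. real n * nonedge 1 n) \<longlonglongrightarrow> z2 * z1\<^sup>2"
proof (rule order_tendstoI)
  fix y assume "y < z2 * z1\<^sup>2"
  then show "\<forall>\<^sub>F n in sequentially. y < real n * nonedge 1 n"
    using nonedge_lower[of 1 z1 y] by simp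
next
  fix y assume y: "z2 * z1\<^sup>2 < y"
  have "(\<lambda>n. u n * (\<beta> n * real n) * (rig.e1 n / sqrt (\<beta> n))\<^sup>2) \<longlonglongrightarrow> z2 * z1\<^sup>2"
    by (intro tendsto_mult u_lim tendsto_power e1_lim)
  then have "\<forall>\<^sub>F n in sequentially. u n * (\<beta> n * real n) * (rig.e1 n / sqrt (\<beta> n))\<^sup>2 < y"
    using y by (rule order_tendstoD)
  then show "\<forall>\<^sub>F n in sequentially. real n * nonedge 1 n < y"
    using ev_regular
  proof eventually_elim
    case (elim n)
    have "real n * nonedge 1 n \<le> real n * (u n * (rig.e1 n)\<^sup>2)"
      unfolding nonedge_def u_def by (intro mult_left_mono rig.nonedge_degree_prob_1_le) auto
    also have "\<dots> = u n * (\<beta> n * real n) * (rig.e1 n / sqrt (\<beta> n))\<^sup>2"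
      using elim by (simp add: power_divide)
    finally show ?case using elim by linarith
  qed
qed

lemma u_e2_lim: "(\<lambda>n. (real n)\<^sup>2 * (u n * rig.e2 n)\<^sup>2) \<longlonglongrightarrow> z2 ^ 4"
proof -
  have "(\<lambda>n. (u n * (\<beta> n * real n) * (rig.e2 n / \<beta> n))\<^sup>2) \<longlonglongrightarrow> (z2 * z2)\<^sup>2"
    by (intro tendsto_mult u_lim tendsto_power e2_lim)
  moreover have "\<forall>\<^sub>F n in sequentially.
      (u n * (\<beta> n * real n) * (rig.e2 n / \<beta> n))\<^sup>2 = (real n)\<^sup>2 * (u n * rig.e2 n)\<^sup>2"
    using ev_regular by eventually_elim (simp add: power_mult_distrib field_simps)
  ultimately have "(\<lambda>n. (real n)\<^sup>2 * (u n * rig.e2 n)\<^sup>2) \<longlonglongrightarrow> (z2 * z2)\<^sup>2"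
    by (rule Lim_transform_eventually)
  then show ?thesis by (simp add: power2_eq_square power4_eq_xxxx mult.assoc)
qed

lemma nonedge_2_lim: "(\<lambda>n. (real n)\<^sup>2 * nonedge 2 n) \<longlonglongrightarrow> z2 ^ 4 / 2"
proof (rule order_tendstoI)
  fix y assume "y < z2 ^ 4 / 2"
  then show "\<forall>\<^sub>F n in sequentially. y < (real n)\<^sup>2 * nonedge 2 n"
    using nonedge_lower[of 2 z2 y] by (simp add: power_add[symmetric])
next
  fix y assume y: "z2 ^ 4 / 2 < y"
  have "\<forall>\<^sub>F n in sequentially. (real n)\<^sup>2 * (u n * rig.e2 n)\<^sup>2 / 2 < y"
    by (rule order_tendstoD[OF _ y]) (intro tendsto_divide u_e2_lim tendsto_const, simp)
  then show "\<forall>\<^sub>F n in sequentially. (real n)\<^sup>2 * nonedge 2 n < y"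
  proof eventually_elim
    case (elim n)
    have "(real n)\<^sup>2 * nonedge 2 n \<le> (real n)\<^sup>2 * ((u n * rig.e2 n)\<^sup>2 / 2)"
      unfolding nonedge_def u_def by (intro mult_left_mono rig.nonedge_degree_prob_2_le) auto
    then show ?case using elim by simp
  qed
qed

section \<open>Adjacent pairs with two common neighbours\<close>

text \<open>Only second moments are available; capping the factor \<open>k l / m\<close> at 1 makes \<open>T\<close> vanish in the
  limit nevertheless.\<close>

definition T :: "nat \<Rightarrow> real" where
  "T n = rig.ES2 n (\<lambda>k l. min 1 (real k * real l / real (m n)) * ((real k)\<^sup>2 * (real l)\<^sup>2)) / (\<beta> n)\<^sup>2"

lemma T_nonneg: "0 \<le> T n"
  unfolding T_def by (intro divide_nonneg_nonneg rig.ES_nonneg mult_nonneg_nonneg) auto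

text \<open>If both sizes are at most \<open>L = K sqrt \<beta>\<close>, the capped factor is at
  most \<open>L\<^sup>2 / m = K\<^sup>2 / n\<close>. Otherwise it is at most 1 and one of the
  squares lies in the uniformly small tail.\<close>

lemma T_lim: "T \<longlonglongrightarrow> 0"
proof (rule order_tendstoI)
  fix y :: real assume "y < 0"
  then show "\<forall>\<^sub>F n in sequentially. y < T n" using T_nonneg by (auto intro: less_le_trans always_eventually)
next
  fix y :: real assume y: "0 < y"
  \<comment> \<open>Chosen so that the two tail contributions, \<open>2 \<epsilon> z2\<close> in the
    limit, amount to \<open>y / 2\<close>.\<close>
  define \<epsilon> where "\<epsilon> = y / (4 * z2)"
  have \<epsilon>: "0 < \<epsilon>" "2 * \<epsilon> * z2 < y" using y z2_pos by (auto simp: \<epsilon>_def)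
  obtain K where K: "1 \<le> K" and t: "\<forall>\<^sub>F n in sequentially.
      rig.ES n (\<lambda>k. (real k)\<^sup>2 * of_bool (K * sqrt (\<beta> n) < real k)) / \<beta> n < \<epsilon>"
    using tail[of \<epsilon>] \<epsilon> by auto
  have "(\<lambda>n. K\<^sup>2 * (1 / real n) * (rig.e2 n / \<beta> n)\<^sup>2 + 2 * \<epsilon> * (rig.e2 n / \<beta> n)) \<longlonglongrightarrow> K\<^sup>2 * 0 * z2\<^sup>2 + 2 * \<epsilon> * z2"
    by (intro tendsto_intros inverse_n e2_lim)
  then have "\<forall>\<^sub>F n in sequentially. K\<^sup>2 * (1 / real n) * (rig.e2 n / \<beta> n)\<^sup>2 + 2 * \<epsilon> * (rig.e2 n / \<beta> n) < y"
    by (rule order_tendstoD) (use \<epsilon> in simp)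
  then show "\<forall>\<^sub>F n in sequentially. T n < y"
    using t ev_regular
  proof eventually_elim
    case (elim n)
    define L where "L = K * sqrt (\<beta> n)"
    let ?J = "\<lambda>k. of_bool (L < real k) :: real"
    define t where "t = rig.ES n (\<lambda>k. (real k)\<^sup>2 * ?J k)"
    have t: "t / \<beta> n < \<epsilon>" using elim by (simp add: t_def L_def)
    have L: "0 \<le> L" "L\<^sup>2 / real (m n) = K\<^sup>2 * (1 / real n)"
      using elim K by (auto simp: L_def power_mult_distrib)
    have e2: "0 \<le> rig.e2 n" unfolding rig.e2_def by (intro rig.ES_nonneg) simp
    have "rig.ES2 n (\<lambda>k l. min 1 (real k * real l / real (m n)) * ((real k)\<^sup>2 * (real l)\<^sup>2)) \<le>
      rig.ES2 n (\<lambda>k l. L\<^sup>2 / real (m n) * ((real k)\<^sup>2 * (real l)\<^sup>2)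
        + ((real k)\<^sup>2 * ?J k) * (real l)\<^sup>2 + (real k)\<^sup>2 * ((real l)\<^sup>2 * ?J l))"
    proof (rule rig.ES2_mono)
      fix k l
      define X where "X = (real k)\<^sup>2 * (real l)\<^sup>2"
      have X: "0 \<le> X" by (simp add: X_def)
      have "min 1 (real k * real l / real (m n)) * X \<le> L\<^sup>2 / real (m n) * X + X * ?J k + X * ?J l"
      proof (cases "real k \<le> L \<and> real l \<le> L")
        case True
        then have "real k * real l \<le> L\<^sup>2" unfolding power2_eq_square by (intro mult_mono) auto
        then have "min 1 (real k * real l / real (m n)) \<le> L\<^sup>2 / real (m n)"
          by (simp add: min.coboundedI2 divide_right_mono)
        then have "min 1 (real k * real l / real (m n)) * X \<le> L\<^sup>2 / real (m n) * X"
          using X by (rule mult_right_mono)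
        then show ?thesis using True by simp
      next
        case False
        then have "1 \<le> ?J k + ?J l" by auto
        then have "X * 1 \<le> X * (?J k + ?J l)" using X by (rule mult_left_mono)
        moreover have "min 1 (real k * real l / real (m n)) * X \<le> 1 * X"
          using X by (intro mult_right_mono) auto
        moreover have "0 \<le> L\<^sup>2 / real (m n) * X" using X by simp
        ultimately show ?thesis by (simp only: distrib_left)
      qed
      then show "min 1 (real k * real l / real (m n)) * ((real k)\<^sup>2 * (real l)\<^sup>2) \<le>
        L\<^sup>2 / real (m n) * ((real k)\<^sup>2 * (real l)\<^sup>2)
        + ((real k)\<^sup>2 * ?J k) * (real l)\<^sup>2 + (real k)\<^sup>2 * ((real l)\<^sup>2 * ?J l)"
        by (simp add: X_def mult_ac)
    qed
    also have "\<dots> = L\<^sup>2 / real (m n) * (rig.e2 n * rig.e2 n) + t * rig.e2 n + rig.e2 n * t"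
      by (simp add: rig.e2_def t_def)
    finally have "T n \<le> (L\<^sup>2 / real (m n) * (rig.e2 n * rig.e2 n) + t * rig.e2 n + rig.e2 n * t) / (\<beta> n)\<^sup>2"
      unfolding T_def by (rule divide_right_mono) simp
    also have "\<dots> = K\<^sup>2 * (1 / real n) * (rig.e2 n / \<beta> n)\<^sup>2 + 2 * (t / \<beta> n) * (rig.e2 n / \<beta> n)"
      unfolding L using elim by (simp add: add_divide_distrib power2_eq_square)
    also have "\<dots> \<le> K\<^sup>2 * (1 / real n) * (rig.e2 n / \<beta> n)\<^sup>2 + 2 * \<epsilon> * (rig.e2 n / \<beta> n)"
      using t e2 elim by (intro add_left_mono mult_right_mono) auto
    finally show ?case using elim by simp
  qed
qed

lemma u_m_lim: "(\<lambda>n. u n * real (m n)) \<longlonglongrightarrow> z2"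
proof -
  have "\<forall>\<^sub>F n in sequentially. u n * (\<beta> n * real n) = u n * real (m n)"
    using ev_regular by eventually_elim simp
  with u_lim show ?thesis by (rule Lim_transform_eventually)
qed

text \<open>The two caps differ: \<open>u k l\<close> here against \<open>k l / m\<close> in
  \<open>T\<close>. Since \<open>u m\<close> converges, the constant \<open>max 1 (u m)\<close> that
  can be pulled out of the minimum stays bounded.\<close>

lemma ES2_choose_min_le:
  assumes "0 < m n" "\<beta> n \<noteq> 0"
  shows "rig.ES2 n (\<lambda>k l. real (k choose 2) * real (l choose 2) * min 1 (u n * (real k * real l))) \<le>
    max 1 (u n * real (m n)) / 4 * (T n * (\<beta> n)\<^sup>2)"
proof -
  have half: "real (k choose 2) \<le> (real k)\<^sup>2 / 2" for k
    using two_choose_le[of k] by (simp add: power2_eq_square)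
  define c where "c = max 1 (u n * real (m n))"
  have c1: "1 \<le> c" by (simp add: c_def)
  have "rig.ES2 n (\<lambda>k l. real (k choose 2) * real (l choose 2) * min 1 (u n * (real k * real l))) \<le>
     rig.ES2 n (\<lambda>k l. c / 4 * (min 1 (real k * real l / real (m n)) * ((real k)\<^sup>2 * (real l)\<^sup>2)))"
  proof (rule rig.ES2_mono)
    fix k l
    let ?y = "real k * real l / real (m n)"
    have "u n * (real k * real l) = u n * real (m n) * ?y" using assms by simp
    also have "\<dots> \<le> c * ?y" by (intro mult_right_mono) (auto simp: c_def)
    finally have "min 1 (u n * (real k * real l)) \<le> c * min 1 ?y"
      using c1 by (auto simp: min_def)
    moreover have "real (k choose 2) * real (l choose 2) \<le> ((real k)\<^sup>2 / 2) * ((real l)\<^sup>2 / 2)"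
      by (intro mult_mono half) auto
    ultimately have "real (k choose 2) * real (l choose 2) * min 1 (u n * (real k * real l)) \<le>
        ((real k)\<^sup>2 / 2) * ((real l)\<^sup>2 / 2) * (c * min 1 ?y)"
      using u_nonneg[of n] by (intro mult_mono[where d = "c * min 1 (real k * real l / real (m n))"]) auto
    then show "real (k choose 2) * real (l choose 2) * min 1 (u n * (real k * real l)) \<le>
      c / 4 * (min 1 ?y * ((real k)\<^sup>2 * (real l)\<^sup>2))"
      by (simp add: mult_ac)
  qed
  also have "\<dots> = c / 4 * rig.ES2 n (\<lambda>k l. min 1 (real k * real l / real (m n)) * ((real k)\<^sup>2 * (real l)\<^sup>2))"
    by simp
  also have "\<dots> = c / 4 * (T n * (\<beta> n)\<^sup>2)"
    using assms by (simp add: T_def)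
  finally show ?thesis unfolding c_def .
qed

text \<open>The minorant for degree 2 has order 1 / (\<beta> n), so the scaling by n^2 produces the
  ratio n / \<beta>. The upper bound has the same limit even for \<open>\<gamma> = 0\<close>, as all
  its other terms are o(n^-2).\<close>

lemma edge_2_lim:
  assumes \<gamma>: "(\<lambda>n. real n / \<beta> n) \<longlonglongrightarrow> \<gamma>"
  shows "(\<lambda>n. (real n)\<^sup>2 * edge 2 n) \<longlonglongrightarrow> \<gamma> * z1 ^ 4 / 2"
proof -
  obtain f where f: "\<And>n. f n \<le> edge 2 n" "(\<lambda>n. real n * sqrt (\<beta> n) ^ 2 * f n) \<longlonglongrightarrow> z1 ^ (2 + 2) / fact 2"
    by (rule edge_lower[where r = 2], rule that, assumption+)
  have "(\<lambda>n. (real n / \<beta> n) * (real n * sqrt (\<beta> n) ^ 2 * f n)) \<longlonglongrightarrow> \<gamma> * (z1 ^ (2 + 2) / fact 2)"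
    by (intro tendsto_mult \<gamma> f)
  moreover have "\<forall>\<^sub>F n in sequentially. (real n / \<beta> n) * (real n * sqrt (\<beta> n) ^ 2 * f n) = (real n)\<^sup>2 * f n"
    using ev_regular by eventually_elim (simp add: power2_eq_square)
  ultimately have "(\<lambda>n. (real n)\<^sup>2 * f n) \<longlonglongrightarrow> \<gamma> * (z1 ^ (2 + 2) / fact 2)"
    by (rule Lim_transform_eventually)
  then have lower: "(\<lambda>n. (real n)\<^sup>2 * f n) \<longlonglongrightarrow> \<gamma> * z1 ^ 4 / 2" by (simp add: fact_numeral)
  \<comment> \<open>The five summands of \<open>edge_degree_prob_2_le\<close> multiplied by n^2,
    regrouped into convergent factors; each but the first contains \<open>a\<close> or
    \<open>T\<close> and vanishes.\<close>
  define g where "g = (\<lambda>n. (a n * sqrt (\<beta> n))\<^sup>2 / 2 * (real n * ((rig.e1 n)\<^sup>2 / real (m n))) * (real n / \<beta> n)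
      + a n * (u n * (\<beta> n * real n)) * (real n / \<beta> n * ((rig.e2 n)\<^sup>2 / real (m n)))
      + (u n * (\<beta> n * real n))\<^sup>2 / 2 * T n
      + 2 * a n * ((real n)\<^sup>2 * ((rig.c2 n)\<^sup>2 / real (m n choose 2)))
      + max 1 (u n * real (m n)) / 2 * (real (m n) / (real (m n) - 1)) * T n)"
  have "g \<longlonglongrightarrow> z1\<^sup>2 / 2 * z1\<^sup>2 * \<gamma> + 0 * z2 * z2\<^sup>2 + z2\<^sup>2 / 2 * 0 + 2 * 0 * (z2\<^sup>2 / 2) + max 1 z2 / 2 * 1 * 0"
    unfolding g_def
    by (intro tendsto_add tendsto_mult tendsto_divide tendsto_max tendsto_const tendsto_power a_lim e1_square_lim \<gamma>
      a_lim_0 u_lim e2_square_lim T_lim c2_square_lim u_m_lim m_ratio) simp_all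
  then have g: "g \<longlonglongrightarrow> \<gamma> * z1 ^ 4 / 2" by (simp add: power2_eq_square power4_eq_xxxx mult_ac)
  show ?thesis
  proof (rule tendsto_sandwich[OF _ _ lower g])
    show "\<forall>\<^sub>F n in sequentially. (real n)\<^sup>2 * f n \<le> (real n)\<^sup>2 * edge 2 n"
      using f by (intro always_eventually allI mult_left_mono) auto
    show "\<forall>\<^sub>F n in sequentially. (real n)\<^sup>2 * edge 2 n \<le> g n"
      using ev_regular
    proof eventually_elim
      case (elim n)
      then have m0: "0 < m n" by linarith
      define U where "U = rig.ES2 n (\<lambda>k l. real (k choose 2) * real (l choose 2) * min 1 (u n * (real k * real l)))"
      have C: "real (m n choose 2) > 0" using elim by simp
      have "edge 2 n \<le> (a n)\<^sup>2 / 2 * ((rig.e1 n)\<^sup>2 / real (m n)) + a n * u n * ((rig.e2 n)\<^sup>2 / real (m n))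
         + (u n)\<^sup>2 / 2 * (T n * (\<beta> n)\<^sup>2) + 2 * a n * ((rig.c2 n)\<^sup>2 / real (m n choose 2)) + U / real (m n choose 2)"
        using rig.edge_degree_prob_2_le[OF m0, of "n - 2"] elim
        by (simp add: edge_def a_def u_def U_def T_def)
      also have "U / real (m n choose 2) \<le> max 1 (u n * real (m n)) / 4 * (T n * (\<beta> n)\<^sup>2) / real (m n choose 2)"
        unfolding U_def using C elim by (intro divide_right_mono ES2_choose_min_le m0) auto
      finally have "(real n)\<^sup>2 * edge 2 n \<le> (real n)\<^sup>2 * ((a n)\<^sup>2 / 2 * ((rig.e1 n)\<^sup>2 / real (m n)) + a n * u n * ((rig.e2 n)\<^sup>2 / real (m n))
         + (u n)\<^sup>2 / 2 * (T n * (\<beta> n)\<^sup>2) + 2 * a n * ((rig.c2 n)\<^sup>2 / real (m n choose 2))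
         + max 1 (u n * real (m n)) / 4 * (T n * (\<beta> n)\<^sup>2) / real (m n choose 2))"
        by (intro mult_left_mono) auto
      also have "\<dots> = g n"
      proof -
        have 1: "(real n)\<^sup>2 * ((a n)\<^sup>2 / 2 * x) = (a n * sqrt (\<beta> n))\<^sup>2 / 2 * (real n * x) * (real n / \<beta> n)" for x
        proof -
          have "(sqrt (\<beta> n))\<^sup>2 = \<beta> n" "\<beta> n \<noteq> 0" using elim by auto
          then show ?thesis by (simp add: power_mult_distrib power2_eq_square[of "real n"])
        qed
        have 2: "(real n)\<^sup>2 * (a n * u n * x) = a n * (u n * (\<beta> n * real n)) * (real n / \<beta> n * x)" for x
          using elim by (simp add: power2_eq_square)
        have 3: "(real n)\<^sup>2 * ((u n)\<^sup>2 / 2 * (T n * (\<beta> n)\<^sup>2)) = (u n * (\<beta> n * real n))\<^sup>2 / 2 * T n"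
          by (simp add: power_mult_distrib)
        have 5: "(real n)\<^sup>2 * (c / 4 * (T n * (\<beta> n)\<^sup>2) / real (m n choose 2)) =
            c / 2 * (real (m n) / (real (m n) - 1)) * T n" for c
        proof -
          have m1: "real (m n) \<noteq> 0" "real (m n) - 1 \<noteq> 0" using elim by linarith+
          have "(real n)\<^sup>2 * (c / 4 * (T n * (\<beta> n)\<^sup>2) / real (m n choose 2)) =
              c / 2 * T n * ((\<beta> n * real n)\<^sup>2 / (real (m n) * (real (m n) - 1)))"
            unfolding choose_m_2 by (simp add: power_mult_distrib)
          also have "(\<beta> n * real n)\<^sup>2 = real (m n) * real (m n)" using elim by (simp add: power2_eq_square)
          finally show ?thesis using m1 by simp
        qed
        show ?thesis unfolding g_def distrib_left 1 2 3 5 by simp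
      qed
      finally show "(real n)\<^sup>2 * edge 2 n \<le> g n" .
    qed
  qed
qed

section \<open>Limits of the clustering function\<close>

definition cl :: "nat \<Rightarrow> nat \<Rightarrow> real" where
  "cl r n = edge r n / (edge r n + nonedge r n)"

lemma n_edge_0: "(\<lambda>n. real n * edge 0 n) \<longlonglongrightarrow> z1\<^sup>2"
proof -
  obtain f where f: "\<And>n. f n \<le> edge 0 n" "(\<lambda>n. real n * sqrt (\<beta> n) ^ 0 * f n) \<longlonglongrightarrow> z1 ^ (0 + 2) / fact 0"
    by (rule edge_lower[where r = 0], rule that, assumption+)
  show ?thesis
  proof (rule tendsto_sandwich[OF always_eventually always_eventually _ pe_lim])
    show "(\<lambda>n. real n * f n) \<longlonglongrightarrow> z1\<^sup>2" using f(2) by (simp add: power2_eq_square)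
    show "\<forall>n. real n * f n \<le> real n * edge 0 n" using f by (intro allI mult_left_mono) auto
    show "\<forall>n. real n * edge 0 n \<le> real n * pe n"
      unfolding edge_def pe_def by (intro allI mult_left_mono rig.edge_degree_prob_le_two_edge_prob) auto
  qed
qed

lemma degree_0_lim: "(\<lambda>n. edge 0 n + nonedge 0 n) \<longlonglongrightarrow> 1"
proof (rule tendsto_sandwich[OF always_eventually always_eventually _ tendsto_const])
  have "(\<lambda>n. 1 - (a n * (real n * ((rig.e1 n)\<^sup>2 / real (m n))) * (1 / real n)
      + u n * (\<beta> n * real n) * (rig.e1 n / sqrt (\<beta> n))\<^sup>2 * (1 / real n))) \<longlonglongrightarrow> 1 - (0 * z1\<^sup>2 * 0 + z2 * z1\<^sup>2 * 0)"
    by (intro tendsto_intros a_lim_0 e1_square_lim inverse_n u_lim e1_lim)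
  moreover have "\<forall>\<^sub>F n in sequentially. 1 - (a n * (real n * ((rig.e1 n)\<^sup>2 / real (m n))) * (1 / real n)
      + u n * (\<beta> n * real n) * (rig.e1 n / sqrt (\<beta> n))\<^sup>2 * (1 / real n)) =
      1 - (a n * ((rig.e1 n)\<^sup>2 / real (m n)) + u n * (rig.e1 n)\<^sup>2)"
    using ev_regular by eventually_elim (simp add: power_divide)
  ultimately show "(\<lambda>n. 1 - (a n * ((rig.e1 n)\<^sup>2 / real (m n)) + u n * (rig.e1 n)\<^sup>2)) \<longlonglongrightarrow> 1"
    by (simp add: Lim_transform_eventually)
  show "\<forall>n. 1 - (a n * ((rig.e1 n)\<^sup>2 / real (m n)) + u n * (rig.e1 n)\<^sup>2) \<le> edge 0 n + nonedge 0 n"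
    unfolding edge_def nonedge_def a_def u_def by (intro allI rig.degree_prob_0_ge)
  show "\<forall>n. edge 0 n + nonedge 0 n \<le> 1"
    unfolding edge_def nonedge_def by (intro allI rig.degree_prob_le_1)
qed

lemma n_cl_0: "(\<lambda>n. real n * cl 0 n) \<longlonglongrightarrow> z1\<^sup>2"
  using tendsto_divide[OF n_edge_0 degree_0_lim] by (simp add: cl_def)

lemma cl_0_ratio: "(\<lambda>n. cl 0 n / pe n) \<longlonglongrightarrow> 1"
proof -
  have "(\<lambda>n. (real n * cl 0 n) / (real n * pe n)) \<longlonglongrightarrow> z1\<^sup>2 / z1\<^sup>2"
    using z1_pos by (intro tendsto_divide n_cl_0 pe_lim) simp
  moreover have "\<forall>\<^sub>F n in sequentially. (real n * cl 0 n) / (real n * pe n) = cl 0 n / pe n"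
    using eventually_gt_at_top[of 0] by eventually_elim simp
  ultimately show ?thesis using z1_pos by (simp add: Lim_transform_eventually)
qed

lemma pe_pos: "\<forall>\<^sub>F n in sequentially. 0 < pe n"
proof -
  have "\<forall>\<^sub>F n in sequentially. 0 < real n * pe n"
    by (rule order_tendstoD(1)[OF pe_lim]) (use z1_pos in simp)
  then show ?thesis by eventually_elim (simp add: zero_less_mult_iff)
qed

lemma edge_1_le_R: "edge 1 n \<le> R n"
  unfolding edge_def R_def by (rule rig.edge_degree_prob_1_le)

lemma n_edge_1: "(\<lambda>n. real n * edge 1 n) \<longlonglongrightarrow> 0"
  using edge_1_le_R edge_nonneg
  by (intro tendsto_sandwich[OF always_eventually always_eventually tendsto_const R_lim])
    (auto intro!: mult_left_mono)

lemma n_degree_1: "(\<lambda>n. real n * (edge 1 n + nonedge 1 n)) \<longlonglongrightarrow> z2 * z1\<^sup>2"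
  using tendsto_add[OF n_edge_1 nonedge_1_lim] by (simp add: distrib_left)

text \<open>Degree 1 has probability of exact order 1 / n, produced by non-adjacent pairs, while the
  adjacent ones contribute o(1 / n).\<close>

lemma cl_1_lim: "cl 1 \<longlonglongrightarrow> 0"
proof -
  have "(\<lambda>n. (real n * edge 1 n) / (real n * (edge 1 n + nonedge 1 n))) \<longlonglongrightarrow> 0 / (z2 * z1\<^sup>2)"
    using z1_pos z2_pos by (intro tendsto_divide n_edge_1 n_degree_1) simp
  moreover have "\<forall>\<^sub>F n in sequentially. (real n * edge 1 n) / (real n * (edge 1 n + nonedge 1 n)) = cl 1 n"
    using eventually_gt_at_top[of 0] by eventually_elim (simp add: cl_def)
  ultimately show ?thesis by (simp add: Lim_transform_eventually)
qed

text \<open>Non-edges have probability O(n^-2), edges at least a constant times n^-1 \<beta>^(-r/2),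
  so their quotient is O(\<beta>^(r/2) / n). For \<open>r = 2\<close> the hypothesis is \<beta> / n
  tending to 0.\<close>

lemma cl_lim_1:
  assumes r: "2 \<le> r" and lim: "(\<lambda>n. sqrt (\<beta> n) ^ r / real n) \<longlonglongrightarrow> 0"
  shows "cl r \<longlonglongrightarrow> 1"
proof -
  obtain f where f: "\<And>n. f n \<le> edge r n" "(\<lambda>n. real n * sqrt (\<beta> n) ^ r * f n) \<longlonglongrightarrow> z1 ^ (r + 2) / fact r"
    by (rule edge_lower[where r = r], rule that, assumption+)
  have pos: "0 < z1 ^ (r + 2) / fact r" using z1_pos by simp
  have "\<forall>\<^sub>F n in sequentially. 0 < real n * sqrt (\<beta> n) ^ r * f n"
    by (rule order_tendstoD(1)[OF f(2) pos])
  then have f_pos: "\<forall>\<^sub>F n in sequentially. 0 < f n"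
    using ev_regular by eventually_elim (auto elim: zero_less_mult_pos)
  define h where "h = (\<lambda>n. (real n)\<^sup>2 * (u n * rig.e2 n)\<^sup>2 / (real n * sqrt (\<beta> n) ^ r * f n) * (sqrt (\<beta> n) ^ r / real n))"
  have "h \<longlonglongrightarrow> z2 ^ 4 / (z1 ^ (r + 2) / fact r) * 0"
    unfolding h_def using pos by (intro tendsto_mult[OF tendsto_divide] u_e2_lim f(2) lim) auto
  then have h: "h \<longlonglongrightarrow> 0" by simp
  have ratio: "(\<lambda>n. nonedge r n / edge r n) \<longlonglongrightarrow> 0"
  proof (rule tendsto_sandwich[OF _ _ tendsto_const h])
    show "\<forall>\<^sub>F n in sequentially. 0 \<le> nonedge r n / edge r n"
      using edge_nonneg nonedge_nonneg by simp
    show "\<forall>\<^sub>F n in sequentially. nonedge r n / edge r n \<le> h n"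
      using f_pos ev_regular
    proof eventually_elim
      case (elim n)
      have "nonedge r n / edge r n \<le> (u n * rig.e2 n)\<^sup>2 / f n"
        using elim f(1)[of n] nonedge_nonneg rig.nonedge_degree_prob_le_square[OF r, of n "n - 2"]
        by (intro frac_le) (auto simp: nonedge_def u_def)
      also have "\<dots> = h n" using elim by (simp add: h_def power2_eq_square)
      finally show ?case .
    qed
  qed
  have "(\<lambda>n. 1 / (1 + nonedge r n / edge r n)) \<longlonglongrightarrow> 1 / (1 + 0)"
    by (intro tendsto_intros ratio) simp
  moreover have "\<forall>\<^sub>F n in sequentially. 1 / (1 + nonedge r n / edge r n) = cl r n"
    using f_pos
  proof eventually_elim
    case (elim n)
    then have "0 < edge r n" using f(1)[of n] by linarith
    then show ?case using nonedge_nonneg[of r n] by (simp add: cl_def field_simps)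
  qed
  ultimately show ?thesis by (simp add: Lim_transform_eventually)
qed

lemma cl_2_lim:
  assumes \<gamma>: "(\<lambda>n. real n / \<beta> n) \<longlonglongrightarrow> \<gamma>" "0 \<le> \<gamma>"
  shows "cl 2 \<longlonglongrightarrow> \<gamma> * z1 ^ 4 / (\<gamma> * z1 ^ 4 + z2 ^ 4)"
proof -
  have pos: "0 < \<gamma> * z1 ^ 4 + z2 ^ 4" using \<gamma> z1_pos z2_pos by (simp add: add_nonneg_pos)
  have "(\<lambda>n. ((real n)\<^sup>2 * edge 2 n) / ((real n)\<^sup>2 * edge 2 n + (real n)\<^sup>2 * nonedge 2 n)) \<longlonglongrightarrow>
      (\<gamma> * z1 ^ 4 / 2) / (\<gamma> * z1 ^ 4 / 2 + z2 ^ 4 / 2)"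
    using pos by (intro tendsto_divide tendsto_add edge_2_lim[OF \<gamma>(1)] nonedge_2_lim) auto
  moreover have "\<forall>\<^sub>F n in sequentially.
      ((real n)\<^sup>2 * edge 2 n) / ((real n)\<^sup>2 * edge 2 n + (real n)\<^sup>2 * nonedge 2 n) = cl 2 n"
    using eventually_gt_at_top[of 0] by eventually_elim (simp add: cl_def flip: distrib_left)
  ultimately have "cl 2 \<longlonglongrightarrow> (\<gamma> * z1 ^ 4 / 2) / (\<gamma> * z1 ^ 4 / 2 + z2 ^ 4 / 2)"
    by (rule Lim_transform_eventually)
  also have "(\<gamma> * z1 ^ 4 / 2) / (\<gamma> * z1 ^ 4 / 2 + z2 ^ 4 / 2) = \<gamma> * z1 ^ 4 / (\<gamma> * z1 ^ 4 + z2 ^ 4)"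
    by (simp flip: add_divide_distrib)
  finally show ?thesis .
qed

text \<open>The upper bound has the form \<open>t (1 + \<epsilon>2) + \<eta>2\<close>, the lower bound the form \<open>t (1 + \<epsilon>1)\<close>. The
  relative error is taken to be \<open>min (cl 1 / t - 1) \<epsilon>2\<close>, and what remains is at most \<open>\<eta>2\<close>.\<close>

lemma cl_1_expansion:
  defines "t \<equiv> \<lambda>n. \<beta> n powr (- 1 / 2) * (z1 / z2)"
  obtains \<epsilon> \<eta> where "\<epsilon> \<longlonglongrightarrow> 0" "\<eta> \<in> O(\<lambda>n. 1 / real n)"
    "\<forall>\<^sub>F n in sequentially. cl 1 n = t n * (1 + \<epsilon> n) + \<eta> n"
proof -
  define D where "D = (\<lambda>n. edge 1 n + nonedge 1 n)"
  have D_lim: "(\<lambda>n. real n * D n) \<longlonglongrightarrow> z2 * z1\<^sup>2" unfolding D_def by (rule n_degree_1)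
  have cl_D: "cl 1 n = edge 1 n / D n" for n by (simp add: cl_def D_def)
  have "\<forall>\<^sub>F n in sequentially. 0 < real n * D n"
    by (rule order_tendstoD(1)[OF D_lim]) (use z1_pos z2_pos in simp)
  then have D_pos: "\<forall>\<^sub>F n in sequentially. 0 < D n"
    by eventually_elim (simp add: zero_less_mult_iff)
  have t_eq: "\<forall>\<^sub>F n in sequentially. t n = z1 / z2 / sqrt (\<beta> n) \<and> 0 < t n"
    using ev_regular
  proof eventually_elim
    case (elim n)
    then have "\<beta> n powr (- 1 / 2) = 1 / sqrt (\<beta> n)"
      using powr_minus[of "\<beta> n" "1 / 2"] by (simp add: powr_half_sqrt inverse_eq_divide)
    then show ?case using z1_pos z2_pos elim by (simp add: t_def)
  qed
  obtain f where f: "\<And>n. f n \<le> edge 1 n" "(\<lambda>n. real n * sqrt (\<beta> n) ^ 1 * f n) \<longlonglongrightarrow> z1 ^ (1 + 2) / fact 1"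
    by (rule edge_lower[where r = 1], rule that, assumption+)
  have f2: "(\<lambda>n. real n * sqrt (\<beta> n) * f n) \<longlonglongrightarrow> z1 ^ 3"
    using f(2) by (simp add: numeral_3_eq_3)
  \<comment> \<open>Both relative errors divide a bound for \<open>edge 1\<close> by
    \<open>D t\<close>; the limits come out as 0 because \<open>n D\<close> tends to
    \<open>z2 z1\<^sup>2\<close> and the main terms, scaled by \<open>n sqrt \<beta>\<close>, tend
    to \<open>z1 ^ 3\<close>.\<close>
  define \<epsilon>1 where "\<epsilon>1 = (\<lambda>n. (real n * sqrt (\<beta> n) * f n) / (real n * D n) * (z2 / z1) - 1)"
  define \<epsilon>2 where "\<epsilon>2 = (\<lambda>n. (a n * sqrt (\<beta> n)) * (real n * ((rig.e1 n)\<^sup>2 / real (m n))) / (real n * D n) * (z2 / z1) - 1)"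
  \<comment> \<open>This is \<open>R' / D\<close>: order n^-2 divided by order n^-1.\<close>
  define \<eta>2 where "\<eta>2 = (\<lambda>n. ((real n)\<^sup>2 * R' n) / (real n * D n) * (1 / real n))"
  have "\<epsilon>1 \<longlonglongrightarrow> z1 ^ 3 / (z2 * z1\<^sup>2) * (z2 / z1) - 1"
    unfolding \<epsilon>1_def using z1_pos z2_pos
    by (intro tendsto_diff tendsto_mult tendsto_divide tendsto_const f2 D_lim) auto
  then have \<epsilon>1_lim: "\<epsilon>1 \<longlonglongrightarrow> 0" using z1_pos z2_pos by (simp add: power2_eq_square power3_eq_cube)
  have "\<epsilon>2 \<longlonglongrightarrow> z1 * z1\<^sup>2 / (z2 * z1\<^sup>2) * (z2 / z1) - 1"
    unfolding \<epsilon>2_def using z1_pos z2_pos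
    by (intro tendsto_diff tendsto_mult[OF tendsto_divide[OF tendsto_mult]] tendsto_const a_lim e1_square_lim D_lim) auto
  then have \<epsilon>2_lim: "\<epsilon>2 \<longlonglongrightarrow> 0" using z1_pos z2_pos by (simp add: power2_eq_square)
  have \<eta>2_O: "\<eta>2 \<in> O(\<lambda>n. 1 / real n)"
  proof -
    have "(\<lambda>n. ((real n)\<^sup>2 * R' n) / (real n * D n)) \<longlonglongrightarrow> z2 ^ 3 / (z2 * z1\<^sup>2)"
      using z1_pos z2_pos by (intro tendsto_divide R'_lim D_lim) auto
    then have "(\<lambda>n. ((real n)\<^sup>2 * R' n) / (real n * D n)) \<in> O(\<lambda>_. 1)"
      by (intro bigoI_tendsto[where c = "z2 ^ 3 / (z2 * z1\<^sup>2)"]) simp_all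
    then have "(\<lambda>n. ((real n)\<^sup>2 * R' n) / (real n * D n) * (1 / real n)) \<in> O(\<lambda>n. 1 * (1 / real n))"
      by (intro landau_o.big.mult landau_o.big_refl)
    then show ?thesis by (simp add: \<eta>2_def)
  qed
  define \<epsilon> where "\<epsilon> = (\<lambda>n. min (cl 1 n / t n - 1) (\<epsilon>2 n))"
  define \<eta> where "\<eta> = (\<lambda>n. cl 1 n - t n * (1 + \<epsilon> n))"
  have lower: "\<forall>\<^sub>F n in sequentially. \<epsilon>1 n \<le> cl 1 n / t n - 1"
    using D_pos t_eq ev_regular
  proof eventually_elim
    case (elim n)
    have "(real n * sqrt (\<beta> n) * f n) / (real n * D n) * (z2 / z1) = f n / D n / t n"
    proof -
      have "sqrt (\<beta> n) \<noteq> 0" "real n \<noteq> 0" "D n \<noteq> 0" "z1 \<noteq> 0" "z2 \<noteq> 0" "t n = z1 / z2 / sqrt (\<beta> n)"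
        using elim z1_pos z2_pos by auto
      then show ?thesis by simp
    qed
    also have "\<dots> \<le> cl 1 n / t n"
      unfolding cl_D using elim f(1)[of n]
      by (intro divide_right_mono) auto
    finally show ?case by (simp add: \<epsilon>1_def)
  qed
  have upper: "\<forall>\<^sub>F n in sequentially. cl 1 n \<le> t n * (1 + \<epsilon>2 n) + \<eta>2 n \<and> 0 \<le> \<eta>2 n"
    using D_pos t_eq ev_regular
  proof eventually_elim
    case (elim n)
    have R'0: "0 \<le> R' n" unfolding R'_def by (intro add_nonneg_nonneg mult_nonneg_nonneg a_nonneg u_nonneg) auto
    have "cl 1 n \<le> R n / D n"
      unfolding cl_D using elim edge_1_le_R by (intro divide_right_mono) auto
    also have "R n / D n = a n * ((rig.e1 n)\<^sup>2 / real (m n)) / D n + R' n / D n"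
      unfolding R_eq by (rule add_divide_distrib)
    also have "R' n / D n = \<eta>2 n" using elim by (simp add: \<eta>2_def power2_eq_square)
    also have "a n * ((rig.e1 n)\<^sup>2 / real (m n)) / D n = t n * (1 + \<epsilon>2 n)"
    proof -
      have "t n * (1 + \<epsilon>2 n) = (z1 / z2 / sqrt (\<beta> n)) *
        ((a n * sqrt (\<beta> n)) * (real n * ((rig.e1 n)\<^sup>2 / real (m n))) / (real n * D n) * (z2 / z1))"
        using elim by (simp add: \<epsilon>2_def)
      also have "\<dots> = a n * ((rig.e1 n)\<^sup>2 / real (m n)) / D n"
      proof -
        have "sqrt (\<beta> n) \<noteq> 0" "real n \<noteq> 0" "D n \<noteq> 0" "z1 \<noteq> 0" "z2 \<noteq> 0" using elim z1_pos z2_pos by auto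
        then show ?thesis by simp
      qed
      finally show ?thesis by simp
    qed
    finally have "cl 1 n \<le> t n * (1 + \<epsilon>2 n) + \<eta>2 n" .
    moreover have "0 \<le> \<eta>2 n" unfolding \<eta>2_def using R'0 elim by (intro mult_nonneg_nonneg divide_nonneg_nonneg) auto
    ultimately show ?case by simp
  qed
  have "\<epsilon> \<longlonglongrightarrow> 0"
  proof (rule tendsto_sandwich[OF _ _ _ \<epsilon>2_lim])
    show "\<forall>\<^sub>F n in sequentially. min (\<epsilon>1 n) (\<epsilon>2 n) \<le> \<epsilon> n"
      using lower by eventually_elim (auto simp: \<epsilon>_def)
    show "\<forall>\<^sub>F n in sequentially. \<epsilon> n \<le> \<epsilon>2 n" by (simp add: \<epsilon>_def)
    show "(\<lambda>n. min (\<epsilon>1 n) (\<epsilon>2 n)) \<longlonglongrightarrow> 0" using tendsto_min[OF \<epsilon>1_lim \<epsilon>2_lim] by simp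
  qed
  moreover have "\<eta> \<in> O(\<lambda>n. 1 / real n)"
  proof -
    have distr: "s * (1 + min x y) = min (s * (1 + x)) (s * (1 + y))" if "0 < s" for s x y :: real
      using that by (simp add: min_def)
    \<comment> \<open>The difference is 0 if \<open>c \<le> w\<close>, and otherwise
      \<open>c - w\<close>, which lies between 0 and \<open>e\<close>.\<close>
    have bound: "\<bar>c - min c w\<bar> \<le> \<bar>e\<bar>" if "c \<le> w + e" "0 \<le> e" for c w e :: real
      using that by (auto simp: min_def)
    have "\<forall>\<^sub>F n in sequentially. norm (\<eta> n) \<le> 1 * norm (\<eta>2 n)"
      using upper t_eq
    proof eventually_elim
      case (elim n)
      have "t n * (1 + \<epsilon> n) = min (t n * (1 + (cl 1 n / t n - 1))) (t n * (1 + \<epsilon>2 n))"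
        using elim unfolding \<epsilon>_def by (intro distr) simp
      also have "t n * (1 + (cl 1 n / t n - 1)) = cl 1 n"
      proof -
        have "0 < t n" using elim by blast
        then show ?thesis by simp
      qed
      finally have \<eta>_eq: "\<eta> n = cl 1 n - min (cl 1 n) (t n * (1 + \<epsilon>2 n))" by (simp add: \<eta>_def)
      show ?case unfolding \<eta>_eq real_norm_def mult_1 using elim by (intro bound) blast+
    qed
    then have "\<eta> \<in> O(\<eta>2)" by (rule bigoI)
    then show ?thesis using \<eta>2_O by (rule landau_o.big_trans)
  qed
  moreover have "\<forall>\<^sub>F n in sequentially. cl 1 n = t n * (1 + \<epsilon> n) + \<eta> n" by (simp add: \<eta>_def)
  ultimately show ?thesis by (rule that)
qed


end

text \<open>The hypotheses speak of vertex 1 in the graph, the estimates of the size law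
  \<open>P\<close>. Finite support makes every Borel function integrable, also in the degenerate
  case \<open>n = 0\<close>.\<close>

lemma distr_card_integral:
  fixes f :: "real \<Rightarrow> real" and P :: "nat pmf" and n m :: nat and c :: real
  assumes P: "set_pmf P \<subseteq> {..m}" and f: "f \<in> borel_measurable borel"
  defines "\<nu> \<equiv> distr (measure_pmf (active_rig n m P)) borel (\<lambda>D. real (card (D 1)) * c)"
  shows "integrable \<nu> f" and "1 \<le> n \<Longrightarrow> integral\<^sup>L \<nu> f = measure_pmf.expectation P (\<lambda>k. f (real k * c))"
proof -
  interpret random_attribute_set m P by standard fact
  have "finite (set_pmf (map_pmf (\<lambda>D. D 1) (active_rig n m P)))"
    unfolding active_rig_def by (subst Pi_pmf_component) (auto simp: finite_set_attribute_set_pmf)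
  then have "integrable (measure_pmf (map_pmf (\<lambda>D. D 1) (active_rig n m P))) (\<lambda>A. f (real (card A) * c))"
    by (rule integrable_measure_pmf_finite)
  then show "integrable \<nu> f"
    unfolding \<nu>_def using f by (subst integrable_distr_eq) (simp_all add: integrable_map_pmf_eq)
  assume "1 \<le> n"
  then show "integral\<^sup>L \<nu> f = measure_pmf.expectation P (\<lambda>k. f (real k * c))"
    unfolding \<nu>_def using f expectation_card[of n "\<lambda>k. f (real k * c)"]
    by (subst integral_distr) simp_all
qed

theorem theorem2:
  fixes m :: "nat \<Rightarrow> nat" and P :: "nat \<Rightarrow> nat pmf"
    and M :: "'a measure" and Z :: "'a \<Rightarrow> real"
    and \<beta> :: "nat \<Rightarrow> real" and z :: "nat \<Rightarrow> real" and \<delta> :: "nat \<Rightarrow> real"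
    and cl :: "nat \<Rightarrow> nat \<Rightarrow> real" and p\<^sub>e :: "nat \<Rightarrow> real"
  assumes \<beta>_def: "\<And>n. \<beta> n = real (m n) / real n"
    and z_def: "\<And>k. z k = (\<integral>\<omega>. Z \<omega> ^ k \<partial>M)"
    and \<delta>_def: "\<And>k. \<delta> k =
          measure_pmf.expectation (mixed_poisson M (\<lambda>\<omega>. z 1 * Z \<omega>)) (\<lambda>j. real j ^ k)"
    and cl_def: "\<And>n r. cl n r = clustering_fun n (m n) (P n) r"
    and p\<^sub>e_def: "\<And>n. p\<^sub>e n = edge_prob n (m n) (P n)"
  assumes m_at_top: "filterlim m at_top sequentially"
    and P_support: "\<And>n. set_pmf (P n) \<subseteq> {..m n}"
    and Z_space: "prob_space M"
    and Z_measurable: "Z \<in> borel_measurable M"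
    and cond_i: "weak_conv_m
          (\<lambda>n. distr (measure_pmf (active_rig n (m n) (P n))) borel
                  (\<lambda>D. real (card (D 1)) * sqrt (real n / real (m n))))
          (distr M borel Z)"
    and cond_ii_integrable: "integrable M (\<lambda>\<omega>. Z \<omega> ^ 2)"
    and cond_ii_limit:
      "(\<lambda>n. measure_pmf.expectation (active_rig n (m n) (P n))
               (\<lambda>D. (real (card (D 1)) * sqrt (real n / real (m n))) ^ 2))
         \<longlonglongrightarrow> (\<integral>\<omega>. Z \<omega> ^ 2 \<partial>M)"
    and EZ_pos: "(\<integral>\<omega>. Z \<omega> \<partial>M) > 0"
    and \<beta>_at_top: "filterlim \<beta> at_top sequentially"
  shows
    "(\<exists>\<epsilon>\<in>o(\<lambda>_. 1). \<forall>\<^sub>F n in sequentially. cl n 0 = p\<^sub>e n * (1 + \<epsilon> n)) \<and>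
     (\<exists>\<epsilon>\<in>o(\<lambda>_. 1). \<exists>\<eta>\<in>O(\<lambda>n. 1 / real n). \<forall>\<^sub>F n in sequentially.
        cl n 1 = \<beta> n powr (- 1 / 2) * (z 1 / z 2) * (1 + \<epsilon> n) + \<eta> n) \<and>
     (\<lambda>n. cl n 0) \<in> O(\<lambda>n. 1 / real n) \<and>
     (\<lambda>n. cl n 1) \<in> o(\<lambda>_. 1) \<and>
     ((\<lambda>n. \<beta> n / real n) \<longlonglongrightarrow> 0 \<longrightarrow> (\<lambda>n. cl n 2) \<longlonglongrightarrow> 1) \<and>
     (\<forall>b>0. (\<lambda>n. \<beta> n / real n) \<longlonglongrightarrow> b \<longrightarrow>
        (\<lambda>n. cl n 2) \<longlonglongrightarrow> 1 / (1 + b * (\<delta> 2 - \<delta> 1) ^ 4 / \<delta> 1 ^ 6)) \<and>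
     (filterlim (\<lambda>n. \<beta> n / real n) at_top sequentially \<longrightarrow> (\<lambda>n. cl n 2) \<longlonglongrightarrow> 0) \<and>
     ((\<forall>k\<ge>1. (\<lambda>n. \<beta> n ^ k) \<in> o(\<lambda>n. real n)) \<longrightarrow> (\<forall>r\<ge>2. (\<lambda>n. cl n r) \<longlonglongrightarrow> 1))"
proof -
  interpret Z: prob_space M by (rule Z_space)
  have Z_meas [measurable]: "Z \<in> borel_measurable M" by (rule Z_measurable)
  define \<nu> where "\<nu> = (\<lambda>n. distr (measure_pmf (active_rig n (m n) (P n))) borel
      (\<lambda>D. real (card (D 1)) * sqrt (real n / real (m n))))"
  have sqrt_eq: "sqrt (real n / real (m n)) = 1 / sqrt (\<beta> n)" for n
    by (simp add: \<beta>_def real_sqrt_divide)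
  have \<nu>_integrable: "integrable (\<nu> n) f" if "f \<in> borel_measurable borel" for n and f :: "real \<Rightarrow> real"
    unfolding \<nu>_def by (rule distr_card_integral(1)[OF P_support that])
  have \<nu>_integral: "integral\<^sup>L (\<nu> n) f = measure_pmf.expectation (P n) (\<lambda>k. f (real k / sqrt (\<beta> n)))"
    if "f \<in> borel_measurable borel" "1 \<le> n" for n and f :: "real \<Rightarrow> real"
    unfolding \<nu>_def sqrt_eq
    using distr_card_integral(2)[OF P_support that, where c = "1 / sqrt (\<beta> n)"] by simp
  have \<nu>_distr: "real_distribution (\<nu> n)" for n
    unfolding \<nu>_def by (intro prob_space.real_distribution_distr measure_pmf.prob_space_axioms) simp
  have \<mu>_distr: "real_distribution (distr M borel Z)"
    by (intro Z.real_distribution_distr) measurable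
  have conv: "weak_conv_m \<nu> (distr M borel Z)"
    using cond_i by (simp add: \<nu>_def)
  have second_\<nu>: "(\<integral>x. x\<^sup>2 \<partial>\<nu> n) = measure_pmf.expectation (active_rig n (m n) (P n))
      (\<lambda>D. (real (card (D 1)) * sqrt (real n / real (m n))) ^ 2)" for n
    unfolding \<nu>_def by (subst integral_distr) auto
  have second_\<mu>: "(\<integral>x. x\<^sup>2 \<partial>distr M borel Z) = z 2" and first_\<mu>: "(\<integral>x. x \<partial>distr M borel Z) = z 1"
    by (subst integral_distr; simp add: z_def)+
  interpret W: weak_conv_second_moment \<nu> "distr M borel Z"
  proof (rule weak_conv_second_moment.intro)
    show "(\<lambda>n. \<integral>x. x\<^sup>2 \<partial>\<nu> n) \<longlonglongrightarrow> (\<integral>x. x\<^sup>2 \<partial>distr M borel Z)"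
      unfolding second_\<nu> second_\<mu> using cond_ii_limit by (simp add: z_def)
    show "integrable (distr M borel Z) (\<lambda>x. x\<^sup>2)"
      using cond_ii_integrable by (subst integrable_distr_eq) auto
    show "integrable (\<nu> n) (\<lambda>x. x\<^sup>2)" for n by (rule \<nu>_integrable) measurable
  qed (rule \<nu>_distr \<mu>_distr conv)+
  have Z_int: "integrable M Z"
    by (rule Z.square_integrable_imp_integrable) (use cond_ii_integrable in auto)
  have z1_pos: "0 < z 1" using EZ_pos by (simp add: z_def)
  \<comment> \<open>Nonnegativity of the variance; it turns the positive mean into a positive second
    moment.\<close>
  have "(z 1)\<^sup>2 \<le> z 2"
    using Z.variance_eq[OF Z_int cond_ii_integrable] Z.variance_positive[of Z] by (simp add: z_def)
  with zero_less_power[OF z1_pos] have z2_pos: "0 < z 2" by (rule less_le_trans)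
  have \<beta>_pos: "\<forall>\<^sub>F n in sequentially. 1 \<le> \<beta> n \<and> 2 \<le> n"
    using filterlim_at_top[THEN iffD1, OF \<beta>_at_top, rule_format, of 1] eventually_ge_at_top[of 2]
    by eventually_elim simp
  interpret G: random_attribute_sets_limit m P \<beta> "z 1" "z 2"
  proof
    show "\<beta> n = real (m n) / real n" "set_pmf (P n) \<subseteq> {..m n}" for n by (rule \<beta>_def P_support)+
    show "filterlim \<beta> at_top sequentially" "0 < z 1" "0 < z 2" by fact+
    have "\<forall>\<^sub>F n in sequentially. (\<integral>x. x \<partial>\<nu> n) = measure_pmf.expectation (P n) real / sqrt (\<beta> n)"
      using \<beta>_pos by eventually_elim (simp add: \<nu>_integral)
    then show "(\<lambda>n. measure_pmf.expectation (P n) real / sqrt (\<beta> n)) \<longlonglongrightarrow> z 1"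
      using W.first_moment unfolding first_\<mu> by (rule Lim_transform_eventually[rotated])
    have "\<forall>\<^sub>F n in sequentially. (\<integral>x. x\<^sup>2 \<partial>\<nu> n) = measure_pmf.expectation (P n) (\<lambda>k. (real k)\<^sup>2) / \<beta> n"
      using \<beta>_pos by eventually_elim (simp add: \<nu>_integral power_divide)
    then show "(\<lambda>n. measure_pmf.expectation (P n) (\<lambda>k. (real k)\<^sup>2) / \<beta> n) \<longlonglongrightarrow> z 2"
      using W.moment unfolding second_\<mu> by (rule Lim_transform_eventually[rotated])
    fix \<epsilon> :: real assume "0 < \<epsilon>"
    then obtain K where K: "1 \<le> K" and t: "\<forall>\<^sub>F n in sequentially. (\<integral>x. x\<^sup>2 * of_bool (K < \<bar>x\<bar>) \<partial>\<nu> n) < \<epsilon>"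
      by (rule W.uniform_tail)
    have "\<forall>\<^sub>F n in sequentially. measure_pmf.expectation (P n)
        (\<lambda>k. (real k)\<^sup>2 * of_bool (K * sqrt (\<beta> n) < real k)) / \<beta> n < \<epsilon>"
      using t \<beta>_pos
    proof eventually_elim
      case (elim n)
      have "(\<integral>x. x\<^sup>2 * of_bool (K < \<bar>x\<bar>) \<partial>\<nu> n) = measure_pmf.expectation (P n)
          (\<lambda>k. (real k / sqrt (\<beta> n))\<^sup>2 * of_bool (K < \<bar>real k / sqrt (\<beta> n)\<bar>))"
        using elim by (intro \<nu>_integral) auto
      also have "\<dots> = measure_pmf.expectation (P n)
          (\<lambda>k. (real k)\<^sup>2 * of_bool (K * sqrt (\<beta> n) < real k) / \<beta> n)"
        using elim by (intro Bochner_Integration.integral_cong refl)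
          (simp add: power_divide pos_less_divide_eq)
      finally show ?case using elim by simp
    qed
    with K show "\<exists>K\<ge>1. \<forall>\<^sub>F n in sequentially. measure_pmf.expectation (P n)
        (\<lambda>k. (real k)\<^sup>2 * of_bool (K * sqrt (\<beta> n) < real k)) / \<beta> n < \<epsilon>" by blast
  qed
  have cl_eq: "cl n r = G.cl r n" if "2 \<le> n" for n r
    unfolding cl_def G.cl_def G.edge_def G.nonedge_def by (rule G.rig.clustering_fun_eq[OF that])
  have ev_cl: "\<forall>\<^sub>F n in sequentially. cl n r = G.cl r n" for r
    using eventually_ge_at_top[of 2] by eventually_elim (rule cl_eq)
  have ev_pe: "\<forall>\<^sub>F n in sequentially. p\<^sub>e n = G.pe n"
    using eventually_ge_at_top[of 2] unfolding p\<^sub>e_def G.pe_def G.rig.two_edge_prob_def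
    by eventually_elim (rule G.rig.edge_prob_eq)
  have cl_tendsto: "(\<lambda>n. cl n r) \<longlonglongrightarrow> l" if "G.cl r \<longlonglongrightarrow> l" for r l
    using that tendsto_cong[OF ev_cl] by blast

  \<comment> \<open>The sign of \<open>Z\<close> is inherited in the limit from the set sizes;
    without it the mixed Poisson formula would not define a distribution.\<close>
  have Z_nonneg: "AE \<omega> in M. 0 \<le> Z \<omega>"
  proof -
    have "AE x in distr M borel Z. 0 \<le> x"
      using \<nu>_distr \<mu>_distr conv
    proof (rule weak_conv_limit_nonneg)
      show "AE x in \<nu> n. 0 \<le> x" for n
        unfolding \<nu>_def by (subst AE_distr_iff) auto
    qed
    then show ?thesis by (subst (asm) AE_distr_iff) auto
  qed
  have rate_nonneg: "AE \<omega> in M. 0 \<le> z 1 * Z \<omega>"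
    using Z_nonneg by eventually_elim (use z1_pos in simp)
  have \<delta>1: "\<delta> 1 = (z 1)\<^sup>2"
  proof -
    have "\<delta> 1 = (\<integral>\<omega>. z 1 * Z \<omega> \<partial>M)"
      unfolding \<delta>_def using rate_nonneg poisson_first_moment_sums
      by (intro expectation_mixed_poisson[where h = "\<lambda>y. y"] Z_space) auto
    then show ?thesis by (simp add: z_def power2_eq_square)
  qed
  \<comment> \<open>At rate \<open>y\<close> the Poisson second moment is
    \<open>y\<^sup>2 + y\<close>; subtracting \<open>\<delta> 1\<close> leaves the mean of
    \<open>(z 1 * Z)\<^sup>2\<close>.\<close>
  have \<delta>2: "\<delta> 2 - \<delta> 1 = (z 1)\<^sup>2 * z 2"
  proof -
    have "\<delta> 2 = (\<integral>\<omega>. (z 1 * Z \<omega>)\<^sup>2 + z 1 * Z \<omega> \<partial>M)"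
      unfolding \<delta>_def using rate_nonneg poisson_second_moment_sums
      by (intro expectation_mixed_poisson[where h = "\<lambda>y. y\<^sup>2 + y"] Z_space) auto
    also have "\<dots> = (z 1)\<^sup>2 * z 2 + z 1 * (\<integral>\<omega>. Z \<omega> \<partial>M)"
      using Z_int cond_ii_integrable by (simp add: power_mult_distrib z_def)
    finally show ?thesis unfolding \<delta>1 by (simp add: z_def power2_eq_square)
  qed

  have part1: "\<exists>\<epsilon>\<in>o(\<lambda>_. 1). \<forall>\<^sub>F n in sequentially. cl n 0 = p\<^sub>e n * (1 + \<epsilon> n)"
  proof
    show "(\<lambda>n. G.cl 0 n / G.pe n - 1) \<in> o(\<lambda>_. 1)"
      using tendsto_diff[OF G.cl_0_ratio tendsto_const[of 1]] by (intro smalloI_tendsto) simp_all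
    show "\<forall>\<^sub>F n in sequentially. cl n 0 = p\<^sub>e n * (1 + (G.cl 0 n / G.pe n - 1))"
      using ev_cl[of 0] ev_pe G.pe_pos by eventually_elim simp
  qed
  have part2: "\<exists>\<epsilon>\<in>o(\<lambda>_. 1). \<exists>\<eta>\<in>O(\<lambda>n. 1 / real n). \<forall>\<^sub>F n in sequentially.
        cl n 1 = \<beta> n powr (- 1 / 2) * (z 1 / z 2) * (1 + \<epsilon> n) + \<eta> n"
  proof -
    obtain \<epsilon> \<eta> where \<epsilon>: "\<epsilon> \<longlonglongrightarrow> 0" and \<eta>: "\<eta> \<in> O(\<lambda>n. 1 / real n)"
      and eq: "\<forall>\<^sub>F n in sequentially. G.cl 1 n = \<beta> n powr (- 1 / 2) * (z 1 / z 2) * (1 + \<epsilon> n) + \<eta> n"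
      by (rule G.cl_1_expansion)
    have "\<epsilon> \<in> o(\<lambda>_. 1)" using \<epsilon> by (intro smalloI_tendsto) simp_all
    moreover have "\<forall>\<^sub>F n in sequentially. cl n 1 = \<beta> n powr (- 1 / 2) * (z 1 / z 2) * (1 + \<epsilon> n) + \<eta> n"
      using eq ev_cl[of 1] by eventually_elim (simp only:)
    ultimately show ?thesis using \<eta> by blast
  qed
  have part3: "(\<lambda>n. cl n 0) \<in> O(\<lambda>n. 1 / real n)"
  proof (rule bigoI_tendsto)
    have "\<forall>\<^sub>F n in sequentially. real n * G.cl 0 n = cl n 0 / (1 / real n)"
      using ev_cl[of 0] by eventually_elim simp
    with G.n_cl_0 show "(\<lambda>n. cl n 0 / (1 / real n)) \<longlonglongrightarrow> (z 1)\<^sup>2"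
      by (rule Lim_transform_eventually)
    show "\<forall>\<^sub>F n in sequentially. 1 / real n \<noteq> 0"
      using eventually_gt_at_top[of 0] by eventually_elim simp
  qed
  have part4: "(\<lambda>n. cl n 1) \<in> o(\<lambda>_. 1)"
    using cl_tendsto[OF G.cl_1_lim] by (intro smalloI_tendsto) simp_all
  have ev_sqrt: "\<forall>\<^sub>F n in sequentially. \<beta> n / real n = sqrt (\<beta> n) ^ 2 / real n"
    using \<beta>_pos by eventually_elim simp
  have part5: "(\<lambda>n. cl n 2) \<longlonglongrightarrow> 1" if "(\<lambda>n. \<beta> n / real n) \<longlonglongrightarrow> 0"
    using Lim_transform_eventually[OF that ev_sqrt] by (intro cl_tendsto G.cl_lim_1) simp_all
  have part6: "(\<lambda>n. cl n 2) \<longlonglongrightarrow> 1 / (1 + b * (\<delta> 2 - \<delta> 1) ^ 4 / \<delta> 1 ^ 6)"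
    if b: "0 < b" and lim: "(\<lambda>n. \<beta> n / real n) \<longlonglongrightarrow> b" for b
  proof -
    have "(\<lambda>n. 1 / (\<beta> n / real n)) \<longlonglongrightarrow> 1 / b" using b by (intro tendsto_intros lim) simp
    then have "(\<lambda>n. real n / \<beta> n) \<longlonglongrightarrow> 1 / b" by simp
    then have "G.cl 2 \<longlonglongrightarrow> 1 / b * z 1 ^ 4 / (1 / b * z 1 ^ 4 + z 2 ^ 4)"
      using b by (intro G.cl_2_lim) simp_all
    also have "1 / b * z 1 ^ 4 / (1 / b * z 1 ^ 4 + z 2 ^ 4) = 1 / (1 + b * (z 2 ^ 4 / z 1 ^ 4))"
      using b z1_pos by (simp add: divide_simps mult.commute)
    also have "z 2 ^ 4 / z 1 ^ 4 = (\<delta> 2 - \<delta> 1) ^ 4 / \<delta> 1 ^ 6"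
    proof -
      have "(\<delta> 2 - \<delta> 1) ^ 4 / \<delta> 1 ^ 6 = (z 1 ^ 8 * z 2 ^ 4) / z 1 ^ 12"
        unfolding \<delta>2 unfolding \<delta>1 by (simp add: power_mult_distrib flip: power_mult power_add)
      also have "z 1 ^ 12 = z 1 ^ 8 * z 1 ^ 4" by (simp flip: power_add)
      also have "z 1 ^ 8 * z 2 ^ 4 / (z 1 ^ 8 * z 1 ^ 4) = z 2 ^ 4 / z 1 ^ 4"
        using z1_pos by (intro mult_divide_mult_cancel_left) simp
      finally show ?thesis by (rule sym)
    qed
    finally show ?thesis by (intro cl_tendsto) simp
  qed
  have part7: "(\<lambda>n. cl n 2) \<longlonglongrightarrow> 0" if lim: "filterlim (\<lambda>n. \<beta> n / real n) at_top sequentially"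
  proof -
    have "(\<lambda>n. 1 / (\<beta> n / real n)) \<longlonglongrightarrow> 0"
      by (intro tendsto_divide_0[OF tendsto_const] filterlim_at_top_imp_at_infinity lim)
    then have "(\<lambda>n. real n / \<beta> n) \<longlonglongrightarrow> 0" by simp
    from G.cl_2_lim[OF this] show ?thesis by (intro cl_tendsto) simp
  qed
  have part8: "(\<lambda>n. cl n r) \<longlonglongrightarrow> 1" if small: "\<forall>k\<ge>1. (\<lambda>n. \<beta> n ^ k) \<in> o(\<lambda>n. real n)" and r: "2 \<le> r" for r
  proof (intro cl_tendsto G.cl_lim_1 r)
    have "(\<lambda>n. \<beta> n ^ r) \<in> o(\<lambda>n. real n)" using small r by simp
    then have lim: "(\<lambda>n. \<beta> n ^ r / real n) \<longlonglongrightarrow> 0" by (rule smalloD_tendsto)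
    \<comment> \<open>The exponent \<open>k = r\<close> of the hypothesis is more than the needed
      \<open>r / 2\<close>; as eventually \<open>\<beta> \<ge> 1\<close>, the root is dominated by
      \<open>\<beta>\<close> itself.\<close>
    show "(\<lambda>n. sqrt (\<beta> n) ^ r / real n) \<longlonglongrightarrow> 0"
    proof (rule tendsto_sandwich[OF _ _ tendsto_const lim])
      show "\<forall>\<^sub>F n in sequentially. 0 \<le> sqrt (\<beta> n) ^ r / real n"
        using \<beta>_pos by eventually_elim simp
      show "\<forall>\<^sub>F n in sequentially. sqrt (\<beta> n) ^ r / real n \<le> \<beta> n ^ r / real n"
        using \<beta>_pos
      proof eventually_elim
        case (elim n)
        then have "sqrt (\<beta> n) * 1 \<le> sqrt (\<beta> n) * sqrt (\<beta> n)" by (intro mult_left_mono) auto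
        with elim show ?case by (intro divide_right_mono power_mono) auto
      qed
    qed
  qed
  show ?thesis
    using part1 part2 part3 part4 part5 part6 part7 part8 by blast
qed

end
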